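(* Let $J\subset(0,\infty)$ be an interval, $\Lambda,\lambda>0$, $\alpha,s\in\mathbb R$ with $\alpha\ne-2$. Let $g:(0,\infty)\to\mathbb R$ be of class $\mathcal C^2$ and assume that $|g'(y)|\ge\lambda y^{\alpha+1}$ and $|g''(y)|\ge\lambda y^{\alpha}$ on $J$. (1) If $\alpha>s>-2$ or $\alpha<s<-2$, there exists $C>0$ such that for any $t\in\mathbb R\setminus\{0\}$ and any $\delta>0$, $$\sum_{k\in\mathbb Z_J}\sup_{x\in\mathbb R^2}|I^{s}_{t,x,k}|\le C\,\frac{\delta^{-\frac{(\alpha+1)(s+2)}{2+\alpha}}}{|t|^{\frac{s+2}{2+\alpha}}},\qquad \sup_{x\in\mathbb R^2}\Big|\int_{\mathbb R^2}e^{ix\cdot\xi}e^{i\frac t\delta g(\delta|\xi|)}\sum_{k\in\mathbb Z_J}Q_k(\delta|\xi|)|\xi|^{s}d\xi\Big|\le C\,\frac{\delta^{-\frac{(\alpha+1)(s+2)}{2+\alpha}}}{|t|^{\frac{s+2}{2+\alpha}}}.$$ (2) If $s=\alpha$ and $\alpha\notin\{-2,-1\}$, assuming furthermore that $g$ is $\mathcal C^3$, that $|g'(y)|\le\Lambda y^{\alpha+1}$, $|g''(y)|\le\Lambda y^{\alpha}$ and $|g'''(y)|\le\Lambda y^{\alpha-1}$ on $J$, there exists $C>0$ such that for any $t\in\mathbb R\setminus\{0\}$ and any $\delta>0$, $$\sup_{x\in\mathbb R^2}\ \sum_{k\in\mathbb Z_J}|I^{\alpha}_{t,x,k}|\le C\,\frac{\delta^{-(\alpha+1)}}{|t|},\qquad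 \sup_{x\in\mathbb R^2}\Big|\int_{\mathbb R^2}e^{ix\cdot\xi}e^{i\frac t\delta g(\delta|\xi|)}\sum_{k\in\mathbb Z_J}Q_k(\delta|\xi|)|\xi|^{\alpha}d\xi\Big|\le C\,\frac{\delta^{-(\alpha+1)}}{|t|}.$$
   Context: Dimension $n=2$. $P$ is a fixed smooth even function on $\mathbb R$ supported in $[-2,-\tfrac12]\cup[\tfrac12,2]$, and for $t\in\mathbb R$, $x\in\mathbb R^2$, $s\in\mathbb R$, $k\in\mathbb Z$, $\delta>0$, $$I^{s}_{t,x,k}:=\int_{\mathbb R^2}e^{ix\cdot\xi}e^{i\frac t\delta g(\delta|\xi|)}P\big(\tfrac{\delta|\xi|}{2^k}\big)|\xi|^{s}\,d\xi.$$ $\mathbb Z_J:=\{k\in\mathbb Z:\ [2^{k-1},2^{k+1}]\subset J\}$. Littlewood-Paley functions: $\varphi_0$ is a fixed smooth nonnegative even function supported in $[-\tfrac45,\tfrac45]$, equal to $1$ on $[-\tfrac35,\tfrac35]$ and nonincreasing on $[0,\infty)$; $Q_j(y):=\varphi_0(2^{-j-1}y)-\varphi_0(2^{-j}y)$. When the integral containing $\sum_{k\in\mathbb Z_J}Q_k$ is not absolutely convergent it is understood as the sum over $k\in\mathbb Z_J$ of the integrals with $Q_k$. Constants $C$ do not depend on $t,\delta,x$. *)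

theory Defs
  imports "HOL-Analysis.Analysis"
begin

text \<open>Classes \<open>C\<^sup>k\<close> and \<open>C\<^sup>\<infinity>\<close> of real functions; only meant for open \<open>U\<close>, where the iterated \<^const>\<open>deriv\<close>
  is the iterated derivative of the restriction of \<open>f\<close> to \<open>U\<close>.\<close>

definition C_k_on :: "nat \<Rightarrow> (real \<Rightarrow> real) \<Rightarrow> real set \<Rightarrow> bool" where
  "C_k_on k f U \<longleftrightarrow>
     (\<forall>i<k. (deriv ^^ i) f differentiable_on U) \<and> continuous_on U ((deriv ^^ k) f)"

definition smooth_on :: "(real \<Rightarrow> real) \<Rightarrow> real set \<Rightarrow> bool" where
  "smooth_on f U \<longleftrightarrow> (\<forall>k. C_k_on k f U)"

definition supported_in :: "(real \<Rightarrow> real) \<Rightarrow> real set \<Rightarrow> bool" where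
  "supported_in f S \<longleftrightarrow> closure (support_on UNIV f) \<subseteq> S"

definition annular_cutoff :: "(real \<Rightarrow> real) \<Rightarrow> bool" where
  "annular_cutoff P \<longleftrightarrow>
     smooth_on P UNIV \<and> (\<forall>y. P (- y) = P y) \<and> supported_in P ({-2..-1/2} \<union> {1/2..2})"

definition lp_generator :: "(real \<Rightarrow> real) \<Rightarrow> bool" where
  "lp_generator \<phi> \<longleftrightarrow>
     smooth_on \<phi> UNIV \<and> (\<forall>y. 0 \<le> \<phi> y) \<and> (\<forall>y. \<phi> (- y) = \<phi> y) \<and>
     supported_in \<phi> {-4/5..4/5} \<and> (\<forall>y\<in>{-3/5..3/5}. \<phi> y = 1) \<and> antimono_on {0..} \<phi>"

definition lp_Q :: "(real \<Rightarrow> real) \<Rightarrow> int \<Rightarrow> real \<Rightarrow> real" where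
  "lp_Q \<phi> j y = \<phi> (2 powi (- j - 1) * y) - \<phi> (2 powi (- j) * y)"

definition dyadic_indices :: "real set \<Rightarrow> int set" where
  "dyadic_indices J = {k. {2 powi (k - 1)..2 powi (k + 1)} \<subseteq> J}"

text \<open>The integrand and the integral with a general radial cutoff \<open>h(\<delta>|\<xi>|)\<close>. The value of \<open>g\<close> outside
  \<open>(0,\<infinity>)\<close> is irrelevant, since \<open>\<xi> = 0\<close> is a null set.\<close>

definition osc_integrand ::
  "(real \<Rightarrow> real) \<Rightarrow> (real \<Rightarrow> real) \<Rightarrow> real \<Rightarrow> real \<Rightarrow> real \<Rightarrow> real^2 \<Rightarrow> real^2 \<Rightarrow> complex" where
  "osc_integrand g h s t \<delta> x \<xi> =
     exp (\<i> * complex_of_real (x \<bullet> \<xi>)) *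
     exp (\<i> * complex_of_real (t / \<delta> * g (\<delta> * norm \<xi>))) *
     complex_of_real (h (\<delta> * norm \<xi>)) * complex_of_real (norm \<xi> powr s)"

definition osc_integral ::
  "(real \<Rightarrow> real) \<Rightarrow> (real \<Rightarrow> real) \<Rightarrow> real \<Rightarrow> real \<Rightarrow> real \<Rightarrow> real^2 \<Rightarrow> complex" where
  "osc_integral g h s t \<delta> x = (LINT \<xi>|lborel. osc_integrand g h s t \<delta> x \<xi>)"

definition I_dyadic ::
  "(real \<Rightarrow> real) \<Rightarrow> (real \<Rightarrow> real) \<Rightarrow> real \<Rightarrow> real \<Rightarrow> real \<Rightarrow> real^2 \<Rightarrow> int \<Rightarrow> complex" where
  "I_dyadic g P s t \<delta> x k = osc_integral g (\<lambda>y. P (y / 2 powi k)) s t \<delta> x"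

text \<open>At each point at most two of the \<open>Q\<^sub>k\<close> are nonzero, so the infinite sum is pointwise finite.\<close>

definition lp_sum :: "(real \<Rightarrow> real) \<Rightarrow> real set \<Rightarrow> real \<Rightarrow> real" where
  "lp_sum \<phi> J y = (\<Sum>\<^sub>\<infinity>k\<in>dyadic_indices J. lp_Q \<phi> k y)"

text \<open>The integral with cutoff \<open>\<Sum>\<^sub>k Q\<^sub>k\<close>: the Lebesgue integral if it converges absolutely, otherwise
  the sum over \<open>k\<close> of the integrals with \<open>Q\<^sub>k\<close>. The companion predicate says that this
  prescription makes sense, ruling out the default value of a divergent \<^const>\<open>infsum\<close>.\<close>

definition lp_integral ::
  "(real \<Rightarrow> real) \<Rightarrow> (real \<Rightarrow> real) \<Rightarrow> real set \<Rightarrow> real \<Rightarrow> real \<Rightarrow> real \<Rightarrow> real^2 \<Rightarrow> complex" where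
  "lp_integral g \<phi> J s t \<delta> x =
     (if integrable lborel (osc_integrand g (lp_sum \<phi> J) s t \<delta> x)
      then osc_integral g (lp_sum \<phi> J) s t \<delta> x
      else (\<Sum>\<^sub>\<infinity>k\<in>dyadic_indices J. osc_integral g (lp_Q \<phi> k) s t \<delta> x))"

definition lp_integral_converges ::
  "(real \<Rightarrow> real) \<Rightarrow> (real \<Rightarrow> real) \<Rightarrow> real set \<Rightarrow> real \<Rightarrow> real \<Rightarrow> real \<Rightarrow> real^2 \<Rightarrow> bool" where
  "lp_integral_converges g \<phi> J s t \<delta> x \<longleftrightarrow>
     integrable lborel (osc_integrand g (lp_sum \<phi> J) s t \<delta> x) \<or>
     (\<lambda>k. osc_integral g (lp_Q \<phi> k) s t \<delta> x) summable_on dyadic_indices J"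

end

theory Submission
  imports Defs
begin

text \<open>In polar coordinates, and after rescaling \<open>|\<xi>|\<close> to \<open>[1/2, 2]\<close>, a dyadic piece becomes a one-dimensional
  integral whose phase \<open>\<Phi>\<close> has first and second derivatives of size at least
  \<open>T\<^sub>k = |t| 2\<^bsup>k(\<alpha>+2)\<^esup> / \<delta>\<close>, multiplied by the Bessel function \<open>J\<^sub>0(r \<rho>)\<close> with \<open>r = |x| 2\<^sup>k / \<delta>\<close>. If \<open>r\<close> is small
  against \<open>T\<^sub>k\<close>, the phase \<open>\<Phi>(\<rho>) + r \<rho> cos \<theta>\<close> is nonstationary for every angle. Otherwise \<open>J\<^sub>0\<close> contributes
  \<open>r\<^bsup>-1/2\<^esup>\<close> and phases \<open>\<Phi>(\<rho>) \<plusminus> r \<rho>\<close>, and the second derivative test gives another \<open>T\<^sub>k\<^bsup>-1/2\<^esup>\<close>. Hence a piece is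
  at most a constant times \<open>(2\<^sup>k/\<delta>)\<^bsup>s+2\<^esup> min(1, 1/T\<^sub>k)\<close>, which sums geometrically from both sides of \<open>T\<^sub>k = 1\<close> when
  \<open>0 < (s+2)/(\<alpha>+2) < 1\<close>. In the critical case \<open>s = \<alpha>\<close> the pieces with \<open>T\<^sub>k \<ge> 1\<close> gain an extra \<open>T\<^sub>k\<^bsup>-1/2\<^esup>\<close> unless
  \<open>r\<close> and \<open>T\<^sub>k\<close> are comparable, which for fixed \<open>x\<close> happens for boundedly many \<open>k\<close> as \<open>\<alpha> \<noteq> -1\<close>.\<close>

section \<open>Van der Corput estimates\<close>

text \<open>With only two derivatives of g at hand in part (1), integration by parts must not
  differentiate \<Phi>''. The lower bound on |g''| together with continuity fixes the sign of
  \<Phi>''. Adding r \<rho> cos \<theta> or \<plusminus> r \<rho> leaves \<Phi>'' alone, so the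
  total phase always has a monotone derivative; hence the second derivative is used even in the
  nonstationary regime. The product r^-1/2 T_k^-1/2 is of order 1 / T_k exactly because r is not
  small against T_k. Up to the constant, (2^k / \<delta>)^(s+2) is the claimed right side times
  T_k^\<sigma> with \<sigma> = (s+2) / (\<alpha>+2), so the summation involves T_k alone. For s =
  \<alpha> one has \<sigma> = 1, and T_k min(1, 1/T_k) equals 1 for all T_k >= 1: without a further
  gain nothing would sum. The scales that miss this gain depend on |x| / |t|, which is why the
  supremum stands outside the sum in (2), whereas in (1) the majorant of each piece is uniform in
  x.\<close>

lemma continuous_bounded_away_from_zero_sign:
  fixes f :: "real \<Rightarrow> real"
  assumes "continuous_on {a..b} f" "\<And>x. x \<in> {a..b} \<Longrightarrow> \<mu> \<le> \<bar>f x\<bar>" "0 < \<mu>"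
  shows "(\<forall>x\<in>{a..b}. \<mu> \<le> f x) \<or> (\<forall>x\<in>{a..b}. f x \<le> - \<mu>)"
proof (rule ccontr)
  assume "\<not> ?thesis"
  then obtain x y where xy: "x \<in> {a..b}" "y \<in> {a..b}" "f x < \<mu>" "- \<mu> < f y" by force
  have "f x \<le> -\<mu>" "\<mu> \<le> f y" using assms(2)[OF xy(1)] assms(2)[OF xy(2)] xy assms(3) by auto
  moreover have "connected (f ` {a..b})"
    by (intro connected_continuous_image assms) auto
  ultimately have "0 \<in> f ` {a..b}"
    using xy assms(3) unfolding connected_iff_interval by (smt (verit) imageI)
  then show False using assms(2,3) by force
qed

text \<open>Integrate by parts after writing cos \<phi> = (sin \<phi>)' / \<phi>'. The boundary
  terms cost 2 / \<nu>. The remaining integrand is dominated by |\<phi>''| / \<phi>'^2, which up to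
  a constant sign is the derivative of -1 / \<phi>', so its integral is again at most 2 /
  \<nu>.\<close>

lemma van_der_Corput_first:
  fixes \<phi> \<phi>' \<phi>'' :: "real \<Rightarrow> real"
  assumes ab: "a \<le> b"
    and d1: "\<And>x. x \<in> {a..b} \<Longrightarrow> (\<phi> has_real_derivative \<phi>' x) (at x within {a..b})"
    and d2: "\<And>x. x \<in> {a..b} \<Longrightarrow> (\<phi>' has_real_derivative \<phi>'' x) (at x within {a..b})"
    and sg: "(\<forall>x\<in>{a..b}. 0 \<le> \<phi>'' x) \<or> (\<forall>x\<in>{a..b}. \<phi>'' x \<le> 0)"
    and nu: "0 < \<nu>" "\<And>x. x \<in> {a..b} \<Longrightarrow> \<nu> \<le> \<bar>\<phi>' x\<bar>"
  shows "\<bar>integral {a..b} (\<lambda>x. cos (\<phi> x))\<bar> \<le> 4 / \<nu>"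
proof -
  define u where "u x = sin (\<phi> x) * (\<phi>'' x / (\<phi>' x)\<^sup>2)" for x
  define v where "v x = \<phi>'' x / (\<phi>' x)\<^sup>2" for x
  have nz: "\<phi>' x \<noteq> 0" if "x \<in> {a..b}" for x using nu(1) nu(2)[OF that] by auto
  have inv: "\<bar>1 / \<phi>' x\<bar> \<le> 1 / \<nu>" if "x \<in> {a..b}" for x
    using nu(1) nu(2)[OF that] by (simp add: frac_le)
  have c: "continuous_on {a..b} \<phi>"
    using d1 by (rule DERIV_continuous_on)
  have I1: "((\<lambda>x. cos (\<phi> x) - u x) has_integral (sin (\<phi> b) / \<phi>' b - sin (\<phi> a) / \<phi>' a)) {a..b}"
  proof (rule fundamental_theorem_of_calculus[OF ab], unfold has_real_derivative_iff_has_vector_derivative[symmetric])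
    fix x assume x: "x \<in> {a..b}"
    show "((\<lambda>x. sin (\<phi> x) / \<phi>' x) has_real_derivative cos (\<phi> x) - u x) (at x within {a..b})"
      unfolding u_def using nz[OF x]
      by (auto intro!: derivative_eq_intros d1[OF x] d2[OF x] simp: field_simps power2_eq_square)
  qed
  have I2: "(v has_integral (- (1 / \<phi>' b) - - (1 / \<phi>' a))) {a..b}"
  proof (rule fundamental_theorem_of_calculus[OF ab], unfold has_real_derivative_iff_has_vector_derivative[symmetric])
    fix x assume x: "x \<in> {a..b}"
    show "((\<lambda>x. - (1 / \<phi>' x)) has_real_derivative v x) (at x within {a..b})"
      unfolding v_def using nz[OF x]
      by (auto intro!: derivative_eq_intros d2[OF x] simp: field_simps power2_eq_square)
  qed
  have ci: "(\<lambda>x. cos (\<phi> x)) integrable_on {a..b}"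
    by (intro integrable_continuous_real continuous_intros c)
  have ui: "u integrable_on {a..b}"
    using integrable_diff[OF ci has_integral_integrable[OF I1]] by simp
  have bd: "\<bar>integral {a..b} v\<bar> \<le> 2 / \<nu>"
    using inv[of a] inv[of b] ab integral_unique[OF I2] unfolding abs_le_iff by (simp add: field_simps)
  have un: "\<bar>u x\<bar> \<le> \<bar>v x\<bar>" for x
    unfolding u_def v_def abs_mult by (intro mult_left_le_one_le) auto
  have "\<bar>integral {a..b} u\<bar> \<le> 2 / \<nu>"
    using sg
  proof
    assume p: "\<forall>x\<in>{a..b}. 0 \<le> \<phi>'' x"
    have "norm (integral {a..b} u) \<le> integral {a..b} v"
    proof (rule integral_norm_bound_integral[OF ui has_integral_integrable[OF I2]])
      fix x assume "x \<in> {a..b}"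
      then show "norm (u x) \<le> v x" using un[of x] p by (simp add: v_def)
    qed
    then show ?thesis using bd by auto
  next
    assume p: "\<forall>x\<in>{a..b}. \<phi>'' x \<le> 0"
    have "norm (integral {a..b} u) \<le> integral {a..b} (\<lambda>x. - v x)"
    proof (rule integral_norm_bound_integral[OF ui])
      show "(\<lambda>x. - v x) integrable_on {a..b}" using has_integral_integrable[OF I2] by (rule integrable_neg)
      fix x assume "x \<in> {a..b}"
      then show "norm (u x) \<le> - v x" using un[of x] p by (simp add: v_def divide_nonpos_nonneg)
    qed
    then show ?thesis using bd by auto
  qed
  moreover have "integral {a..b} (\<lambda>x. cos (\<phi> x)) = sin (\<phi> b) / \<phi>' b - sin (\<phi> a) / \<phi>' a + integral {a..b} u"
    using integral_unique[OF I1] integral_diff[OF ci ui] by simp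
  moreover have "\<bar>sin (\<phi> x) / \<phi>' x\<bar> \<le> 1 / \<nu>" if "x \<in> {a..b}" for x
  proof -
    have "\<bar>sin (\<phi> x) / \<phi>' x\<bar> = \<bar>sin (\<phi> x)\<bar> * \<bar>1 / \<phi>' x\<bar>" by (simp add: abs_mult[symmetric])
    also have "\<dots> \<le> 1 * (1 / \<nu>)" by (intro mult_mono inv that) auto
    finally show ?thesis by simp
  qed
  from this[of a] this[of b] ab have "\<bar>sin (\<phi> b) / \<phi>' b\<bar> \<le> 1 / \<nu>" "\<bar>sin (\<phi> a) / \<phi>' a\<bar> \<le> 1 / \<nu>" by auto
  ultimately have "\<bar>integral {a..b} (\<lambda>x. cos (\<phi> x))\<bar> \<le> 1 / \<nu> + 1 / \<nu> + 2 / \<nu>" by linarith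
  then show ?thesis by simp
qed

text \<open>The reflection \<open>x \<mapsto> - x\<close> preserves convexity of the phase, so it suffices to treat the side on
  which \<open>\<phi>'\<close> is nonnegative.\<close>

lemma van_der_Corput_second_half:
  fixes \<phi> \<phi>' \<phi>'' :: "real \<Rightarrow> real"
  assumes ab: "a \<le> b"
    and d1: "\<And>x. x \<in> {a..b} \<Longrightarrow> (\<phi> has_real_derivative \<phi>' x) (at x within {a..b})"
    and d2: "\<And>x. x \<in> {a..b} \<Longrightarrow> (\<phi>' has_real_derivative \<phi>'' x) (at x within {a..b})"
    and mu: "0 < \<mu>" "\<And>x. x \<in> {a..b} \<Longrightarrow> \<mu> \<le> \<phi>'' x"
    and a: "0 \<le> \<phi>' a"
  shows "\<bar>integral {a..b} (\<lambda>x. cos (\<phi> x))\<bar> \<le> 5 / sqrt \<mu>"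
proof -
  \<comment> \<open>The part of the interval up to \<open>a + h\<close> is estimated by its length,
    the rest by the first derivative test, as there \<phi>' >= h \<mu> by convexity. The costs h and
    4 / (h \<mu>) are of the same order for this \<open>h\<close> and add up to 5 / sqrt
    \<mu>.\<close>
  define h where "h = 1 / sqrt \<mu>"
  have h: "h > 0" using mu by (simp add: h_def)
  have c: "continuous_on {a..b} \<phi>"
    using d1 by (rule DERIV_continuous_on)
  have ci: "(\<lambda>x. cos (\<phi> x)) integrable_on {a..b}"
    by (intro integrable_continuous_real continuous_intros c)
  have triv: "\<bar>integral {a..y} (\<lambda>x. cos (\<phi> x))\<bar> \<le> y - a" if "a \<le> y" "y \<le> b" for y
  proof -
    have "norm (integral {a..y} (\<lambda>x. cos (\<phi> x))) \<le> 1 * (y - a)"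
      by (rule integral_bound) (use that in \<open>auto intro!: continuous_intros continuous_on_subset[OF c]\<close>)
    then show ?thesis by simp
  qed
  show ?thesis
  proof (cases "a + h \<le> b")
    case False
    then have "\<bar>integral {a..b} (\<lambda>x. cos (\<phi> x))\<bar> \<le> h" using triv[of b] ab by auto
    also have "h \<le> 5 / sqrt \<mu>" using mu by (simp add: h_def divide_right_mono)
    finally show ?thesis .
  next
    case True
    have gr: "sqrt \<mu> \<le> \<phi>' x" if x: "x \<in> {a+h..b}" for x
    proof -
      have xi: "x \<in> {a..b}" "a < x" using x h by auto
      have "\<exists>z\<in>{a<..<x}. \<phi>' x - \<phi>' a = \<phi>'' z * (x - a)"
      proof (rule mvt_simple[OF xi(2), where f' = "\<lambda>y. (*) (\<phi>'' y)"])
        fix y assume "a \<le> y" "y \<le> x"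
        then have "(\<phi>' has_real_derivative \<phi>'' y) (at y within {a..x})"
          using DERIV_subset[OF d2, of y "{a..x}"] xi by auto
        then show "(\<phi>' has_derivative (*) (\<phi>'' y)) (at y within {a..x})"
          by (simp add: has_field_derivative_def)
      qed
      then obtain z where z: "a < z" "z < x" "\<phi>' x - \<phi>' a = (x - a) * \<phi>'' z"
        by (auto simp: mult.commute)
      have "h * \<mu> \<le> (x - a) * \<phi>'' z"
        using x h mu(1) mu(2)[of z] z xi by (intro mult_mono) auto
      moreover have "h * \<mu> = sqrt \<mu>" using mu(1) by (simp add: h_def real_div_sqrt)
      ultimately show ?thesis using z(3) a by linarith
    qed
    have sub: "{a+h..b} \<subseteq> {a..b}" using h by auto
    have "\<bar>integral {a+h..b} (\<lambda>x. cos (\<phi> x))\<bar> \<le> 4 / sqrt \<mu>"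
    proof (rule van_der_Corput_first[OF True])
      show "(\<phi> has_real_derivative \<phi>' x) (at x within {a+h..b})" if "x \<in> {a+h..b}" for x
        using DERIV_subset[OF d1 sub] that sub by blast
      show "(\<phi>' has_real_derivative \<phi>'' x) (at x within {a+h..b})" if "x \<in> {a+h..b}" for x
        using DERIV_subset[OF d2 sub] that sub by blast
      show "(\<forall>x\<in>{a+h..b}. 0 \<le> \<phi>'' x) \<or> (\<forall>x\<in>{a+h..b}. \<phi>'' x \<le> 0)"
        using mu sub by (meson in_mono le_less order_trans)
      show "0 < sqrt \<mu>" using mu by simp
      show "sqrt \<mu> \<le> \<bar>\<phi>' x\<bar>" if "x \<in> {a+h..b}" for x using gr[OF that] by linarith
    qed
    moreover have "integral {a..b} (\<lambda>x. cos (\<phi> x)) =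
        integral {a..a+h} (\<lambda>x. cos (\<phi> x)) + integral {a+h..b} (\<lambda>x. cos (\<phi> x))"
      using Henstock_Kurzweil_Integration.integral_combine[OF _ True ci] h by simp
    moreover have "\<bar>integral {a..a+h} (\<lambda>x. cos (\<phi> x))\<bar> \<le> h" using triv[of "a+h"] h True by simp
    ultimately have "\<bar>integral {a..b} (\<lambda>x. cos (\<phi> x))\<bar> \<le> 4 / sqrt \<mu> + 1 / sqrt \<mu>"
      unfolding h_def by linarith
    then show ?thesis by (simp add: add_divide_distrib[symmetric])
  qed
qed

text \<open>Since \<phi>' increases, one point splits the interval into a piece with \<phi>' <= 0
  and a piece with \<phi>' >= 0, each of cost 5 / sqrt \<mu>. The first piece is reflected to bring
  it under \<open>van_der_Corput_second_half\<close>.\<close>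

lemma van_der_Corput_second_convex:
  fixes \<phi> \<phi>' \<phi>'' :: "real \<Rightarrow> real"
  assumes ab: "a \<le> b"
    and d1: "\<And>x. x \<in> {a..b} \<Longrightarrow> (\<phi> has_real_derivative \<phi>' x) (at x within {a..b})"
    and d2: "\<And>x. x \<in> {a..b} \<Longrightarrow> (\<phi>' has_real_derivative \<phi>'' x) (at x within {a..b})"
    and mu: "0 < \<mu>" "\<And>x. x \<in> {a..b} \<Longrightarrow> \<mu> \<le> \<phi>'' x"
  shows "\<bar>integral {a..b} (\<lambda>x. cos (\<phi> x))\<bar> \<le> 10 / sqrt \<mu>"
proof -
  have c: "continuous_on {a..b} \<phi>"
    using d1 by (rule DERIV_continuous_on)
  have c': "continuous_on {a..b} \<phi>'"
    using d2 by (rule DERIV_continuous_on)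
  have ci: "(\<lambda>x. cos (\<phi> x)) integrable_on {a..b}"
    by (intro integrable_continuous_real continuous_intros c)
  have R: "\<bar>integral {e..b} (\<lambda>x. cos (\<phi> x))\<bar> \<le> 5 / sqrt \<mu>" if "a \<le> e" "e \<le> b" "0 \<le> \<phi>' e" for e
  proof (rule van_der_Corput_second_half[of e b \<phi> \<phi>' \<phi>''])
    have sub: "{e..b} \<subseteq> {a..b}" using that by auto
    show "(\<phi> has_real_derivative \<phi>' x) (at x within {e..b})" if "x \<in> {e..b}" for x
      using DERIV_subset[OF d1 sub] that sub by blast
    show "(\<phi>' has_real_derivative \<phi>'' x) (at x within {e..b})" if "x \<in> {e..b}" for x
      using DERIV_subset[OF d2 sub] that sub by blast
  qed (use that mu in auto)
  have L: "\<bar>integral {a..e} (\<lambda>x. cos (\<phi> x))\<bar> \<le> 5 / sqrt \<mu>" if e: "a \<le> e" "e \<le> b" "\<phi>' e \<le> 0" for e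
  proof -
    have im: "(uminus :: real \<Rightarrow> real) ` {-e..-a} = {a..e}" by simp
    have sub: "{a..e} \<subseteq> {a..b}" using that by auto
    have "\<bar>integral {-e..-a} (\<lambda>x. cos (\<phi> (- x)))\<bar> \<le> 5 / sqrt \<mu>"
    proof (rule van_der_Corput_second_half[of _ _ _ "\<lambda>x. - \<phi>' (- x)" "\<lambda>x. \<phi>'' (- x)"])
      fix x assume x: "x \<in> {-e..-a}"
      then have mx: "- x \<in> {a..e}" by auto
      have n: "((\<lambda>x. - x) has_real_derivative -1) (at x within {-e..-a})"
        by (auto intro!: derivative_eq_intros)
      have "(\<phi> has_real_derivative \<phi>' (- x)) (at (- x) within uminus ` {-e..-a})"
        unfolding im using DERIV_subset[OF d1 sub] mx sub by blast
      from DERIV_image_chain[OF this n]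
      show "((\<lambda>x. \<phi> (- x)) has_real_derivative - \<phi>' (- x)) (at x within {-e..-a})"
        by (simp add: o_def)
      have "(\<phi>' has_real_derivative \<phi>'' (- x)) (at (- x) within uminus ` {-e..-a})"
        unfolding im using DERIV_subset[OF d2 sub] mx sub by blast
      from DERIV_minus[OF DERIV_image_chain[OF this n]]
      show "((\<lambda>x. - \<phi>' (- x)) has_real_derivative \<phi>'' (- x)) (at x within {-e..-a})"
        by (simp add: o_def)
    qed (use e mu in auto)
    then show ?thesis
      using Henstock_Kurzweil_Integration.integral_reflect_real[of e a "\<lambda>x. cos (\<phi> x)"] by simp
  qed
  \<comment> \<open>If \<phi>' keeps its sign on the interval, \<open>e\<close> is an endpoint and
    one of the two pieces shrinks to a point, with integral 0. The alternatives \<open>e = b\<close>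
    and \<open>e = a\<close> record this.\<close>
  obtain e where e: "a \<le> e" "e \<le> b" "(0 \<le> \<phi>' e \<or> e = b) \<and> (\<phi>' e \<le> 0 \<or> e = a)"
  proof (cases "0 \<le> \<phi>' a \<or> \<phi>' b \<le> 0")
    case True
    then show ?thesis using that[of a] that[of b] ab by auto
  next
    case False
    then obtain e where "a \<le> e" "e \<le> b" "\<phi>' e = 0"
      using IVT'[of \<phi>' a 0 b] ab c' by auto
    then show ?thesis using that[of e] by simp
  qed
  have "\<bar>integral {a..e} (\<lambda>x. cos (\<phi> x))\<bar> \<le> 5 / sqrt \<mu>"
    using e L[of e] mu(1) by auto
  moreover have "\<bar>integral {e..b} (\<lambda>x. cos (\<phi> x))\<bar> \<le> 5 / sqrt \<mu>"
    using e R[of e] mu(1) by auto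
  moreover have "integral {a..b} (\<lambda>x. cos (\<phi> x)) =
        integral {a..e} (\<lambda>x. cos (\<phi> x)) + integral {e..b} (\<lambda>x. cos (\<phi> x))"
    using Henstock_Kurzweil_Integration.integral_combine[OF e(1,2) ci] by simp
  ultimately show ?thesis by linarith
qed

lemma van_der_Corput_second:
  fixes \<phi> \<phi>' \<phi>'' :: "real \<Rightarrow> real"
  assumes ab: "a \<le> b"
    and d1: "\<And>x. x \<in> {a..b} \<Longrightarrow> (\<phi> has_real_derivative \<phi>' x) (at x within {a..b})"
    and d2: "\<And>x. x \<in> {a..b} \<Longrightarrow> (\<phi>' has_real_derivative \<phi>'' x) (at x within {a..b})"
    and mu: "0 < \<mu>" "(\<forall>x\<in>{a..b}. \<mu> \<le> \<phi>'' x) \<or> (\<forall>x\<in>{a..b}. \<phi>'' x \<le> - \<mu>)"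
  shows "\<bar>integral {a..b} (\<lambda>x. cos (\<phi> x))\<bar> \<le> 10 / sqrt \<mu>"
  using mu(2)
proof
  assume "\<forall>x\<in>{a..b}. \<mu> \<le> \<phi>'' x"
  then show ?thesis using van_der_Corput_second_convex[OF ab d1 d2 mu(1)] by blast
next
  assume n: "\<forall>x\<in>{a..b}. \<phi>'' x \<le> - \<mu>"
  have "\<bar>integral {a..b} (\<lambda>x. cos (- \<phi> x))\<bar> \<le> 10 / sqrt \<mu>"
    by (rule van_der_Corput_second_convex[OF ab _ _ mu(1), of "\<lambda>x. - \<phi> x" "\<lambda>x. - \<phi>' x" "\<lambda>x. - \<phi>'' x"])
      (use n in \<open>force intro!: DERIV_minus d1 d2\<close>)+
  then show ?thesis by simp
qed

text \<open>Integrate by parts against the primitive of \<open>u\<close> that vanishes at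
  \<open>a\<close>: the boundary term is at most B M, the integral with f' at most B M (b - a). This
  carries van der Corput bounds over to integrals with an amplitude, and it is the reason why those
  bounds are later proved on every initial subinterval. On {1/2..2} the last factor is 5/2.\<close>

lemma amplitude_integral_bound:
  fixes f f' u :: "real \<Rightarrow> real"
  assumes ab: "a \<le> b"
    and u: "continuous_on {a..b} u"
    and d: "\<And>x. x \<in> {a..b} \<Longrightarrow> (f has_real_derivative f' x) (at x within {a..b})"
    and M: "\<And>x. x \<in> {a..b} \<Longrightarrow> \<bar>f x\<bar> \<le> M" "\<And>x. x \<in> {a..b} \<Longrightarrow> \<bar>f' x\<bar> \<le> M"
    and B: "\<And>x. x \<in> {a..b} \<Longrightarrow> \<bar>integral {a..x} u\<bar> \<le> B"
  shows "\<bar>integral {a..b} (\<lambda>x. f x * u x)\<bar> \<le> B * M * (1 + (b - a))"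
proof -
  define G where "G x = integral {a..x} u" for x
  have G: "(G has_real_derivative u x) (at x within {a..b})" if "x \<in> {a..b}" for x
    unfolding G_def using integral_has_real_derivative[OF u that] .
  have M0: "0 \<le> M" "0 \<le> B" using M(1)[of a] B[of a] ab by auto
  have c: "continuous_on {a..b} f"
    using d by (rule DERIV_continuous_on)
  have I: "((\<lambda>x. f' x * G x + f x * u x) has_integral (f b * G b - f a * G a)) {a..b}"
  proof (rule fundamental_theorem_of_calculus[OF ab], unfold has_real_derivative_iff_has_vector_derivative[symmetric])
    fix x assume x: "x \<in> {a..b}"
    show "((\<lambda>x. f x * G x) has_real_derivative f' x * G x + f x * u x) (at x within {a..b})"
      by (auto intro!: derivative_eq_intros d[OF x] G[OF x])
  qed
  have fu: "(\<lambda>x. f x * u x) integrable_on {a..b}"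
    by (intro integrable_continuous_real continuous_intros c u)
  have I2: "((\<lambda>x. f' x * G x) has_integral (f b * G b - f a * G a - integral {a..b} (\<lambda>x. f x * u x))) {a..b}"
    using has_integral_diff[OF I integrable_integral[OF fu]] by simp
  have "norm (f b * G b - f a * G a - integral {a..b} (\<lambda>x. f x * u x)) \<le> (M * B) * measure lborel (cbox a b)"
  proof (rule has_integral_bound)
    show "((\<lambda>x. f' x * G x) has_integral (f b * G b - f a * G a - integral {a..b} (\<lambda>x. f x * u x))) (cbox a b)"
      using I2 by simp
    fix x assume "x \<in> cbox a b"
    then show "norm (f' x * G x) \<le> M * B"
      using M B M0 by (auto simp: G_def abs_mult intro!: mult_mono)
  qed (use M0 in auto)
  moreover have "G a = 0" by (simp add: G_def)
  moreover have "\<bar>f b * G b\<bar> \<le> M * B"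
    using M B M0 ab by (auto simp: G_def abs_mult intro!: mult_mono)
  ultimately have "\<bar>integral {a..b} (\<lambda>x. f x * u x)\<bar> \<le> M * B + M * B * (b - a)"
    using ab by simp
  then show ?thesis by (simp add: algebra_simps)
qed

section \<open>The Bessel function of order zero\<close>

text \<open>This is \<open>2 \<pi> J\<^sub>0\<close> for the Bessel function \<open>J\<^sub>0\<close>.\<close>

definition bess :: "real \<Rightarrow> real" where
  "bess z = integral {0..2*pi} (\<lambda>\<theta>. cos (z * cos \<theta>))"

lemma bess_derivatives:
  "(bess has_real_derivative integral {0..2*pi} (\<lambda>\<theta>. - cos \<theta> * sin (z * cos \<theta>))) (at z)"
  "((\<lambda>z. integral {0..2*pi} (\<lambda>\<theta>. - cos \<theta> * sin (z * cos \<theta>))) has_real_derivative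
     integral {0..2*pi} (\<lambda>\<theta>. - (cos \<theta>)\<^sup>2 * cos (z * cos \<theta>))) (at z)"
proof -
  have "((\<lambda>z. integral (cbox 0 (2*pi)) (\<lambda>\<theta>. cos (z * cos \<theta>))) has_real_derivative
      integral (cbox 0 (2*pi)) (\<lambda>\<theta>. - cos \<theta> * sin (z * cos \<theta>))) (at z within UNIV)"
    by (rule leibniz_rule_field_derivative)
      (auto intro!: derivative_eq_intros continuous_intros integrable_continuous_real simp: case_prod_beta)
  then show "(bess has_real_derivative integral {0..2*pi} (\<lambda>\<theta>. - cos \<theta> * sin (z * cos \<theta>))) (at z)"
    by (simp add: bess_def[abs_def])
  have "((\<lambda>z. integral (cbox 0 (2*pi)) (\<lambda>\<theta>. - cos \<theta> * sin (z * cos \<theta>))) has_real_derivative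
      integral (cbox 0 (2*pi)) (\<lambda>\<theta>. - (cos \<theta>)\<^sup>2 * cos (z * cos \<theta>))) (at z within UNIV)"
    by (rule leibniz_rule_field_derivative)
      (auto intro!: derivative_eq_intros continuous_intros integrable_continuous_real simp: case_prod_beta power2_eq_square)
  then show "((\<lambda>z. integral {0..2*pi} (\<lambda>\<theta>. - cos \<theta> * sin (z * cos \<theta>))) has_real_derivative
     integral {0..2*pi} (\<lambda>\<theta>. - (cos \<theta>)\<^sup>2 * cos (z * cos \<theta>))) (at z)"
    by simp
qed

text \<open>This is Bessel's equation z J'' + J' + z J = 0, with the derivatives as integrals. After
  1 - cos^2 = sin^2 the left side is, up to sign, the integral over a period of the
  \<theta>-derivative of sin \<theta> sin (z cos \<theta>), hence zero.\<close>

lemma bess_ode: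
  "z * integral {0..2*pi} (\<lambda>\<theta>. - (cos \<theta>)\<^sup>2 * cos (z * cos \<theta>))
     + integral {0..2*pi} (\<lambda>\<theta>. - cos \<theta> * sin (z * cos \<theta>)) + z * bess z = 0"
proof -
  have "((\<lambda>\<theta>. cos \<theta> * sin (z * cos \<theta>) - z * (sin \<theta>)\<^sup>2 * cos (z * cos \<theta>)) has_integral
     (sin (2*pi) * sin (z * cos (2*pi)) - sin 0 * sin (z * cos 0))) {0..2*pi}"
    by (rule fundamental_theorem_of_calculus)
      (auto simp: has_real_derivative_iff_has_vector_derivative[symmetric] power2_eq_square
        intro!: derivative_eq_intros)
  then have 0: "integral {0..2*pi} (\<lambda>\<theta>. cos \<theta> * sin (z * cos \<theta>) - z * (sin \<theta>)\<^sup>2 * cos (z * cos \<theta>)) = 0"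
    by (simp add: integral_unique)
  have "z * integral {0..2*pi} (\<lambda>\<theta>. - (cos \<theta>)\<^sup>2 * cos (z * cos \<theta>))
     + integral {0..2*pi} (\<lambda>\<theta>. - cos \<theta> * sin (z * cos \<theta>)) + z * bess z
     = integral {0..2*pi} (\<lambda>\<theta>. z * (- (cos \<theta>)\<^sup>2 * cos (z * cos \<theta>)))
     + integral {0..2*pi} (\<lambda>\<theta>. - cos \<theta> * sin (z * cos \<theta>)) + integral {0..2*pi} (\<lambda>\<theta>. z * cos (z * cos \<theta>))"
    unfolding bess_def by simp
  also have "\<dots> = integral {0..2*pi} (\<lambda>\<theta>. z * (- (cos \<theta>)\<^sup>2 * cos (z * cos \<theta>))
     + (- cos \<theta> * sin (z * cos \<theta>)) + z * cos (z * cos \<theta>))"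
    by (subst integral_add[symmetric] | intro integrable_continuous_real continuous_intros integrable_add | simp)+
  also have "\<dots> = integral {0..2*pi} (\<lambda>\<theta>. - (cos \<theta> * sin (z * cos \<theta>) - z * (sin \<theta>)\<^sup>2 * cos (z * cos \<theta>)))"
    by (intro integral_cong) (simp add: sin_squared_eq algebra_simps)
  also have "\<dots> = 0" using 0 by (simp only: integral_neg)
  finally show ?thesis .
qed

text \<open>With \<open>w = \<surd>z J\<close>, Bessel's equation becomes \<open>w'' + w = - w / (4 z\<^sup>2)\<close>. The amplitudes \<open>p, q\<close> are
  the coordinates of \<open>(w, w')\<close> in the frame rotating with the free solutions \<open>cos, sin\<close>; the energy
  \<open>w\<^sup>2 + w'\<^sup>2\<close> grows at most like \<open>exp (- 1 / (4 z))\<close>, so it stays bounded.\<close>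

lemma bess_decomposition:
  obtains M p q p' q' where "M > 0"
    "\<And>z. z > 0 \<Longrightarrow> bess z = (p z * cos z + q z * sin z) / sqrt z"
    "\<And>z. z > 0 \<Longrightarrow> (p has_real_derivative p' z) (at z)"
    "\<And>z. z > 0 \<Longrightarrow> (q has_real_derivative q' z) (at z)"
    "\<And>z. z \<ge> 1 \<Longrightarrow> \<bar>p z\<bar> \<le> M \<and> \<bar>q z\<bar> \<le> M \<and> \<bar>p' z\<bar> \<le> M / z\<^sup>2 \<and> \<bar>q' z\<bar> \<le> M / z\<^sup>2"
proof -
  define J1 where "J1 z = integral {0..2*pi} (\<lambda>\<theta>. - cos \<theta> * sin (z * cos \<theta>))" for z :: real
  define J2 where "J2 z = integral {0..2*pi} (\<lambda>\<theta>. - (cos \<theta>)\<^sup>2 * cos (z * cos \<theta>))" for z :: real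
  note dJ = bess_derivatives[folded J1_def J2_def]
  have ode: "J2 z = - J1 z / z - bess z" if "z > 0" for z
    using bess_ode[of z, folded J1_def J2_def] that by (simp add: field_simps)
  define w where "w z = sqrt z * bess z" for z
  \<comment> \<open>\<open>v\<close> is w', and \<open>v1\<close> is w'' with Bessel's equation
    inserted.\<close>
  define v where "v z = bess z / (2 * sqrt z) + sqrt z * J1 z" for z
  define v1 where "v1 z = - w z - w z / (4 * z\<^sup>2)" for z
  have dw: "(w has_real_derivative v z) (at z)" if "z > 0" for z
    unfolding w_def[abs_def] v_def using that
    by (auto intro!: derivative_eq_intros dJ simp: field_simps)
  have dv: "(v has_real_derivative v1 z) (at z)" if z: "z > 0" for z
  proof -
    define r where "r = sqrt z"
    have r: "r > 0" "z = r^2" "sqrt z = r" using z by (auto simp: r_def)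
    show ?thesis
      unfolding v_def[abs_def] using r(1) z
      apply (auto intro!: derivative_eq_intros dJ simp: ode[OF z] v1_def w_def r(3))
      apply (simp add: r(2))
      apply (simp add: field_simps power2_eq_square power4_eq_xxxx)
      done
  qed
  \<comment> \<open>The rotation removes the main term -w of w'', so only the perturbation w / (4
    z^2) survives in \<open>p'\<close> and \<open>q'\<close>. This is the source of their
    decay.\<close>
  define p where "p z = w z * cos z - v z * sin z" for z
  define q where "q z = w z * sin z + v z * cos z" for z
  define p' where "p' z = w z / (4 * z\<^sup>2) * sin z" for z
  define q' where "q' z = - (w z / (4 * z\<^sup>2) * cos z)" for z
  have dp: "(p has_real_derivative p' z) (at z)" if "z > 0" for z
    unfolding p_def[abs_def] p'_def
    by (rule derivative_eq_intros dw dv that refl)+ (simp add: v1_def algebra_simps)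
  have dq: "(q has_real_derivative q' z) (at z)" if "z > 0" for z
    unfolding q_def[abs_def] q'_def
    by (rule derivative_eq_intros dw dv that refl)+ (simp add: v1_def algebra_simps)
  have rot: "p z * cos z + q z * sin z = w z" for z
  proof -
    have "p z * cos z + q z * sin z = w z * ((cos z)\<^sup>2 + (sin z)\<^sup>2)"
      unfolding p_def q_def by algebra
    then show ?thesis by simp
  qed
  define E where "E z = (w z)\<^sup>2 + (v z)\<^sup>2" for z
  have E_pq: "E z = (p z)\<^sup>2 + (q z)\<^sup>2" for z
  proof -
    have "(p z)\<^sup>2 + (q z)\<^sup>2 = ((w z)\<^sup>2 + (v z)\<^sup>2) * ((cos z)\<^sup>2 + (sin z)\<^sup>2)"
      unfolding p_def q_def by algebra
    then show ?thesis by (simp add: E_def)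
  qed
  have E0: "0 \<le> E z" for z by (simp add: E_def)
  \<comment> \<open>The equation gives E' = - w v / (2 z^2), and the weight contributes - E / (4
    z^2). Together they form the nonpositive term - (w + v)^2 / (4 z^2).\<close>
  have mono: "E z * exp (1 / (4 * z)) \<le> E 1 * exp (1 / (4 * 1))" if z: "1 \<le> z" for z
  proof (rule DERIV_nonpos_imp_nonincreasing[OF z])
    fix y assume y: "1 \<le> y" "y \<le> z"
    then have y0: "y > 0" by simp
    have "((\<lambda>z. E z * exp (1 / (4 * z))) has_real_derivative
        (2 * w y * v y + 2 * v y * v1 y - E y / (4 * y\<^sup>2)) * exp (1 / (4 * y))) (at y)"
      unfolding E_def[abs_def] using y0
      by (auto intro!: derivative_eq_intros dw dv simp: power2_eq_square field_simps)
    moreover have "2 * w y * v y + 2 * v y * v1 y - E y / (4 * y\<^sup>2) = - (w y + v y)\<^sup>2 / (4 * y\<^sup>2)"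
      using y0 unfolding v1_def E_def by (simp add: field_simps power2_eq_square)
    moreover have "- (w y + v y)\<^sup>2 / (4 * y\<^sup>2) * exp (1 / (4 * y)) \<le> 0"
      by (intro mult_nonpos_nonneg) (auto simp: divide_nonpos_nonneg)
    ultimately show "\<exists>d. ((\<lambda>z. E z * exp (1 / (4 * z))) has_real_derivative d) (at y) \<and> d \<le> 0"
      by (smt (verit))
  qed
  define M where "M = sqrt (E 1 * exp (1/4)) + 1"
  have M0: "M > 0" unfolding M_def using E0[of 1] by (simp add: add_nonneg_pos)
  have Eb: "sqrt (E z) \<le> M" if z: "1 \<le> z" for z
  proof -
    have "E z * 1 \<le> E z * exp (1 / (4 * z))" using z E0 by (intro mult_left_mono) auto
    also have "\<dots> \<le> E 1 * exp (1/4)" using mono[OF z] by simp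
    finally have "sqrt (E z) \<le> sqrt (E 1 * exp (1/4))" by (simp del: real_sqrt_mult)
    then show ?thesis unfolding M_def by linarith
  qed
  show ?thesis
  proof (rule that[OF M0, of p q p' q'])
    fix z :: real assume z: "z > 0"
    show "bess z = (p z * cos z + q z * sin z) / sqrt z"
      using z by (simp add: rot w_def)
    show "(p has_real_derivative p' z) (at z)" "(q has_real_derivative q' z) (at z)"
      using dp dq z by auto
  next
    fix z :: real assume z: "z \<ge> 1"
    have pq: "\<bar>p z\<bar> \<le> sqrt (E z)" "\<bar>q z\<bar> \<le> sqrt (E z)" unfolding E_pq
      by (rule real_sqrt_sum_squares_ge1 real_le_rsqrt; simp)+
    have w: "\<bar>w z\<bar> \<le> sqrt (E z)" unfolding E_def by (rule real_le_rsqrt) simp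
    have a: "\<bar>w z / (4 * z\<^sup>2) * c\<bar> \<le> M / z\<^sup>2" if "\<bar>c\<bar> \<le> 1" for c
    proof -
      have "\<bar>w z / (4 * z\<^sup>2) * c\<bar> \<le> \<bar>w z\<bar> / (4 * z\<^sup>2) * 1"
        unfolding abs_mult by (intro mult_mono that) (auto simp: abs_mult)
      also have "\<dots> \<le> M / z\<^sup>2"
        using w Eb[OF z] M0 z by (simp add: field_simps)
      finally show ?thesis .
    qed
    show "\<bar>p z\<bar> \<le> M \<and> \<bar>q z\<bar> \<le> M \<and> \<bar>p' z\<bar> \<le> M / z\<^sup>2 \<and> \<bar>q' z\<bar> \<le> M / z\<^sup>2"
      using pq Eb[OF z] a[of "sin z"] a[of "cos z"] by (auto simp: p'_def q'_def)
  qed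
qed

text \<open>For r >= 2 and \<rho> >= 1/2 the argument z = r \<rho> is at least 1, where the bounds
  of \<open>bess_decomposition\<close> hold. Differentiating in \<rho> costs a factor r, but the
  derivatives of p, q and the logarithmic derivative of 1 / sqrt z are O(1 / z) with z comparable to
  r. So the amplitudes and their derivatives are both of order r^-1/2.\<close>

lemma bess_amplitudes:
  obtains M where "M > 0"
    "\<And>r. r \<ge> 2 \<Longrightarrow> \<exists>F G F' G'. \<forall>\<rho>\<in>{1/2..2}.
       bess (r * \<rho>) = F \<rho> * cos (r * \<rho>) + G \<rho> * sin (r * \<rho>) \<and>
       (F has_real_derivative F' \<rho>) (at \<rho> within {1/2..2}) \<and>
       (G has_real_derivative G' \<rho>) (at \<rho> within {1/2..2}) \<and>
       \<bar>F \<rho>\<bar> \<le> M / sqrt r \<and> \<bar>F' \<rho>\<bar> \<le> M / sqrt r \<and> \<bar>G \<rho>\<bar> \<le> M / sqrt r \<and> \<bar>G' \<rho>\<bar> \<le> M / sqrt r"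
proof -
  obtain M p q p' q' where M: "M > 0"
    and dec: "\<And>z. z > 0 \<Longrightarrow> bess z = (p z * cos z + q z * sin z) / sqrt z"
    and dp: "\<And>z. z > 0 \<Longrightarrow> (p has_real_derivative p' z) (at z)"
    and dq: "\<And>z. z > 0 \<Longrightarrow> (q has_real_derivative q' z) (at z)"
    and bd: "\<And>z. z \<ge> 1 \<Longrightarrow> \<bar>p z\<bar> \<le> M \<and> \<bar>q z\<bar> \<le> M \<and> \<bar>p' z\<bar> \<le> M / z\<^sup>2 \<and> \<bar>q' z\<bar> \<le> M / z\<^sup>2"
    by (rule bess_decomposition) blast
  \<comment> \<open>The constant 6 is the product of 3, from r |f' - f / (2 z)| <= 3 M, and 2, from
    1 / sqrt z <= 2 / sqrt r. Both follow from z >= r / 2.\<close>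
  have amp: "((\<lambda>\<rho>. f (r * \<rho>) / sqrt (r * \<rho>)) has_real_derivative
        r * (f' (r * \<rho>) - f (r * \<rho>) / (2 * (r * \<rho>))) / sqrt (r * \<rho>)) (at \<rho> within {1/2..2}) \<and>
      \<bar>f (r * \<rho>) / sqrt (r * \<rho>)\<bar> \<le> 6 * M / sqrt r \<and>
      \<bar>r * (f' (r * \<rho>) - f (r * \<rho>) / (2 * (r * \<rho>))) / sqrt (r * \<rho>)\<bar> \<le> 6 * M / sqrt r"
    if r: "r \<ge> 2" and \<rho>: "\<rho> \<in> {1/2..2}"
      and df: "\<And>z. z > 0 \<Longrightarrow> (f has_real_derivative f' z) (at z)"
      and bf: "\<And>z. z \<ge> 1 \<Longrightarrow> \<bar>f z\<bar> \<le> M" "\<And>z. z \<ge> 1 \<Longrightarrow> \<bar>f' z\<bar> \<le> M / z\<^sup>2"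
    for r \<rho> f f'
  proof -
    define z where "z = r * \<rho>"
    have zr: "r / 2 \<le> z" using r \<rho> mult_left_mono[of "1/2" \<rho> r] by (simp add: z_def)
    then have z1: "1 \<le> z" and z0: "z > 0" using r by auto
    have s: "1 / sqrt z \<le> 2 / sqrt r"
    proof -
      have "sqrt r \<le> sqrt (4 * z)" using zr z0 by (intro real_sqrt_le_mono) linarith
      then show ?thesis using r z0 by (simp add: real_sqrt_mult field_simps)
    qed
    have s0: "0 \<le> 1 / sqrt z" using z0 by simp
    have "((\<lambda>\<rho>. f (r * \<rho>)) has_real_derivative f' z * r) (at \<rho> within {1/2..2})"
      unfolding z_def
      by (rule DERIV_chain2[where g = "\<lambda>\<rho>. r * \<rho>"])
        (use df z0 in \<open>auto intro!: derivative_eq_intros simp: z_def\<close>)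
    then have D: "((\<lambda>\<rho>. f (r * \<rho>) / sqrt (r * \<rho>)) has_real_derivative
        r * (f' z - f z / (2 * z)) / sqrt z) (at \<rho> within {1/2..2})"
      using z0 unfolding z_def
      by (auto intro!: derivative_eq_intros simp: divide_simps) (simp add: algebra_simps)
    have 1: "\<bar>f z / sqrt z\<bar> \<le> M * (2 / sqrt r)"
    proof -
      have "\<bar>f z / sqrt z\<bar> = \<bar>f z\<bar> * (1 / sqrt z)" using z0 by simp
      also have "\<dots> \<le> M * (2 / sqrt r)" using M z0 by (intro mult_mono bf z1 s) auto
      finally show ?thesis .
    qed
    have "\<bar>f' z\<bar> \<le> M / z"
    proof -
      have "M / z\<^sup>2 \<le> M / z" using z1 M by (intro divide_left_mono) (auto simp: power2_eq_square)
      then show ?thesis using bf(2)[OF z1] by linarith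
    qed
    moreover have "\<bar>f z / (2 * z)\<bar> \<le> M / (2 * z)" using bf(1)[OF z1] z0 by (simp add: field_simps)
    ultimately have "\<bar>f' z - f z / (2 * z)\<bar> \<le> M / z + M / (2 * z)" by linarith
    also have "\<dots> = (3 / 2) * M / z" using z0 by (simp add: field_simps)
    also have "\<dots> \<le> (3 / 2) * M / (r / 2)" using M r zr z0 by (intro divide_left_mono) auto
    finally have "r * \<bar>f' z - f z / (2 * z)\<bar> \<le> r * ((3 / 2) * M / (r / 2))" using r by (intro mult_left_mono) auto
    then have "r * \<bar>f' z - f z / (2 * z)\<bar> \<le> 3 * M" using r by simp
    then have "r * \<bar>f' z - f z / (2 * z)\<bar> * (1 / sqrt z) \<le> 3 * M * (2 / sqrt r)"
      using M r z0 by (rule_tac mult_mono[OF _ s]) auto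
    moreover have "\<bar>r * (f' z - f z / (2 * z)) / sqrt z\<bar> = r * \<bar>f' z - f z / (2 * z)\<bar> * (1 / sqrt z)"
      using r z0 by (simp add: abs_mult)
    ultimately have 2: "\<bar>r * (f' z - f z / (2 * z)) / sqrt z\<bar> \<le> 6 * M / sqrt r"
      by simp
    show ?thesis using D 1 2 M r unfolding z_def[symmetric]
      by (auto intro: order_trans simp: field_simps)
  qed
  show ?thesis
  proof (rule that[of "6 * M"])
    show "6 * M > 0" using M by simp
    fix r :: real assume r: "r \<ge> 2"
    let ?D = "\<lambda>f f' \<rho>. r * (f' (r * \<rho>) - f (r * \<rho>) / (2 * (r * \<rho>))) / sqrt (r * \<rho>)"
    show "\<exists>F G F' G'. \<forall>\<rho>\<in>{1/2..2}.
       bess (r * \<rho>) = F \<rho> * cos (r * \<rho>) + G \<rho> * sin (r * \<rho>) \<and>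
       (F has_real_derivative F' \<rho>) (at \<rho> within {1/2..2}) \<and>
       (G has_real_derivative G' \<rho>) (at \<rho> within {1/2..2}) \<and>
       \<bar>F \<rho>\<bar> \<le> 6 * M / sqrt r \<and> \<bar>F' \<rho>\<bar> \<le> 6 * M / sqrt r \<and> \<bar>G \<rho>\<bar> \<le> 6 * M / sqrt r \<and> \<bar>G' \<rho>\<bar> \<le> 6 * M / sqrt r"
    proof (intro exI ballI)
      fix \<rho> :: real assume \<rho>: "\<rho> \<in> {1/2..2}"
      have z: "r * \<rho> > 0" using r \<rho> by auto
      have 1: "bess (r * \<rho>) = p (r * \<rho>) / sqrt (r * \<rho>) * cos (r * \<rho>) + q (r * \<rho>) / sqrt (r * \<rho>) * sin (r * \<rho>)"
        unfolding dec[OF z] by (simp add: add_divide_distrib)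
      show "bess (r * \<rho>) = p (r * \<rho>) / sqrt (r * \<rho>) * cos (r * \<rho>) + q (r * \<rho>) / sqrt (r * \<rho>) * sin (r * \<rho>) \<and>
       ((\<lambda>\<rho>. p (r * \<rho>) / sqrt (r * \<rho>)) has_real_derivative ?D p p' \<rho>) (at \<rho> within {1/2..2}) \<and>
       ((\<lambda>\<rho>. q (r * \<rho>) / sqrt (r * \<rho>)) has_real_derivative ?D q q' \<rho>) (at \<rho> within {1/2..2}) \<and>
       \<bar>p (r * \<rho>) / sqrt (r * \<rho>)\<bar> \<le> 6 * M / sqrt r \<and> \<bar>?D p p' \<rho>\<bar> \<le> 6 * M / sqrt r \<and>
       \<bar>q (r * \<rho>) / sqrt (r * \<rho>)\<bar> \<le> 6 * M / sqrt r \<and> \<bar>?D q q' \<rho>\<bar> \<le> 6 * M / sqrt r"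
        using amp[OF r \<rho> dp] amp[OF r \<rho> dq] bd 1 by blast
    qed
  qed
qed

section \<open>The rescaled radial integral\<close>

text \<open>Up to a power of the scale this is a dyadic piece in polar coordinates, rotated in the
  complex plane so as to be real. The angle \<theta> is measured from the direction of x, r is |x|
  2^k / \<delta>, and \<open>b\<close> will be the cutoff times \<rho>^(s+1), where one power of
  \<rho> is the Jacobian.\<close>

definition radial_integral :: "(real \<Rightarrow> real) \<Rightarrow> (real \<Rightarrow> real) \<Rightarrow> real \<Rightarrow> real" where
  "radial_integral b \<Phi> r = integral {1/2..2} (\<lambda>\<rho>. b \<rho> * integral {0..2*pi} (\<lambda>\<theta>. cos (r * \<rho> * cos \<theta> + \<Phi> \<rho>)))"

section \<open>Integration over the angle and reduction to one variable\<close>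

lemma integral_sin_cos_0: "integral {0..2*pi} (\<lambda>\<theta>. sin (z * cos \<theta>)) = (0::real)"
proof -
  have i: "(\<lambda>\<theta>. sin (z * cos \<theta>)) integrable_on {0..2*pi}"
    by (intro integrable_continuous_real continuous_intros)
  have "integral {0..pi} ((\<lambda>\<theta>. sin (z * cos \<theta>)) \<circ> (\<lambda>x. x + pi)) = integral {0+pi..pi+pi} (\<lambda>\<theta>. sin (z * cos \<theta>))"
    by (rule integral_shift) (intro continuous_intros)
  then have "integral {pi..2*pi} (\<lambda>\<theta>. sin (z * cos \<theta>)) = - integral {0..pi} (\<lambda>\<theta>. sin (z * cos \<theta>))"
    by (simp add: o_def)
  then show ?thesis
    using Henstock_Kurzweil_Integration.integral_combine[OF _ _ i, of pi] by simp
qed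

lemma angular_integral_bess:
  "integral {0..2*pi} (\<lambda>\<theta>. cos (z * cos \<theta> + c)) = bess z * cos c"
proof -
  have "integral {0..2*pi} (\<lambda>\<theta>. cos (z * cos \<theta> + c)) =
      integral {0..2*pi} (\<lambda>\<theta>. cos (z * cos \<theta>) * cos c - sin (z * cos \<theta>) * sin c)"
    by (simp add: cos_add)
  also have "\<dots> = bess z * cos c - integral {0..2*pi} (\<lambda>\<theta>. sin (z * cos \<theta>)) * sin c"
    unfolding bess_def
    by (subst integral_diff) (auto intro!: integrable_continuous_real continuous_intros)
  finally show ?thesis by (simp add: integral_sin_cos_0)
qed

text \<open>Exchanging the two integrations freezes the angle, so that the phase in \<rho> differs
  from \<Phi> only by the linear term r \<rho> cos \<theta>.\<close>

lemma radial_integral_le_sup_angle: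
  assumes b: "continuous_on {1/2..2} b" and \<Phi>: "continuous_on {1/2..2} \<Phi>"
    and B: "\<And>\<theta>. \<bar>integral {1/2..2} (\<lambda>\<rho>. b \<rho> * cos (r * \<rho> * cos \<theta> + \<Phi> \<rho>))\<bar> \<le> B"
  shows "\<bar>radial_integral b \<Phi> r\<bar> \<le> 2 * pi * B"
proof -
  let ?f = "\<lambda>\<rho> \<theta>. b \<rho> * cos (r * \<rho> * cos \<theta> + \<Phi> \<rho>)"
  have B0: "0 \<le> B" using B[of 0] by linarith
  have c: "continuous_on (cbox (1/2, 0) (2, 2*pi)) (\<lambda>(\<rho>, \<theta>). ?f \<rho> \<theta>)"
    unfolding case_prod_beta cbox_Pair_eq
    by (intro continuous_intros continuous_on_compose2[OF b] continuous_on_compose2[OF \<Phi>]) auto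
  have "radial_integral b \<Phi> r = integral (cbox (1/2) 2) (\<lambda>\<rho>. integral (cbox 0 (2*pi)) (?f \<rho>))"
    unfolding radial_integral_def by simp
  also have "\<dots> = integral (cbox 0 (2*pi)) (\<lambda>\<theta>. integral (cbox (1/2) 2) (\<lambda>\<rho>. ?f \<rho> \<theta>))"
    by (rule integral_swap_continuous[OF c])
  finally have e: "radial_integral b \<Phi> r = integral {0..2*pi} (\<lambda>\<theta>. integral {1/2..2} (\<lambda>\<rho>. ?f \<rho> \<theta>))" by simp
  show ?thesis
  \<comment> \<open>A non-integrable function has the default integral 0, which satisfies the bound
    too; so both cases close without an argument for integrability in \<theta>.\<close>
  proof (cases "(\<lambda>\<theta>. integral {1/2..2} (\<lambda>\<rho>. ?f \<rho> \<theta>)) integrable_on {0..2*pi}")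
    case True
    have "norm (integral {0..2*pi} (\<lambda>\<theta>. integral {1/2..2} (\<lambda>\<rho>. ?f \<rho> \<theta>))) \<le> B * measure lborel (cbox 0 (2*pi))"
      by (rule has_integral_bound[OF B0]) (use True B in \<open>auto simp: has_integral_integral[symmetric]\<close>)
    then show ?thesis using e by (simp add: mult.commute)
  next
    case False
    then show ?thesis using e B0 by (simp add: not_integrable_integral)
  qed
qed

lemma radial_integral_trivial:
  assumes b: "continuous_on {1/2..2} b" and \<Phi>: "continuous_on {1/2..2} \<Phi>"
    and M: "\<And>\<rho>. \<rho> \<in> {1/2..2} \<Longrightarrow> \<bar>b \<rho>\<bar> \<le> M"
  shows "\<bar>radial_integral b \<Phi> r\<bar> \<le> 3 * pi * M"
proof -
  have "\<bar>radial_integral b \<Phi> r\<bar> \<le> 2 * pi * (M * (2 - 1/2))"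
  proof (rule radial_integral_le_sup_angle[OF b \<Phi>])
    fix \<theta>
    have "norm (integral {1/2..2} (\<lambda>\<rho>. b \<rho> * cos (r * \<rho> * cos \<theta> + \<Phi> \<rho>))) \<le> M * (2 - 1/2)"
    proof (rule integral_bound)
      show "continuous_on {1/2..2} (\<lambda>\<rho>. b \<rho> * cos (r * \<rho> * cos \<theta> + \<Phi> \<rho>))"
        by (intro continuous_intros b \<Phi>)
      fix \<rho> :: real assume \<rho>: "\<rho> \<in> {1/2..2}"
      have "\<bar>b \<rho> * cos (r * \<rho> * cos \<theta> + \<Phi> \<rho>)\<bar> \<le> M * 1"
        unfolding abs_mult using M[OF \<rho>] by (intro mult_mono) auto
      then show "norm (b \<rho> * cos (r * \<rho> * cos \<theta> + \<Phi> \<rho>)) \<le> M" by simp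
    qed simp
    then show "\<bar>integral {1/2..2} (\<lambda>\<rho>. b \<rho> * cos (r * \<rho> * cos \<theta> + \<Phi> \<rho>))\<bar> \<le> M * (2 - 1/2)" by simp
  qed
  then show ?thesis by (simp add: mult_ac)
qed

text \<open>Inserting the amplitudes of \<open>bess\<close> and the product formulas for cosines
  gives four integrals with phases \<Phi> \<plusminus> r \<rho> and amplitudes of order r^-1/2. The
  constant \<open>c\<close> in the hypothesis makes room for the shift by -pi/2 that writes a sine
  as a cosine.\<close>

lemma radial_integral_hankel:
  assumes db: "\<And>x. x \<in> {1/2..2} \<Longrightarrow> (b has_real_derivative b' x) (at x within {1/2..2})"
    and M: "\<And>x. x \<in> {1/2..2} \<Longrightarrow> \<bar>b x\<bar> \<le> M" "\<And>x. x \<in> {1/2..2} \<Longrightarrow> \<bar>b' x\<bar> \<le> M"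
  obtains C where "C > 0"
    "\<And>r \<Phi> B. r \<ge> 2 \<Longrightarrow> continuous_on {1/2..2} \<Phi> \<Longrightarrow>
      (\<And>\<sigma> c x. \<sigma> \<in> {-1, 1} \<Longrightarrow> x \<in> {1/2..2} \<Longrightarrow> \<bar>integral {1/2..x} (\<lambda>\<rho>. cos (\<Phi> \<rho> + \<sigma> * r * \<rho> + c))\<bar> \<le> B) \<Longrightarrow>
      \<bar>radial_integral b \<Phi> r\<bar> \<le> C * B / sqrt r"
proof -
  obtain M1 where M1: "M1 > 0" and amp: "\<And>r. r \<ge> 2 \<Longrightarrow> \<exists>F G F' G'. \<forall>\<rho>\<in>{1/2..2}.
       bess (r * \<rho>) = F \<rho> * cos (r * \<rho>) + G \<rho> * sin (r * \<rho>) \<and>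
       (F has_real_derivative F' \<rho>) (at \<rho> within {1/2..2}) \<and>
       (G has_real_derivative G' \<rho>) (at \<rho> within {1/2..2}) \<and>
       \<bar>F \<rho>\<bar> \<le> M1 / sqrt r \<and> \<bar>F' \<rho>\<bar> \<le> M1 / sqrt r \<and> \<bar>G \<rho>\<bar> \<le> M1 / sqrt r \<and> \<bar>G' \<rho>\<bar> \<le> M1 / sqrt r"
    by (rule bess_amplitudes) blast
  have M0: "0 \<le> M" using M(1)[of 1] by auto
  have bc: "continuous_on {1/2..2} b" using db by (rule DERIV_continuous_on)
  show ?thesis
  \<comment> \<open>Half the sum of four terms, each at most 5 M M1 B / sqrt r, gives the 10. The
    summand 1 keeps the constant positive when M = 0.\<close>
  proof (rule that[of "10 * M * M1 + 1"])
    show "10 * M * M1 + 1 > 0" using M0 M1 by (simp add: add_nonneg_pos)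
    fix r B :: real and \<Phi> assume r: "r \<ge> 2" and \<Phi>: "continuous_on {1/2..2} \<Phi>"
      and B: "\<And>\<sigma> c x. \<sigma> \<in> {-1, 1} \<Longrightarrow> x \<in> {1/2..2} \<Longrightarrow> \<bar>integral {1/2..x} (\<lambda>\<rho>. cos (\<Phi> \<rho> + \<sigma> * r * \<rho> + c))\<bar> \<le> B"
    have B0: "0 \<le> B" using B[of 1 1 0] by auto
    obtain F G F' G' where FG_all: "\<forall>\<rho>\<in>{1/2..2}.
       bess (r * \<rho>) = F \<rho> * cos (r * \<rho>) + G \<rho> * sin (r * \<rho>) \<and>
       (F has_real_derivative F' \<rho>) (at \<rho> within {1/2..2}) \<and>
       (G has_real_derivative G' \<rho>) (at \<rho> within {1/2..2}) \<and>
       \<bar>F \<rho>\<bar> \<le> M1 / sqrt r \<and> \<bar>F' \<rho>\<bar> \<le> M1 / sqrt r \<and> \<bar>G \<rho>\<bar> \<le> M1 / sqrt r \<and> \<bar>G' \<rho>\<bar> \<le> M1 / sqrt r"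
      using amp[OF r] by (elim exE)
    have FG: "bess (r * \<rho>) = F \<rho> * cos (r * \<rho>) + G \<rho> * sin (r * \<rho>)"
      and dF: "(F has_real_derivative F' \<rho>) (at \<rho> within {1/2..2})"
      and dG: "(G has_real_derivative G' \<rho>) (at \<rho> within {1/2..2})"
      and bF: "\<bar>F \<rho>\<bar> \<le> M1 / sqrt r" "\<bar>F' \<rho>\<bar> \<le> M1 / sqrt r"
      and bG: "\<bar>G \<rho>\<bar> \<le> M1 / sqrt r" "\<bar>G' \<rho>\<bar> \<le> M1 / sqrt r"
      if "\<rho> \<in> {1/2..2}" for \<rho>
      using bspec[OF FG_all that] by simp_all
    \<comment> \<open>The 5 is the factor 2 for the product rule times the 5/2 from
      \<open>amplitude_integral_bound\<close>.\<close>
    have one: "\<bar>integral {1/2..2} (\<lambda>\<rho>. (b \<rho> * H \<rho>) * cos (\<Phi> \<rho> + \<sigma> * r * \<rho> + c))\<bar> \<le> 5 * (M * M1 * B / sqrt r) \<and>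
        (\<lambda>\<rho>. (b \<rho> * H \<rho>) * cos (\<Phi> \<rho> + \<sigma> * r * \<rho> + c)) integrable_on {1/2..2}"
      if dH: "\<And>\<rho>. \<rho>\<in>{1/2..2} \<Longrightarrow> (H has_real_derivative H' \<rho>) (at \<rho> within {1/2..2})"
        and bH: "\<And>\<rho>. \<rho>\<in>{1/2..2} \<Longrightarrow> \<bar>H \<rho>\<bar> \<le> M1 / sqrt r" "\<And>\<rho>. \<rho>\<in>{1/2..2} \<Longrightarrow> \<bar>H' \<rho>\<bar> \<le> M1 / sqrt r"
        and \<sigma>: "\<sigma> \<in> {-1, 1}" for H H' \<sigma> c
    proof
      have Hc: "continuous_on {1/2..2} H" using dH by (rule DERIV_continuous_on)
      have s0: "0 \<le> M1 / sqrt r" using M1 r by simp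
      have "\<bar>integral {1/2..2} (\<lambda>\<rho>. (b \<rho> * H \<rho>) * cos (\<Phi> \<rho> + \<sigma> * r * \<rho> + c))\<bar> \<le> B * (2 * (M * (M1 / sqrt r))) * (1 + (2 - 1/2))"
      proof (rule amplitude_integral_bound[where f' = "\<lambda>\<rho>. b' \<rho> * H \<rho> + b \<rho> * H' \<rho>"])
        show "continuous_on {1/2..2} (\<lambda>\<rho>. cos (\<Phi> \<rho> + \<sigma> * r * \<rho> + c))"
          by (intro continuous_intros \<Phi>)
        fix \<rho> :: real assume \<rho>: "\<rho> \<in> {1/2..2}"
        show "((\<lambda>\<rho>. b \<rho> * H \<rho>) has_real_derivative b' \<rho> * H \<rho> + b \<rho> * H' \<rho>) (at \<rho> within {1/2..2})"
          by (auto intro!: derivative_eq_intros db[OF \<rho>] dH[OF \<rho>])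
        have 1: "\<bar>b \<rho> * H \<rho>\<bar> \<le> M * (M1 / sqrt r)" "\<bar>b' \<rho> * H \<rho>\<bar> \<le> M * (M1 / sqrt r)" "\<bar>b \<rho> * H' \<rho>\<bar> \<le> M * (M1 / sqrt r)"
          unfolding abs_mult by (rule mult_mono; use M[OF \<rho>] bH[OF \<rho>] M0 s0 in simp)+
        have 2: "0 \<le> M * (M1 / sqrt r)" using M0 s0 by (rule mult_nonneg_nonneg)
        from 1 2 show "\<bar>b \<rho> * H \<rho>\<bar> \<le> 2 * (M * (M1 / sqrt r))" "\<bar>b' \<rho> * H \<rho> + b \<rho> * H' \<rho>\<bar> \<le> 2 * (M * (M1 / sqrt r))"
          by linarith+
        show "\<bar>integral {1/2..\<rho>} (\<lambda>\<rho>. cos (\<Phi> \<rho> + \<sigma> * r * \<rho> + c))\<bar> \<le> B" by (rule B[OF \<sigma> \<rho>])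
      qed simp
      then show "\<bar>integral {1/2..2} (\<lambda>\<rho>. (b \<rho> * H \<rho>) * cos (\<Phi> \<rho> + \<sigma> * r * \<rho> + c))\<bar> \<le> 5 * (M * M1 * B / sqrt r)"
        by (simp add: mult_ac)
      show "(\<lambda>\<rho>. (b \<rho> * H \<rho>) * cos (\<Phi> \<rho> + \<sigma> * r * \<rho> + c)) integrable_on {1/2..2}"
        by (intro integrable_continuous_real continuous_intros bc Hc \<Phi>)
    qed
    let ?e = "\<lambda>H \<sigma> c \<rho>. (b \<rho> * H \<rho>) * cos (\<Phi> \<rho> + \<sigma> * r * \<rho> + c)"
    have pt: "b \<rho> * integral {0..2*pi} (\<lambda>\<theta>. cos (r * \<rho> * cos \<theta> + \<Phi> \<rho>)) =
       ((?e F 1 0 \<rho> + ?e F (-1) 0 \<rho>) + (?e G 1 (-pi/2) \<rho> - ?e G (-1) (-pi/2) \<rho>)) / 2"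
      if \<rho>: "\<rho> \<in> {1/2..2}" for \<rho>
    proof -
      have c1: "cos (y + - pi / 2) = sin y" for y :: real by (simp add: cos_diff)
      have "b \<rho> * integral {0..2*pi} (\<lambda>\<theta>. cos (r * \<rho> * cos \<theta> + \<Phi> \<rho>)) =
        b \<rho> * ((F \<rho> * cos (r * \<rho>) + G \<rho> * sin (r * \<rho>)) * cos (\<Phi> \<rho>))"
        unfolding angular_integral_bess FG[OF \<rho>] ..
      also have "\<dots> = ((?e F 1 0 \<rho> + ?e F (-1) 0 \<rho>) + (?e G 1 (-pi/2) \<rho> - ?e G (-1) (-pi/2) \<rho>)) / 2"
      proof -
        have e: "cos (\<Phi> \<rho> + 1 * r * \<rho> + 0) = cos (\<Phi> \<rho>) * cos (r * \<rho>) - sin (\<Phi> \<rho>) * sin (r * \<rho>)"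
          "cos (\<Phi> \<rho> + - 1 * r * \<rho> + 0) = cos (\<Phi> \<rho>) * cos (r * \<rho>) + sin (\<Phi> \<rho>) * sin (r * \<rho>)"
          "cos (\<Phi> \<rho> + 1 * r * \<rho> + - pi / 2) = sin (\<Phi> \<rho>) * cos (r * \<rho>) + cos (\<Phi> \<rho>) * sin (r * \<rho>)"
          "cos (\<Phi> \<rho> + - 1 * r * \<rho> + - pi / 2) = sin (\<Phi> \<rho>) * cos (r * \<rho>) - cos (\<Phi> \<rho>) * sin (r * \<rho>)"
          unfolding c1 by (simp_all add: cos_add cos_diff sin_add sin_diff)
        show ?thesis unfolding e by (simp add: field_simps)
      qed
      finally show ?thesis .
    qed
    have "radial_integral b \<Phi> r = integral {1/2..2} (\<lambda>\<rho>. ((?e F 1 0 \<rho> + ?e F (-1) 0 \<rho>) + (?e G 1 (-pi/2) \<rho> - ?e G (-1) (-pi/2) \<rho>)) / 2)"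
      unfolding radial_integral_def by (rule integral_cong) (rule pt)
    also have "\<dots> = ((integral {1/2..2} (?e F 1 0) + integral {1/2..2} (?e F (-1) 0))
        + (integral {1/2..2} (?e G 1 (-pi/2)) - integral {1/2..2} (?e G (-1) (-pi/2)))) / 2"
    proof (rule integral_unique)
      have i: "?e F 1 0 integrable_on {1/2..2}" "?e F (-1) 0 integrable_on {1/2..2}"
        "?e G 1 (-pi/2) integrable_on {1/2..2}" "?e G (-1) (-pi/2) integrable_on {1/2..2}"
        by (rule conjunct2[OF one[OF dF bF]] conjunct2[OF one[OF dG bG]]; simp)+
      show "((\<lambda>\<rho>. ((?e F 1 0 \<rho> + ?e F (-1) 0 \<rho>) + (?e G 1 (-pi/2) \<rho> - ?e G (-1) (-pi/2) \<rho>)) / 2) has_integral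
         ((integral {1/2..2} (?e F 1 0) + integral {1/2..2} (?e F (-1) 0))
        + (integral {1/2..2} (?e G 1 (-pi/2)) - integral {1/2..2} (?e G (-1) (-pi/2)))) / 2) {1/2..2}"
        by (intro has_integral_divide has_integral_add has_integral_diff integrable_integral i)
    qed
    finally have e: "radial_integral b \<Phi> r = \<dots>" .
    have "\<bar>integral {1/2..2} (?e F 1 0)\<bar> \<le> 5 * (M * M1 * B / sqrt r)"
      "\<bar>integral {1/2..2} (?e F (-1) 0)\<bar> \<le> 5 * (M * M1 * B / sqrt r)"
      "\<bar>integral {1/2..2} (?e G 1 (-pi/2))\<bar> \<le> 5 * (M * M1 * B / sqrt r)"
      "\<bar>integral {1/2..2} (?e G (-1) (-pi/2))\<bar> \<le> 5 * (M * M1 * B / sqrt r)"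
      by (rule conjunct1[OF one[OF dF bF]] conjunct1[OF one[OF dG bG]]; simp)+
    moreover have "\<bar>((A + B) + (C - D)) / 2\<bar> \<le> 10 * Q"
      if "\<bar>A\<bar> \<le> 5 * Q" "\<bar>B\<bar> \<le> 5 * Q" "\<bar>C\<bar> \<le> 5 * Q" "\<bar>D\<bar> \<le> 5 * Q" for A B C D Q :: real
      using that by (simp add: abs_le_iff)
    ultimately have "\<bar>radial_integral b \<Phi> r\<bar> \<le> 10 * (M * M1 * B / sqrt r)"
      unfolding e by blast
    also have "\<dots> = 10 * M * M1 * B / sqrt r" by simp
    also have "\<dots> \<le> (10 * M * M1 + 1) * B / sqrt r"
      using B0 r by (intro divide_right_mono mult_right_mono) auto
    finally show "\<bar>radial_integral b \<Phi> r\<bar> \<le> (10 * M * M1 + 1) * B / sqrt r" .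
  qed
qed

text \<open>For r <= \<mu>/2 the derivative of \<Phi>(\<rho>) + r \<rho> cos \<theta> stays above
  \<mu>/2 at every angle, and the first derivative test gives 1 / \<mu>. For larger r the second
  derivative test and the decay of \<open>bess\<close> give (\<mu> r)^-1/2, which is at most 2 /
  \<mu>. The latter needs r >= 2; in the gap \<mu>/2 < r < 2 one has \<mu> < 4, and the trivial
  bound is already of order 1 / \<mu>.\<close>

lemma radial_integral_bound_C2:
  assumes db: "\<And>x. x \<in> {1/2..2} \<Longrightarrow> (b has_real_derivative b' x) (at x within {1/2..2})"
    and M: "\<And>x. x \<in> {1/2..2} \<Longrightarrow> \<bar>b x\<bar> \<le> M" "\<And>x. x \<in> {1/2..2} \<Longrightarrow> \<bar>b' x\<bar> \<le> M"
  obtains C where "C > 0"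
    "\<And>r \<mu> \<Phi> \<Phi>' \<Phi>''. r \<ge> 0 \<Longrightarrow> \<mu> > 0 \<Longrightarrow>
      (\<And>x. x \<in> {1/2..2} \<Longrightarrow> (\<Phi> has_real_derivative \<Phi>' x) (at x within {1/2..2})) \<Longrightarrow>
      (\<And>x. x \<in> {1/2..2} \<Longrightarrow> (\<Phi>' has_real_derivative \<Phi>'' x) (at x within {1/2..2})) \<Longrightarrow>
      continuous_on {1/2..2} \<Phi>'' \<Longrightarrow>
      (\<And>x. x \<in> {1/2..2} \<Longrightarrow> \<mu> \<le> \<bar>\<Phi>' x\<bar>) \<Longrightarrow> (\<And>x. x \<in> {1/2..2} \<Longrightarrow> \<mu> \<le> \<bar>\<Phi>'' x\<bar>) \<Longrightarrow>
      \<bar>radial_integral b \<Phi> r\<bar> \<le> C * min 1 (1 / \<mu>)"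
proof -
  obtain C0 where C0: "C0 > 0" and hank: "\<And>r \<Phi> B. r \<ge> 2 \<Longrightarrow> continuous_on {1/2..2} \<Phi> \<Longrightarrow>
      (\<And>\<sigma> c x. \<sigma> \<in> {-1, 1} \<Longrightarrow> x \<in> {1/2..2} \<Longrightarrow> \<bar>integral {1/2..x} (\<lambda>\<rho>. cos (\<Phi> \<rho> + \<sigma> * r * \<rho> + c))\<bar> \<le> B) \<Longrightarrow>
      \<bar>radial_integral b \<Phi> r\<bar> \<le> C0 * B / sqrt r"
    using radial_integral_hankel[OF db M] by blast
  have M0: "0 \<le> M" using M(1)[of 1] by auto
  have bc: "continuous_on {1/2..2} b" using db by (rule DERIV_continuous_on)
  show ?thesis
  \<comment> \<open>The nonstationary case contributes 2 pi times 8 M / \<mu> times 5/2, that is 40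
    pi M / \<mu>. The case of large r contributes 10 C0 / (\<mu>/2). The trivial bound 3 pi M with
    \<mu> < 4 fits into the first.\<close>
  proof (rule that[of "40 * pi * M + 20 * C0"])
    show "40 * pi * M + 20 * C0 > 0" using C0 M0 by (simp add: add_nonneg_pos)
    fix r \<mu> :: real and \<Phi> \<Phi>' \<Phi>''
    assume r: "r \<ge> 0" and mu: "\<mu> > 0"
      and d1: "\<And>x. x \<in> {1/2..2} \<Longrightarrow> (\<Phi> has_real_derivative \<Phi>' x) (at x within {1/2..2})"
      and d2: "\<And>x. x \<in> {1/2..2} \<Longrightarrow> (\<Phi>' has_real_derivative \<Phi>'' x) (at x within {1/2..2})"
      and c2: "continuous_on {1/2..2} \<Phi>''"
      and b1: "\<And>x. x \<in> {1/2..2} \<Longrightarrow> \<mu> \<le> \<bar>\<Phi>' x\<bar>" and b2: "\<And>x. x \<in> {1/2..2} \<Longrightarrow> \<mu> \<le> \<bar>\<Phi>'' x\<bar>"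
    have sg: "(\<forall>x\<in>{1/2..2}. \<mu> \<le> \<Phi>'' x) \<or> (\<forall>x\<in>{1/2..2}. \<Phi>'' x \<le> - \<mu>)"
      by (rule continuous_bounded_away_from_zero_sign[OF c2 b2 mu])
    have c0: "continuous_on {1/2..2} \<Phi>" using d1 by (rule DERIV_continuous_on)
    have triv: "\<bar>radial_integral b \<Phi> r\<bar> \<le> 3 * pi * M" by (rule radial_integral_trivial[OF bc c0 M(1)])
    have ph1: "((\<lambda>\<rho>. k * \<rho> + \<Phi> \<rho> + c) has_real_derivative k + \<Phi>' x) (at x within {1/2..y})"
      and ph2: "((\<lambda>\<rho>. k + \<Phi>' \<rho>) has_real_derivative \<Phi>'' x) (at x within {1/2..y})"
      if x: "x \<in> {1/2..y}" "y \<in> {1/2..2}" for x y c k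
    proof -
      have "{1/2..y} \<subseteq> {1/2..2}" "x \<in> {1/2..2}" using x by auto
      note d = DERIV_subset[OF d1[OF this(2)] this(1)] DERIV_subset[OF d2[OF this(2)] this(1)]
      show "((\<lambda>\<rho>. k * \<rho> + \<Phi> \<rho> + c) has_real_derivative k + \<Phi>' x) (at x within {1/2..y})"
        "((\<lambda>\<rho>. k + \<Phi>' \<rho>) has_real_derivative \<Phi>'' x) (at x within {1/2..y})"
        by (auto intro!: derivative_eq_intros d)
    qed
    have "\<bar>radial_integral b \<Phi> r\<bar> \<le> (40 * pi * M + 20 * C0) / \<mu>"
    proof (cases "r \<le> \<mu> / 2")
      case True
      have "\<bar>radial_integral b \<Phi> r\<bar> \<le> 2 * pi * ((4 / (\<mu> / 2)) * M * (1 + (2 - 1/2)))"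
      proof (rule radial_integral_le_sup_angle[OF bc c0], rule amplitude_integral_bound[OF _ _ db M])
        fix \<theta>
        show "continuous_on {1/2..2} (\<lambda>\<rho>. cos (r * \<rho> * cos \<theta> + \<Phi> \<rho>))" by (intro continuous_intros c0)
        fix y :: real assume y: "y \<in> {1/2..2}"
        have rc: "\<bar>r * cos \<theta>\<bar> \<le> \<mu> / 2" using r True mult_left_le[of "\<bar>cos \<theta>\<bar>" r] by (simp add: abs_mult)
        have "\<bar>integral {1/2..y} (\<lambda>\<rho>. cos (r * cos \<theta> * \<rho> + \<Phi> \<rho> + 0))\<bar> \<le> 4 / (\<mu> / 2)"
        proof (rule van_der_Corput_first[OF _ ph1 ph2])
          show "(\<forall>x\<in>{1/2..y}. 0 \<le> \<Phi>'' x) \<or> (\<forall>x\<in>{1/2..y}. \<Phi>'' x \<le> 0)"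
            using sg y mu by (smt (verit) atLeastAtMost_iff)
          show "\<mu> / 2 \<le> \<bar>r * cos \<theta> + \<Phi>' x\<bar>" if "x \<in> {1/2..y}" for x
          proof -
            have "\<mu> \<le> \<bar>\<Phi>' x\<bar>" using b1[of x] that y by simp
            then show ?thesis using rc by linarith
          qed
        qed (use y mu in auto)
        then show "\<bar>integral {1/2..y} (\<lambda>\<rho>. cos (r * \<rho> * cos \<theta> + \<Phi> \<rho>))\<bar> \<le> 4 / (\<mu> / 2)"
          by (simp add: mult_ac)
      qed auto
      also have "\<dots> \<le> (40 * pi * M + 20 * C0) / \<mu>" using C0 mu by (simp add: field_simps)
      finally show ?thesis .
    next
      case False
      show ?thesis
      proof (cases "r < 2")
        case True
        then have "\<mu> < 4" using False by simp
        have "3 * pi * M * 1 \<le> 3 * pi * M * (4 / \<mu>)"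
          using M0 mu \<open>\<mu> < 4\<close> by (intro mult_left_mono) auto
        also have "\<dots> \<le> (40 * pi * M + 20 * C0) / \<mu>" using C0 mu M0 by (simp add: divide_right_mono)
        finally show ?thesis using triv by linarith
      next
        case r2: False
        have "\<bar>radial_integral b \<Phi> r\<bar> \<le> C0 * (10 / sqrt \<mu>) / sqrt r"
        proof (rule hank[OF _ c0])
          fix \<sigma> c y :: real assume y: "y \<in> {1/2..2}"
          have "\<bar>integral {1/2..y} (\<lambda>\<rho>. cos (\<sigma> * r * \<rho> + \<Phi> \<rho> + c))\<bar> \<le> 10 / sqrt \<mu>"
          proof (rule van_der_Corput_second[OF _ ph1 ph2])
            show "(\<forall>x\<in>{1/2..y}. \<mu> \<le> \<Phi>'' x) \<or> (\<forall>x\<in>{1/2..y}. \<Phi>'' x \<le> - \<mu>)"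
              using sg y by (smt (verit) atLeastAtMost_iff)
          qed (use y mu in auto)
          then show "\<bar>integral {1/2..y} (\<lambda>\<rho>. cos (\<Phi> \<rho> + \<sigma> * r * \<rho> + c))\<bar> \<le> 10 / sqrt \<mu>"
            by (simp add: add_ac)
        qed (use r2 in simp)
        also have "\<dots> = 10 * C0 / sqrt (\<mu> * r)" by (simp add: real_sqrt_mult)
        also have "\<dots> \<le> 10 * C0 / (\<mu> / 2)"
        proof (rule divide_left_mono)
          have "sqrt ((\<mu> / 2)^2) \<le> sqrt (\<mu> * r)" using False mu
            by (intro real_sqrt_le_mono) (simp add: power2_eq_square field_simps)
          then show "\<mu> / 2 \<le> sqrt (\<mu> * r)" using mu by simp
        qed (use C0 mu r2 in auto)
        also have "\<dots> \<le> (40 * pi * M + 20 * C0) / \<mu>" using M0 mu by (simp add: field_simps)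
        finally show ?thesis .
      qed
    qed
    moreover have "\<bar>radial_integral b \<Phi> r\<bar> \<le> 40 * pi * M + 20 * C0"
      using triv C0 M0 mult_nonneg_nonneg[of pi M] by simp
    ultimately show "\<bar>radial_integral b \<Phi> r\<bar> \<le> (40 * pi * M + 20 * C0) * min 1 (1 / \<mu>)"
      by (simp add: min_def)
  qed
qed

text \<open>The first integration by parts has no boundary terms, as \<open>b\<close> vanishes at
  both ends. It turns cos into sin and \<open>b\<close> into \<open>b1\<close>, the derivative of b
  / \<phi>', which is of size 1 / T. The second factor 1 / T comes from the first derivative test
  with amplitude \<open>b1\<close>; bounding the derivative \<open>b2\<close> of that amplitude is
  where \<phi>''' enters.\<close>

lemma nonstationary_twice:
  fixes b b' b'' \<phi> \<phi>' \<phi>'' \<phi>''' :: "real \<Rightarrow> real"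
  assumes db: "\<And>x. x \<in> {1/2..2} \<Longrightarrow> (b has_real_derivative b' x) (at x within {1/2..2})"
    and db': "\<And>x. x \<in> {1/2..2} \<Longrightarrow> (b' has_real_derivative b'' x) (at x within {1/2..2})"
    and M: "\<And>x. x \<in> {1/2..2} \<Longrightarrow> \<bar>b x\<bar> \<le> M" "\<And>x. x \<in> {1/2..2} \<Longrightarrow> \<bar>b' x\<bar> \<le> M" "\<And>x. x \<in> {1/2..2} \<Longrightarrow> \<bar>b'' x\<bar> \<le> M"
    and ends: "b (1/2) = 0" "b 2 = 0"
    and m: "m > 0" "T > 0"
    and d1: "\<And>x. x \<in> {1/2..2} \<Longrightarrow> (\<phi> has_real_derivative \<phi>' x) (at x within {1/2..2})"
    and d2: "\<And>x. x \<in> {1/2..2} \<Longrightarrow> (\<phi>' has_real_derivative \<phi>'' x) (at x within {1/2..2})"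
    and d3: "\<And>x. x \<in> {1/2..2} \<Longrightarrow> (\<phi>'' has_real_derivative \<phi>''' x) (at x within {1/2..2})"
    and lo: "\<And>x. x \<in> {1/2..2} \<Longrightarrow> m * T \<le> \<bar>\<phi>' x\<bar>"
    and hi: "\<And>x. x \<in> {1/2..2} \<Longrightarrow> \<bar>\<phi>' x\<bar> \<le> L * T" "\<And>x. x \<in> {1/2..2} \<Longrightarrow> \<bar>\<phi>'' x\<bar> \<le> L * T"
       "\<And>x. x \<in> {1/2..2} \<Longrightarrow> \<bar>\<phi>''' x\<bar> \<le> L * T"
    and sg: "(\<forall>x\<in>{1/2..2}. 0 \<le> \<phi>'' x) \<or> (\<forall>x\<in>{1/2..2}. \<phi>'' x \<le> 0)"
  shows "\<bar>integral {1/2..2} (\<lambda>x. b x * cos (\<phi> x))\<bar> \<le> 10 * (2 * M * L / m\<^sup>2 + 4 * M * L\<^sup>2 / m^3) / (m * T\<^sup>2)"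
proof -
  let ?I = "{1/2..2::real}"
  \<comment> \<open>\<open>N / T\<close> bounds \<open>b1\<close> as well as \<open>b2\<close>. The
    summands belong to the two quotients in \<open>b2\<close>: numerators of order T and T^2 over
    \<phi>'^2 and \<phi>'^3, so that each leaves 1 / T.\<close>
  define N where "N = 2 * M * L / m\<^sup>2 + 4 * M * L\<^sup>2 / m^3"
  define b1 where "b1 x = (b' x * \<phi>' x - b x * \<phi>'' x) / (\<phi>' x)\<^sup>2" for x
  define b2 where "b2 x = (b'' x * \<phi>' x - b x * \<phi>''' x) / (\<phi>' x)\<^sup>2
      - 2 * \<phi>'' x * (b' x * \<phi>' x - b x * \<phi>'' x) / (\<phi>' x)^3" for x
  have mT: "0 < m * T" using m by simp
  have M0: "0 \<le> M" and LT: "0 \<le> L * T" using M(1)[of 1] hi(1)[of 1] by auto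
  then have L0: "0 \<le> L" using m by (simp add: zero_le_mult_iff)
  have nz: "\<phi>' x \<noteq> 0" if "x \<in> ?I" for x using lo[OF that] mT by auto
  have c: "continuous_on ?I \<phi>" "continuous_on ?I b" using d1 db by (blast intro: DERIV_continuous_on)+
  have db1: "(b1 has_real_derivative b2 x) (at x within ?I)" if x: "x \<in> ?I" for x
  proof -
    have num: "((\<lambda>x. b' x * \<phi>' x - b x * \<phi>'' x) has_real_derivative b'' x * \<phi>' x - b x * \<phi>''' x) (at x within ?I)"
      by (auto intro!: derivative_eq_intros db[OF x] db'[OF x] d2[OF x] d3[OF x])
    have den: "((\<lambda>x. (\<phi>' x)\<^sup>2) has_real_derivative 2 * \<phi>' x * \<phi>'' x) (at x within ?I)"
      by (auto intro!: derivative_eq_intros d2[OF x])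
    have "(u * p\<^sup>2 - w * (2 * p * c)) / (p\<^sup>2 * p\<^sup>2) = u / p\<^sup>2 - 2 * c * w / p^3" if "p \<noteq> 0" for u w c p :: real
      using that by (simp add: field_simps power2_eq_square power3_eq_cube)
    then show ?thesis
      unfolding b1_def[abs_def] b2_def using DERIV_divide[OF num den] nz[OF x] by simp
  qed
  have c1: "continuous_on ?I b1" using db1 by (rule DERIV_continuous_on)
  have num: "\<bar>b' x * \<phi>' x - b x * \<phi>'' x\<bar> \<le> 2 * M * (L * T)" "\<bar>b'' x * \<phi>' x - b x * \<phi>''' x\<bar> \<le> 2 * M * (L * T)"
    if x: "x \<in> ?I" for x
  proof -
    have "\<bar>b' x * \<phi>' x\<bar> \<le> M * (L * T)" "\<bar>b x * \<phi>'' x\<bar> \<le> M * (L * T)"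
      "\<bar>b'' x * \<phi>' x\<bar> \<le> M * (L * T)" "\<bar>b x * \<phi>''' x\<bar> \<le> M * (L * T)"
      unfolding abs_mult by (rule mult_mono; use M[OF x] hi[OF x] M0 LT in simp)+
    then show "\<bar>b' x * \<phi>' x - b x * \<phi>'' x\<bar> \<le> 2 * M * (L * T)" "\<bar>b'' x * \<phi>' x - b x * \<phi>''' x\<bar> \<le> 2 * M * (L * T)"
      by linarith+
  qed
  have den: "(m * T)^n \<le> \<bar>\<phi>' x\<bar>^n" if "x \<in> ?I" for x n
    using lo[OF that] mT by (intro power_mono) auto
  have N2: "2 * M * (L * T) / (m * T)\<^sup>2 = (2 * M * L / m\<^sup>2) / T"
    using m by (simp add: field_simps power2_eq_square)
  have N3: "2 * (L * T) * (2 * M * (L * T)) / (m * T)^3 = (4 * M * L\<^sup>2 / m^3) / T"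
    using m by (simp add: field_simps power2_eq_square power3_eq_cube)
  have NN: "0 \<le> 2 * M * L / m\<^sup>2" "0 \<le> 4 * M * L\<^sup>2 / m^3" using M0 L0 m by auto
  have q2: "\<bar>u / (\<phi>' x)\<^sup>2\<bar> \<le> (2 * M * L / m\<^sup>2) / T" if x: "x \<in> ?I" and u: "\<bar>u\<bar> \<le> 2 * M * (L * T)" for u x
  proof -
    have "\<bar>u / (\<phi>' x)\<^sup>2\<bar> = \<bar>u\<bar> / \<bar>\<phi>' x\<bar>\<^sup>2" by simp
    also have "\<dots> \<le> 2 * M * (L * T) / (m * T)\<^sup>2"
      using den[OF x, of 2] u mT M0 LT by (intro frac_le) auto
    finally show ?thesis unfolding N2 .
  qed
  have bb1: "\<bar>b1 x\<bar> \<le> N / T" if x: "x \<in> ?I" for x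
  proof -
    have "\<bar>b1 x\<bar> \<le> (2 * M * L / m\<^sup>2) / T" unfolding b1_def by (rule q2[OF x num(1)[OF x]])
    also have "\<dots> \<le> N / T" unfolding N_def using NN m by (intro divide_right_mono) auto
    finally show ?thesis .
  qed
  have bb2: "\<bar>b2 x\<bar> \<le> N / T" if x: "x \<in> ?I" for x
  proof -
    have "\<bar>2 * \<phi>'' x * (b' x * \<phi>' x - b x * \<phi>'' x)\<bar> \<le> (2 * (L * T)) * (2 * M * (L * T))"
      unfolding abs_mult[of "2 * \<phi>'' x"] by (rule mult_mono; use hi[OF x] num[OF x] LT in simp)
    then have "\<bar>2 * \<phi>'' x * (b' x * \<phi>' x - b x * \<phi>'' x)\<bar> / \<bar>\<phi>' x\<bar>^3 \<le> 2 * (L * T) * (2 * M * (L * T)) / (m * T)^3"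
      using den[OF x, of 3] mT by (intro frac_le) auto
    then have "\<bar>2 * \<phi>'' x * (b' x * \<phi>' x - b x * \<phi>'' x) / (\<phi>' x)^3\<bar> \<le> (4 * M * L\<^sup>2 / m^3) / T"
      unfolding N3 abs_divide power_abs .
    moreover have "\<bar>(b'' x * \<phi>' x - b x * \<phi>''' x) / (\<phi>' x)\<^sup>2\<bar> \<le> (2 * M * L / m\<^sup>2) / T"
      by (rule q2[OF x num(2)[OF x]])
    ultimately show ?thesis unfolding b2_def N_def add_divide_distrib[of _ _ T] by linarith
  qed
  have I: "((\<lambda>x. b x * cos (\<phi> x) + b1 x * sin (\<phi> x)) has_integral
      (b 2 / \<phi>' 2 * sin (\<phi> 2) - b (1/2) / \<phi>' (1/2) * sin (\<phi> (1/2)))) ?I"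
  proof (rule fundamental_theorem_of_calculus, simp, unfold has_real_derivative_iff_has_vector_derivative[symmetric])
    fix x assume x: "x \<in> ?I"
    show "((\<lambda>x. b x / \<phi>' x * sin (\<phi> x)) has_real_derivative b x * cos (\<phi> x) + b1 x * sin (\<phi> x)) (at x within ?I)"
      unfolding b1_def using nz[OF x]
      by (auto intro!: derivative_eq_intros db[OF x] d1[OF x] d2[OF x]) (simp add: field_simps power2_eq_square)
  qed
  have i: "(\<lambda>x. b x * cos (\<phi> x)) integrable_on ?I" "(\<lambda>x. b1 x * sin (\<phi> x)) integrable_on ?I"
    by (intro integrable_continuous_real continuous_intros c c1)+
  have "integral ?I (\<lambda>x. b x * cos (\<phi> x)) = - integral ?I (\<lambda>x. b1 x * sin (\<phi> x))"
    using integral_unique[OF I] integral_add[OF i] ends by simp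
  also have "(\<lambda>x. b1 x * sin (\<phi> x)) = (\<lambda>x. b1 x * cos (\<phi> x - pi / 2))" by (simp add: cos_diff)
  finally have "\<bar>integral ?I (\<lambda>x. b x * cos (\<phi> x))\<bar> = \<bar>integral ?I (\<lambda>x. b1 x * cos (\<phi> x - pi / 2))\<bar>" by simp
  also have "\<dots> \<le> (4 / (m * T)) * (N / T) * (1 + (2 - 1/2))"
  proof (rule amplitude_integral_bound[OF _ _ db1 bb1 bb2])
    show "continuous_on ?I (\<lambda>x. cos (\<phi> x - pi / 2))" by (intro continuous_intros c)
    fix y :: real assume y: "y \<in> ?I"
    then have s: "{1/2..y} \<subseteq> ?I" by auto
    show "\<bar>integral {1/2..y} (\<lambda>x. cos (\<phi> x - pi / 2))\<bar> \<le> 4 / (m * T)"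
    proof (rule van_der_Corput_first[where \<phi>' = \<phi>' and \<phi>'' = \<phi>''])
      fix x assume x: "x \<in> {1/2..y}"
      then have x': "x \<in> ?I" using s by blast
      show "((\<lambda>x. \<phi> x - pi / 2) has_real_derivative \<phi>' x) (at x within {1/2..y})"
        by (auto intro!: derivative_eq_intros DERIV_subset[OF d1[OF x'] s])
      show "(\<phi>' has_real_derivative \<phi>'' x) (at x within {1/2..y})"
        by (rule DERIV_subset[OF d2[OF x'] s])
      show "m * T \<le> \<bar>\<phi>' x\<bar>" by (rule lo[OF x'])
    next
      show "(\<forall>x\<in>{1/2..y}. 0 \<le> \<phi>'' x) \<or> (\<forall>x\<in>{1/2..y}. \<phi>'' x \<le> 0)" using sg s by blast
    qed (use y mT in auto)
  qed auto
  also have "\<dots> = 10 * N / (m * T\<^sup>2)" using m by (simp add: power2_eq_square)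
  finally show ?thesis unfolding N_def .
qed

text \<open>Away from r ~ T no stationary point occurs, and either side improves on 1 / T. If r is
  small, the phase at each fixed angle is nonstationary and two integrations by parts give T^-2. If
  r is large, it dominates \<Phi>', so the first derivative test gives 1 / r for the phases \<Phi>
  \<plusminus> r \<rho>; with the decay r^-1/2 of \<open>bess\<close> this is r^-3/2, at most
  T^-3/2. Here \<open>\<kappa>\<close> depends only on \<open>m\<close> and \<open>L\<close>, so it
  is uniform in the scale.\<close>

lemma radial_integral_bound_C3:
  assumes db: "\<And>x. x \<in> {1/2..2} \<Longrightarrow> (b has_real_derivative b' x) (at x within {1/2..2})"
    and db': "\<And>x. x \<in> {1/2..2} \<Longrightarrow> (b' has_real_derivative b'' x) (at x within {1/2..2})"
    and M: "\<And>x. x \<in> {1/2..2} \<Longrightarrow> \<bar>b x\<bar> \<le> M" "\<And>x. x \<in> {1/2..2} \<Longrightarrow> \<bar>b' x\<bar> \<le> M" "\<And>x. x \<in> {1/2..2} \<Longrightarrow> \<bar>b'' x\<bar> \<le> M"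
    and ends: "b (1/2) = 0" "b 2 = 0"
    and m: "m > 0" and L: "L > 0"
  obtains C \<kappa> where "C > 0" "0 < \<kappa>" 
    "\<And>r T \<Phi> \<Phi>' \<Phi>'' \<Phi>'''. r \<ge> 0 \<Longrightarrow> T \<ge> 1 \<Longrightarrow> r \<le> \<kappa> * T \<or> T \<le> \<kappa> * r \<Longrightarrow>
      (\<And>x. x \<in> {1/2..2} \<Longrightarrow> (\<Phi> has_real_derivative \<Phi>' x) (at x within {1/2..2})) \<Longrightarrow>
      (\<And>x. x \<in> {1/2..2} \<Longrightarrow> (\<Phi>' has_real_derivative \<Phi>'' x) (at x within {1/2..2})) \<Longrightarrow>
      (\<And>x. x \<in> {1/2..2} \<Longrightarrow> (\<Phi>'' has_real_derivative \<Phi>''' x) (at x within {1/2..2})) \<Longrightarrow>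
      (\<And>x. x \<in> {1/2..2} \<Longrightarrow> m * T \<le> \<bar>\<Phi>' x\<bar> \<and> \<bar>\<Phi>' x\<bar> \<le> L * T) \<Longrightarrow> 
      (\<And>x. x \<in> {1/2..2} \<Longrightarrow> m * T \<le> \<bar>\<Phi>'' x\<bar> \<and> \<bar>\<Phi>'' x\<bar> \<le> L * T) \<Longrightarrow> 
      (\<And>x. x \<in> {1/2..2} \<Longrightarrow> \<bar>\<Phi>''' x\<bar> \<le> L * T) \<Longrightarrow> 
      \<bar>radial_integral b \<Phi> r\<bar> \<le> C / (T * sqrt T)"
proof -
  obtain C0 where C0: "C0 > 0" and hank: "\<And>r \<Phi> B. r \<ge> 2 \<Longrightarrow> continuous_on {1/2..2} \<Phi> \<Longrightarrow>
      (\<And>\<sigma> c x. \<sigma> \<in> {-1, 1} \<Longrightarrow> x \<in> {1/2..2} \<Longrightarrow> \<bar>integral {1/2..x} (\<lambda>\<rho>. cos (\<Phi> \<rho> + \<sigma> * r * \<rho> + c))\<bar> \<le> B) \<Longrightarrow>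
      \<bar>radial_integral b \<Phi> r\<bar> \<le> C0 * B / sqrt r"
    using radial_integral_hankel[OF db M(1,2)] by blast
  have M0: "0 \<le> M" using M(1)[of 1] by auto
  have bc: "continuous_on {1/2..2} b" using db by (rule DERIV_continuous_on)
  \<comment> \<open>\<open>m'\<close> and \<open>L'\<close> are the lower and upper constants for
    \<Phi> perturbed by r \<rho> cos \<theta> with r <= m T / 2.\<close>
  define m' where "m' = m / 2"
  define L' where "L' = L + m"
  define C1 where "C1 = 10 * (2 * M * L' / m'\<^sup>2 + 4 * M * L'\<^sup>2 / m'^3) / m'"
  \<comment> \<open>For r <= \<kappa> T the bound m/2 keeps |r cos \<theta>| below half of the lower
    bound m T of |\<Phi>'|. For T <= \<kappa> r the bound 1 / (2 L) gives |\<Phi>'| <= L T <= r/2,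
    and the bound 1/2 gives r >= 2 T >= 2, the range in which the amplitudes of \<open>bess\<close>
    are controlled.\<close>
  define \<kappa> where "\<kappa> = min (1/2) (min (m / 2) (1 / (2 * L)))"
  have \<kappa>: "0 < \<kappa>" "\<kappa> \<le> 1/2" "\<kappa> \<le> m / 2" "\<kappa> \<le> 1 / (2 * L)" using m L by (auto simp: \<kappa>_def)
  have C1: "C1 \<ge> 0" using M0 m L by (auto simp: C1_def m'_def L'_def)
  show ?thesis
  proof (rule that[of "2 * pi * C1 + 8 * C0" \<kappa>])
    show "2 * pi * C1 + 8 * C0 > 0" using C0 C1 by (simp add: add_nonneg_pos)
    show "0 < \<kappa>" by fact
    fix r T :: real and \<Phi> \<Phi>' \<Phi>'' \<Phi>''' :: "real \<Rightarrow> real"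
    assume r: "r \<ge> 0" and T: "T \<ge> 1" and rT: "r \<le> \<kappa> * T \<or> T \<le> \<kappa> * r"
      and d1: "\<And>x. x \<in> {1/2..2} \<Longrightarrow> (\<Phi> has_real_derivative \<Phi>' x) (at x within {1/2..2})"
      and d2: "\<And>x. x \<in> {1/2..2} \<Longrightarrow> (\<Phi>' has_real_derivative \<Phi>'' x) (at x within {1/2..2})"
      and d3: "\<And>x. x \<in> {1/2..2} \<Longrightarrow> (\<Phi>'' has_real_derivative \<Phi>''' x) (at x within {1/2..2})"
      and b1: "\<And>x. x \<in> {1/2..2} \<Longrightarrow> m * T \<le> \<bar>\<Phi>' x\<bar> \<and> \<bar>\<Phi>' x\<bar> \<le> L * T"
      and b2: "\<And>x. x \<in> {1/2..2} \<Longrightarrow> m * T \<le> \<bar>\<Phi>'' x\<bar> \<and> \<bar>\<Phi>'' x\<bar> \<le> L * T"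
      and b3: "\<And>x. x \<in> {1/2..2} \<Longrightarrow> \<bar>\<Phi>''' x\<bar> \<le> L * T"
    have c0: "continuous_on {1/2..2} \<Phi>" using d1 by (rule DERIV_continuous_on)
    have c2: "continuous_on {1/2..2} \<Phi>''" using d3 by (rule DERIV_continuous_on)
    have mT: "m * T > 0" using m T by simp
    have sg: "(\<forall>x\<in>{1/2..2}. m * T \<le> \<Phi>'' x) \<or> (\<forall>x\<in>{1/2..2}. \<Phi>'' x \<le> - (m * T))"
      by (rule continuous_bounded_away_from_zero_sign[OF c2 _ mT]) (use b2 in blast)
    have sg0: "(\<forall>x\<in>{1/2..2}. 0 \<le> \<Phi>'' x) \<or> (\<forall>x\<in>{1/2..2}. \<Phi>'' x \<le> 0)"
      using sg mT by (meson dual_order.trans less_imp_le neg_le_0_iff_le)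
    have sT: "1 \<le> sqrt T" using T by simp
    show "\<bar>radial_integral b \<Phi> r\<bar> \<le> (2 * pi * C1 + 8 * C0) / (T * sqrt T)"
    proof (cases "r \<le> \<kappa> * T")
      case True
      have rm: "r \<le> m' * T" 
      proof -
        have "\<kappa> * T \<le> m / 2 * T" using \<kappa>(3) T by (intro mult_right_mono) auto
        then show ?thesis using True unfolding m'_def by linarith
      qed
      have "\<bar>radial_integral b \<Phi> r\<bar> \<le> 2 * pi * (10 * (2 * M * L' / m'\<^sup>2 + 4 * M * L'\<^sup>2 / m'^3) / (m' * T\<^sup>2))"
      proof (rule radial_integral_le_sup_angle[OF bc c0], rule nonstationary_twice[OF db db' M ends])
        fix \<theta>
        have rc: "\<bar>r * cos \<theta>\<bar> \<le> m' * T" using r rm mult_left_le[of "\<bar>cos \<theta>\<bar>" r] by (simp add: abs_mult)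
        fix x :: real assume x: "x \<in> {1/2..2}"
        show "((\<lambda>\<rho>. r * \<rho> * cos \<theta> + \<Phi> \<rho>) has_real_derivative r * cos \<theta> + \<Phi>' x) (at x within {1/2..2})"
          "((\<lambda>\<rho>. r * cos \<theta> + \<Phi>' \<rho>) has_real_derivative \<Phi>'' x) (at x within {1/2..2})"
          "(\<Phi>'' has_real_derivative \<Phi>''' x) (at x within {1/2..2})"
          by (auto intro!: derivative_eq_intros d1[OF x] d2[OF x] d3[OF x])
        have e: "m * T = 2 * (m' * T)" "L' * T = L * T + 2 * (m' * T)" by (auto simp: m'_def L'_def algebra_simps)
        show "m' * T \<le> \<bar>r * cos \<theta> + \<Phi>' x\<bar>" using rc b1[OF x] unfolding e by linarith
        show "\<bar>r * cos \<theta> + \<Phi>' x\<bar> \<le> L' * T" "\<bar>\<Phi>'' x\<bar> \<le> L' * T" "\<bar>\<Phi>''' x\<bar> \<le> L' * T"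
          using rc b1[OF x] b2[OF x] b3[OF x] mT unfolding e by linarith+
      qed (use m T sg0 in \<open>auto simp: m'_def\<close>)
      also have "\<dots> = 2 * pi * C1 / (T * T)" using T by (simp add: C1_def power2_eq_square)
      also have "\<dots> \<le> 2 * pi * C1 / (T * sqrt T)"
      proof (rule divide_left_mono)
        have "sqrt T * 1 \<le> sqrt T * sqrt T" using sT by (intro mult_left_mono) auto
        then show "T * sqrt T \<le> T * T" using T by simp
      qed (use C1 T in auto)
      also have "\<dots> \<le> (2 * pi * C1 + 8 * C0) / (T * sqrt T)"
        using C0 T by (intro divide_right_mono) auto
      finally show ?thesis .
    next
      case False
      then have 1: "T \<le> \<kappa> * r" using rT by simp
      have "\<kappa> * r \<le> (1/2) * r" "\<kappa> * r \<le> 1 / (2 * L) * r" using r \<kappa> by (intro mult_right_mono; simp)+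
      with 1 have "2 * T \<le> r" "T \<le> 1 / (2 * L) * r" by linarith+
      then have rb: "2 * T \<le> r" "L * T \<le> r / 2" using L by (auto simp: field_simps)
      have "\<bar>radial_integral b \<Phi> r\<bar> \<le> C0 * (4 / (r / 2)) / sqrt r"
      proof (rule hank[OF _ c0])
        show "2 \<le> r" using rb T by simp
        fix \<sigma> c y :: real assume y: "y \<in> {1/2..2}" and s: "\<sigma> \<in> {-1, 1}"
        then have sub: "{1/2..y} \<subseteq> {1/2..2}" by auto
        show "\<bar>integral {1/2..y} (\<lambda>\<rho>. cos (\<Phi> \<rho> + \<sigma> * r * \<rho> + c))\<bar> \<le> 4 / (r / 2)"
        proof (rule van_der_Corput_first)
          fix x assume x: "x \<in> {1/2..y}"
          then have x': "x \<in> {1/2..2}" using sub by blast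
          show "((\<lambda>\<rho>. \<Phi> \<rho> + \<sigma> * r * \<rho> + c) has_real_derivative \<Phi>' x + \<sigma> * r) (at x within {1/2..y})"
            "((\<lambda>\<rho>. \<Phi>' \<rho> + \<sigma> * r) has_real_derivative \<Phi>'' x) (at x within {1/2..y})"
            by (auto intro!: derivative_eq_intros DERIV_subset[OF d1[OF x'] sub] DERIV_subset[OF d2[OF x'] sub])
          have "\<bar>\<sigma> * r\<bar> = r" using s r by auto
          then show "r / 2 \<le> \<bar>\<Phi>' x + \<sigma> * r\<bar>" using b1[OF x'] rb(2) by linarith
        next
          show "(\<forall>x\<in>{1/2..y}. 0 \<le> \<Phi>'' x) \<or> (\<forall>x\<in>{1/2..y}. \<Phi>'' x \<le> 0)" using sg0 sub by blast
        qed (use y rb T in auto)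
      qed
      also have "\<dots> = 8 * C0 / (r * sqrt r)" by simp
      also have "\<dots> \<le> 8 * C0 / (T * sqrt T)"
        using C0 T rb by (intro divide_left_mono mult_mono) auto
      also have "\<dots> \<le> (2 * pi * C1 + 8 * C0) / (T * sqrt T)"
        using C1 T by (intro divide_right_mono) auto
      finally show ?thesis .
    qed
  qed
qed

section \<open>Polar coordinates in the plane\<close>

lemma Basis_real2: "(Basis :: (real^2) set) = {axis 1 1, axis 2 1}"
  by (auto simp: Basis_vec_def UNIV_2)

lemma axis_real2_neq: "axis 1 1 \<noteq> (axis 2 1 :: real^2)"
  by (auto simp: axis_eq_axis)

lemma continuous_on_vector2 [continuous_intros]:
  assumes "continuous_on S f" "continuous_on S g"
  shows "continuous_on S (\<lambda>x. vector [f x, g x] :: real^2)"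
proof -
  have "(\<lambda>x. vector [f x, g x] :: real^2) = (\<lambda>x. \<chi> i. if i = 1 then f x else g x)"
    by (auto simp: vec_eq_iff forall_2)
  moreover have "continuous_on S (\<lambda>x. if i = 1 then f x else g x)" for i :: 2
    by (cases "i = 1") (simp_all add: assms)
  ultimately show ?thesis by (simp only: continuous_on_vec_lambda)
qed

text \<open>Lebesgue measure is determined by its values on boxes, and the map matches the boxes of
  the two spaces. This carries Fubini's theorem from \<open>real \<times> real\<close> over to
  \<open>real^2\<close>.\<close>

lemma lborel_real2: "(lborel :: (real^2) measure) = distr lborel borel (\<lambda>p. vector [fst p, snd p])"
proof (rule lborel_eqI)
  have v: "(\<lambda>p :: real \<times> real. vector [fst p, snd p] :: real^2) \<in> borel_measurable borel"
    by (intro borel_measurable_continuous_onI continuous_intros)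
  fix l u :: "real^2" assume lu: "\<And>b. b \<in> Basis \<Longrightarrow> l \<bullet> b \<le> u \<bullet> b"
  have "(\<lambda>p. vector [fst p, snd p]) -` box l u \<inter> space lborel = box (l $ 1, l $ 2) (u $ 1, u $ 2)"
    by (auto simp: mem_box Basis_real2 Basis_prod_def inner_axis)
  then have "emeasure (distr lborel borel (\<lambda>p :: real \<times> real. vector [fst p, snd p])) (box l u) =
      emeasure lborel (box (l $ 1, l $ 2) (u $ 1, u $ 2))"
    using v by (subst emeasure_distr) auto
  also have "\<dots> = ennreal (\<Prod>b\<in>Basis. (u - l) \<bullet> b)"
    using lu[of "axis 1 1"] lu[of "axis 2 1"]
    by (simp add: emeasure_lborel_box_eq Basis_real2 Basis_prod_def inner_axis axis_real2_neq)
  finally show "emeasure (distr lborel borel (\<lambda>p :: real \<times> real. vector [fst p, snd p])) (box l u) =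
      ennreal (\<Prod>b\<in>Basis. (u - l) \<bullet> b)" .
qed simp

lemma integral_cbox_real2:
  fixes h :: "real^2 \<Rightarrow> real"
  assumes h: "continuous_on (cbox (vector [a, c]) (vector [b, d])) h"
  shows "integral (cbox (vector [a, c]) (vector [b, d])) h =
    integral {a..b} (\<lambda>x. integral {c..d} (\<lambda>y. h (vector [x, y])))"
proof -
  let ?v = "\<lambda>p. vector [fst p, snd p] :: real^2"
  let ?Q = "cbox (vector [a, c]) (vector [b, d]) :: (real^2) set"
  have v: "?v \<in> borel_measurable borel"
    by (intro borel_measurable_continuous_onI continuous_intros)
  have mem: "?v p \<in> ?Q \<longleftrightarrow> p \<in> cbox (a, c) (b, d)" for p
    by (auto simp: mem_box Basis_real2 Basis_prod_def inner_axis inner_prod_def)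
  have hv: "continuous_on (cbox (a, c) (b, d)) (\<lambda>p. h (?v p))"
    by (rule continuous_on_compose2[OF h]) (use mem in \<open>auto intro!: continuous_intros\<close>)
  have i1: "set_integrable lborel ?Q h"
    unfolding set_integrable_def by (rule borel_integrable_compact[OF compact_cbox h])
  have i2: "set_integrable lborel (cbox (a, c) (b, d)) (\<lambda>p. h (?v p))"
    unfolding set_integrable_def by (rule borel_integrable_compact[OF compact_cbox hv])
  have "integral ?Q h = (LINT x:?Q|lborel. h x)"
    using set_borel_integral_eq_integral[OF i1] by simp
  also have "\<dots> = (LINT p|lborel. indicator ?Q (?v p) *\<^sub>R h (?v p))"
    unfolding set_lebesgue_integral_def
    by (subst lborel_real2, rule integral_distr)
      (use v borel_measurable_integrable[OF i1[unfolded set_integrable_def]] in simp_all)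
  also have "\<dots> = (LINT p:cbox (a, c) (b, d)|lborel. h (?v p))"
    unfolding set_lebesgue_integral_def using mem by (simp add: indicator_def)
  also have "\<dots> = integral (cbox (a, c) (b, d)) (\<lambda>p. h (?v p))"
    using set_borel_integral_eq_integral[OF i2] by simp
  also have "\<dots> = integral {a..b} (\<lambda>x. integral {c..d} (\<lambda>y. h (vector [x, y])))"
    using integral_prod_continuous[OF hv] by simp
  finally show ?thesis .
qed

lemma norm_polar: "norm (vector [\<rho> * cos \<theta>, \<rho> * sin \<theta>] :: real^2) = \<bar>\<rho>\<bar>"
proof -
  have "norm (vector [\<rho> * cos \<theta>, \<rho> * sin \<theta>] :: real^2) = sqrt (\<rho>\<^sup>2 * ((cos \<theta>)\<^sup>2 + (sin \<theta>)\<^sup>2))"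
    unfolding norm_vec_def L2_set_def
    by (simp add: sum_2 power_mult_distrib distrib_left del: sin_cos_squared_add sin_cos_squared_add2)
  then show ?thesis by (simp only: sin_cos_squared_add2) simp
qed

lemma polar_exists:
  fixes x :: "real^2"
  obtains \<theta> where "0 \<le> \<theta>" "\<theta> < 2 * pi" "x = vector [norm x * cos \<theta>, norm x * sin \<theta>]"
proof (cases "x = 0")
  case True
  then have "x = vector [norm x * cos 0, norm x * sin 0]" by (subst vec_eq_iff) (simp add: forall_2)
  then show ?thesis using that[of 0] by simp
next
  case False
  have n: "(norm x)\<^sup>2 = (x $ 1)\<^sup>2 + (x $ 2)\<^sup>2"
    unfolding norm_vec_def L2_set_def by (simp add: sum_2)
  have "(x $ 1 / norm x)\<^sup>2 + (x $ 2 / norm x)\<^sup>2 = 1"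
    using False by (simp only: power_divide add_divide_distrib[symmetric] n[symmetric]) simp
  then obtain \<theta> where \<theta>: "0 \<le> \<theta>" "\<theta> < 2 * pi" "x $ 1 / norm x = cos \<theta>" "x $ 2 / norm x = sin \<theta>"
    by (rule sincos_total_2pi)
  show ?thesis
  proof (rule that[OF \<theta>(1,2)])
    show "x = vector [norm x * cos \<theta>, norm x * sin \<theta>]"
      using False unfolding \<theta>(3,4)[symmetric] vec_eq_iff forall_2 by simp
  qed
qed

lemma absolutely_integrable_continuous_compact:
  fixes f :: "'a::euclidean_space \<Rightarrow> 'b::euclidean_space"
  assumes "compact S" "continuous_on S f"
  shows "f absolutely_integrable_on S"
proof -
  have "integrable lborel (\<lambda>x. indicator S x *\<^sub>R f x)" by (rule borel_integrable_compact[OF assms])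
  then show ?thesis unfolding set_integrable_def
    by (subst integrable_completion) (auto dest: borel_measurable_integrable)
qed

lemma compact_annulus: "compact {\<xi> :: 'a::euclidean_space. a \<le> norm \<xi> \<and> norm \<xi> \<le> b}"
proof -
  have "{\<xi> :: 'a. a \<le> norm \<xi> \<and> norm \<xi> \<le> b} = cball 0 b \<inter> {\<xi>. a \<le> norm \<xi>}" by auto
  moreover have "closed {\<xi> :: 'a. a \<le> norm \<xi>}" by (intro closed_Collect_le continuous_intros)
  ultimately show ?thesis by (simp add: compact_Int_closed)
qed

text \<open>The polar map has Jacobian determinant N^2 \<rho>. The offset \<open>\<theta>0\<close>
  allows the angle to be measured from the direction of a given vector, later that of x.\<close>

lemma integral_annulus_polar:
  fixes F :: "real^2 \<Rightarrow> real"
  assumes N: "0 < N" and a: "0 < a" "a \<le> b"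
    and F: "continuous_on {\<xi>. N * a \<le> norm \<xi> \<and> norm \<xi> \<le> N * b} F"
  shows "integral {\<xi>. N * a \<le> norm \<xi> \<and> norm \<xi> \<le> N * b} F =
    integral {a..b} (\<lambda>\<rho>. integral {0..2*pi} (\<lambda>\<theta>.
      N\<^sup>2 * \<rho> * F (vector [N * \<rho> * cos (\<theta> + \<theta>0), N * \<rho> * sin (\<theta> + \<theta>0)])))"
proof -
  let ?A = "{\<xi> :: real^2. N * a \<le> norm \<xi> \<and> norm \<xi> \<le> N * b}"
  \<comment> \<open>The angle runs over a half-open interval to make the polar map injective. The
    closed rectangle \<open>?Q\<close>, to which Fubini applies, adds only a part of the null line
    where the angle is 2 pi.\<close>
  define S where "S = {p :: real^2. a \<le> p $ 1 \<and> p $ 1 \<le> b \<and> 0 \<le> p $ 2 \<and> p $ 2 < 2 * pi}"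
  let ?Q = "cbox (vector [a, 0]) (vector [b, 2 * pi]) :: (real^2) set"
  define g where "g p = (vector [N * p $ 1 * cos (p $ 2 + \<theta>0), N * p $ 1 * sin (p $ 2 + \<theta>0)] :: real^2)" for p :: "real^2"
  define g' where "g' p h = (vector
      [N * h $ 1 * cos (p $ 2 + \<theta>0) - N * p $ 1 * sin (p $ 2 + \<theta>0) * h $ 2,
       N * h $ 1 * sin (p $ 2 + \<theta>0) + N * p $ 1 * cos (p $ 2 + \<theta>0) * h $ 2] :: real^2)" for p h :: "real^2"
  have S: "S \<in> sets lebesgue"
  proof -
    have "S = {p. a \<le> p $ 1} \<inter> {p. p $ 1 \<le> b} \<inter> {p. 0 \<le> p $ 2} \<inter> {p. p $ 2 < 2 * pi}"
      by (auto simp: S_def)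
    also have "\<dots> \<in> sets borel"
      by (intro sets.Int borel_closed borel_open closed_Collect_le open_Collect_less continuous_intros)
    finally show ?thesis by simp
  qed
  have ng: "norm (g p) = N * p $ 1" if "p \<in> S" for p
    unfolding g_def norm_polar using that N a by (simp add: S_def)
  have inj: "inj_on g S"
  proof (rule inj_onI)
    fix p q assume p: "p \<in> S" and q: "q \<in> S" and eq: "g p = g q"
    have 1: "p $ 1 = q $ 1" using ng[OF p] ng[OF q] eq N by simp
    have p0: "N * p $ 1 \<noteq> 0" using p N a by (auto simp: S_def)
    have "cos (p $ 2 + \<theta>0) = cos (q $ 2 + \<theta>0)" "sin (p $ 2 + \<theta>0) = sin (q $ 2 + \<theta>0)"
      using eq p0 1 unfolding g_def by (auto simp: vec_eq_iff forall_2)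
    then obtain n :: int where n: "p $ 2 + \<theta>0 = q $ 2 + \<theta>0 + 2 * pi * n"
      using sin_cos_eq_iff[of "p $ 2 + \<theta>0" "q $ 2 + \<theta>0"] by auto
    have "\<bar>2 * pi * n\<bar> < 2 * pi * 1" using n p q by (auto simp: S_def)
    then have "\<bar>real_of_int n\<bar> < 1" by (simp add: abs_mult)
    then have "n = 0" by linarith
    then show "p = q" using n 1 by (simp add: vec_eq_iff forall_2)
  qed
  have img: "g ` S = ?A"
  proof
    show "g ` S \<subseteq> ?A" using ng N by (auto simp: S_def)
    show "?A \<subseteq> g ` S"
    proof
      fix \<xi> assume \<xi>: "\<xi> \<in> ?A"
      obtain t where t: "0 \<le> t" "t < 2 * pi" "\<xi> = vector [norm \<xi> * cos t, norm \<xi> * sin t]"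
        by (rule polar_exists)
      \<comment> \<open>Removing \<open>k\<close> full turns brings the angle relative to
        \<open>\<theta>0\<close> back into the half-open period.\<close>
      define k where "k = \<lfloor>(t - \<theta>0) / (2 * pi)\<rfloor>"
      define u where "u = t - \<theta>0 - 2 * pi * k"
      have "of_int k \<le> (t - \<theta>0) / (2 * pi)" "(t - \<theta>0) / (2 * pi) < of_int k + 1"
        unfolding k_def by linarith+
      then have u: "0 \<le> u" "u < 2 * pi" by (auto simp: u_def field_simps)
      have e: "u + \<theta>0 = t + 2 * pi * of_int (- k)" by (simp add: u_def)
      have cs: "cos (u + \<theta>0) = cos t" "sin (u + \<theta>0) = sin t"
        using sin_cos_eq_iff[of "u + \<theta>0" t] e by blast+
      have "\<xi> = g (vector [norm \<xi> / N, u])" using t(3) N by (simp add: g_def cs)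
      moreover have "vector [norm \<xi> / N, u] \<in> S" using \<xi> u N by (auto simp: S_def field_simps)
      ultimately show "\<xi> \<in> g ` S" by blast
    qed
  qed
  have der: "(g has_derivative g' p) (at p within S)" for p
  proof -
    have c: "((\<lambda>p :: real^2. p $ i) has_derivative (\<lambda>h. h $ i)) (at p within S)" for i
      by (intro bounded_linear_imp_has_derivative bounded_linear_vec_nth)
    show ?thesis
    proof (rule has_derivative_componentwise_within[THEN iffD2], intro ballI)
      fix i :: "real^2" assume "i \<in> Basis"
      then consider "i = axis 1 1" | "i = axis 2 1" by (auto simp: Basis_real2)
      then show "((\<lambda>x. g x \<bullet> i) has_derivative (\<lambda>x. g' p x \<bullet> i)) (at p within S)"
        by cases (auto simp: g_def g'_def inner_axis intro!: derivative_eq_intros c ext simp: algebra_simps)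
    qed
  qed
  have det: "\<bar>det (matrix (g' p))\<bar> = N\<^sup>2 * p $ 1" if "p \<in> S" for p
  proof -
    have "det (matrix (g' p)) = N\<^sup>2 * p $ 1 * ((cos (p $ 2 + \<theta>0))\<^sup>2 + (sin (p $ 2 + \<theta>0))\<^sup>2)"
      unfolding det_2 matrix_def g'_def
      by (simp add: axis_def power2_eq_square algebra_simps
        del: sin_cos_squared_add sin_cos_squared_add2 sin_cos_squared_add3)
    then show ?thesis using that a by (auto simp: S_def)
  qed
  \<comment> \<open>The change of variables is applied to a function with values in some
    \<open>real^n\<close>, so \<open>F\<close> travels as a vector with one component.\<close>
  have Fint: "(\<lambda>\<xi>. vec (F \<xi>) :: real^1) absolutely_integrable_on ?A"
    by (intro absolutely_integrable_continuous_compact compact_annulus)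
      (simp add: vec_def F continuous_on_vec_lambda)
  have hc: "continuous_on ?Q (\<lambda>p. N\<^sup>2 * p $ 1 * F (g p))"
  proof (intro continuous_intros continuous_on_compose2[OF F])
    show "continuous_on ?Q g" unfolding g_def by (intro continuous_intros)
    show "g ` ?Q \<subseteq> ?A"
    proof
      fix y assume "y \<in> g ` ?Q"
      then obtain p where p: "p \<in> ?Q" "y = g p" by blast
      then have "a \<le> p $ 1" "p $ 1 \<le> b" by (auto simp: mem_box Basis_real2 inner_axis)
      then show "y \<in> ?A" unfolding p(2) g_def using norm_polar[of "N * p $ 1" "p $ 2 + \<theta>0"] N a by simp
    qed
  qed
  have "integral ?A F = integral ?A (\<lambda>\<xi>. (vec (F \<xi>) :: real^1) $ 1)" by simp
  also have "\<dots> = integral (g ` S) (\<lambda>\<xi>. vec (F \<xi>) :: real^1) $ 1"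
    unfolding img using Fint by (intro integral_component_eq_cart) (simp add: set_lebesgue_integral_eq_integral(1))
  also have "integral (g ` S) (\<lambda>\<xi>. vec (F \<xi>) :: real^1) =
      integral S (\<lambda>p. \<bar>det (matrix (g' p))\<bar> *\<^sub>R (vec (F (g p)) :: real^1))"
    by (rule integral_change_of_variables[OF S der inj]) (simp add: Fint img)
  also have "\<dots> = integral S (\<lambda>p. vec (N\<^sup>2 * p $ 1 * F (g p)))"
    by (rule integral_cong) (simp add: det vec_eq_iff)
  also have "\<dots> = integral ?Q (\<lambda>p. vec (N\<^sup>2 * p $ 1 * F (g p)))"
  proof (rule integral_spike_set)
    have 1: "negligible {p :: real^2. p \<bullet> axis 2 1 = 2 * pi}"
      by (rule negligible_standard_hyperplane) (simp add: Basis_real2)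
    show "negligible {p \<in> S - ?Q. vec (N\<^sup>2 * p $ 1 * F (g p)) \<noteq> (0 :: real^1)}"
      by (rule negligible_subset[OF negligible_empty]) (auto simp: S_def mem_box Basis_real2 inner_axis)
    show "negligible {p \<in> ?Q - S. vec (N\<^sup>2 * p $ 1 * F (g p)) \<noteq> (0 :: real^1)}"
      by (rule negligible_subset[OF 1]) (auto simp: S_def mem_box Basis_real2 inner_axis)
  qed
  also have "\<dots> $ 1 = integral ?Q (\<lambda>p. (vec (N\<^sup>2 * p $ 1 * F (g p)) :: real^1) $ 1)"
    by (rule integral_component_eq_cart[symmetric], rule integrable_continuous)
      (simp add: vec_def hc continuous_on_vec_lambda)
  also have "\<dots> = integral ?Q (\<lambda>p. N\<^sup>2 * p $ 1 * F (g p))" by simp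
  also have "\<dots> = integral {a..b} (\<lambda>\<rho>. integral {0..2*pi} (\<lambda>\<theta>. N\<^sup>2 * \<rho> * F (g (vector [\<rho>, \<theta>]))))"
    using integral_cbox_real2[OF hc] by simp
  finally show ?thesis by (simp add: g_def)
qed

section \<open>Dyadic pieces\<close>

text \<open>The cutoff keeps \<xi> away from the origin, where |\<xi>|^s and g may be singular. What
  remains is continuous on a compact annulus and extended by zero.\<close>

lemma osc_integrand_annulus:
  assumes P: "continuous_on UNIV P" and supp: "\<And>y. 0 \<le> y \<Longrightarrow> y \<notin> {1/2..2} \<Longrightarrow> P y = 0"
    and g: "continuous_on {0<..} g" and \<delta>: "0 < \<delta>" and N: "N = 2 powi k / \<delta>"
  defines "A \<equiv> {\<xi> :: real^2. N * (1/2) \<le> norm \<xi> \<and> norm \<xi> \<le> N * 2}"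
  shows "osc_integrand g (\<lambda>y. P (y / 2 powi k)) s t \<delta> x =
      (\<lambda>\<xi>. indicator A \<xi> *\<^sub>R osc_integrand g (\<lambda>y. P (y / 2 powi k)) s t \<delta> x \<xi>)"
    and "continuous_on A (osc_integrand g (\<lambda>y. P (y / 2 powi k)) s t \<delta> x)"
    and "integrable lborel (osc_integrand g (\<lambda>y. P (y / 2 powi k)) s t \<delta> x)"
proof -
  let ?f = "osc_integrand g (\<lambda>y. P (y / 2 powi k)) s t \<delta> x"
  have N0: "N > 0" using \<delta> N by simp
  have e: "\<delta> * y / 2 powi k = y / N" for y using \<delta> by (simp add: N field_simps)
  show 1: "?f = (\<lambda>\<xi>. indicator A \<xi> *\<^sub>R ?f \<xi>)"
  proof
    fix \<xi> :: "real^2"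
    have "P (norm \<xi> / N) = 0" if "\<xi> \<notin> A"
      by (rule supp) (use that N0 in \<open>auto simp: A_def field_simps\<close>)
    then show "?f \<xi> = indicator A \<xi> *\<^sub>R ?f \<xi>"
      by (cases "\<xi> \<in> A") (auto simp: osc_integrand_def e)
  qed
  have pos: "0 < norm \<xi>" if "\<xi> \<in> A" for \<xi>
  proof -
    have "0 < N * (1/2)" using N0 by simp
    also have "\<dots> \<le> norm \<xi>" using that unfolding A_def by blast
    finally show ?thesis .
  qed
  have nz: "\<xi> \<noteq> 0" if "\<xi> \<in> A" for \<xi> using pos[OF that] by simp
  show 2: "continuous_on A ?f"
    unfolding osc_integrand_def[abs_def]
    by (intro continuous_intros continuous_on_compose2[OF g] continuous_on_compose2[OF P])
      (use pos nz \<delta> in auto)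
  have "integrable lborel (\<lambda>\<xi>. indicator A \<xi> *\<^sub>R ?f \<xi>)"
    by (rule borel_integrable_compact[OF _ 2]) (simp only: A_def compact_annulus)
  then show "integrable lborel ?f" using 1 by simp
qed

text \<open>Multiplying the piece by the inverse of its sign exp (i Arg I) turns the modulus into a
  real integral of a cosine with a constant \<open>c\<close> added to the phase. Since this constant
  depends on the piece itself, the bound \<open>B\<close> is demanded for all \<open>c\<close>. In
  polar coordinates scaled by N, the Jacobian gives N^2 \<rho> and |\<xi>|^s gives N^s \<rho>^s,
  whence the factor N^(s+2) and the weight \<rho>^(s+1).\<close>

lemma cmod_I_dyadic_le:
  assumes P: "continuous_on UNIV P" and supp: "\<And>y. 0 \<le> y \<Longrightarrow> y \<notin> {1/2..2} \<Longrightarrow> P y = 0"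
    and g: "continuous_on {0<..} g" and \<delta>: "0 < \<delta>" and N: "N = 2 powi k / \<delta>"
    and B: "\<And>c. \<bar>radial_integral (\<lambda>\<rho>. \<rho> powr (s + 1) * P \<rho>) (\<lambda>\<rho>. t / \<delta> * g (2 powi k * \<rho>) + c) (norm x * N)\<bar> \<le> B"
  shows "cmod (I_dyadic g P s t \<delta> x k) \<le> N powr (s + 2) * B"
proof -
  let ?A = "{\<xi> :: real^2. N * (1/2) \<le> norm \<xi> \<and> norm \<xi> \<le> N * 2}"
  let ?f = "osc_integrand g (\<lambda>y. P (y / 2 powi k)) s t \<delta> x"
  note ann = osc_integrand_annulus[OF P supp g \<delta> N, of s t x]
  have N0: "N > 0" using \<delta> N by simp
  have e: "\<delta> * y / 2 powi k = y / N" for y using \<delta> by (simp add: N field_simps)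
  define I where "I = I_dyadic g P s t \<delta> x k"
  define c where "c = - Arg I"
  define F where "F \<xi> = Re (cis c * ?f \<xi>)" for \<xi>
  have F_eq: "F \<xi> = cos (x \<bullet> \<xi> + t / \<delta> * g (\<delta> * norm \<xi>) + c) * P (norm \<xi> / N) * norm \<xi> powr s" for \<xi>
  proof -
    have "cis c * ?f \<xi> = cis (c + (x \<bullet> \<xi> + t / \<delta> * g (\<delta> * norm \<xi>))) * complex_of_real (P (norm \<xi> / N) * norm \<xi> powr s)"
      unfolding osc_integrand_def e cis_conv_exp[symmetric] cis_mult[symmetric] by (simp add: mult_ac)
    then show ?thesis unfolding F_def by (simp add: add_ac)
  qed
  have Fc: "continuous_on ?A F" unfolding F_def[abs_def] by (intro continuous_intros ann(2))
  obtain \<theta>1 where \<theta>1: "x = vector [norm x * cos \<theta>1, norm x * sin \<theta>1]" by (rule polar_exists)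
  have "complex_of_real (cmod I) = cis c * I"
  proof -
    have "cis c * I = cis c * (complex_of_real (cmod I) * cis (Arg I))"
      using rcis_cmod_Arg[of I] by (simp add: rcis_def)
    also have "\<dots> = complex_of_real (cmod I) * (cis c * cis (Arg I))" by (simp add: mult_ac)
    finally show ?thesis by (simp add: cis_mult c_def)
  qed
  then have "cmod I = Re (cis c * I)" by (metis Re_complex_of_real)
  also have "\<dots> = (LINT \<xi>|lborel. F \<xi>)"
    unfolding I_def I_dyadic_def osc_integral_def F_def
    using ann(3) by (subst integral_mult_right_zero[symmetric]) (simp del: integral_mult_right_zero)
  also have "\<dots> = (LINT \<xi>:?A|lborel. F \<xi>)"
  proof -
    have "F \<xi> = indicator ?A \<xi> *\<^sub>R F \<xi>" for \<xi>
    proof -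
      have "Re (z * (indicator B \<xi> *\<^sub>R w)) = indicator B \<xi> *\<^sub>R Re (z * w)" for z w B
        by (simp add: indicator_def)
      then show ?thesis unfolding F_def by (subst ann(1))
    qed
    then show ?thesis unfolding set_lebesgue_integral_def by presburger
  qed
  also have "\<dots> = integral ?A F"
    by (rule set_borel_integral_eq_integral(2), unfold set_integrable_def,
        rule borel_integrable_compact[OF compact_annulus Fc])
  also have "\<dots> = integral {1/2..2} (\<lambda>\<rho>. integral {0..2*pi} (\<lambda>\<theta>.
      N\<^sup>2 * \<rho> * F (vector [N * \<rho> * cos (\<theta> + \<theta>1), N * \<rho> * sin (\<theta> + \<theta>1)])))"
    by (rule integral_annulus_polar[OF N0 _ _ Fc]) auto
  also have "\<dots> = integral {1/2..2} (\<lambda>\<rho>. N powr (s + 2) * (\<rho> powr (s + 1) * P \<rho> *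
      integral {0..2*pi} (\<lambda>\<theta>. cos (norm x * N * \<rho> * cos \<theta> + (t / \<delta> * g (2 powi k * \<rho>) + c)))))"
  proof (rule integral_cong)
    fix \<rho> :: real assume \<rho>: "\<rho> \<in> {1/2..2}"
    have pt: "N\<^sup>2 * \<rho> * F (vector [N * \<rho> * cos (\<theta> + \<theta>1), N * \<rho> * sin (\<theta> + \<theta>1)]) =
      (N powr (s + 2) * (\<rho> powr (s + 1) * P \<rho>)) * cos (norm x * N * \<rho> * cos \<theta> + (t / \<delta> * g (2 powi k * \<rho>) + c))" for \<theta>
    proof -
      have nr: "norm (vector [N * \<rho> * cos (\<theta> + \<theta>1), N * \<rho> * sin (\<theta> + \<theta>1)] :: real^2) = N * \<rho>"
        unfolding norm_polar using N0 \<rho> by simp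
      have ip: "x \<bullet> vector [N * \<rho> * cos (\<theta> + \<theta>1), N * \<rho> * sin (\<theta> + \<theta>1)] = norm x * N * \<rho> * cos \<theta>"
      proof -
        have "x \<bullet> vector [N * \<rho> * cos (\<theta> + \<theta>1), N * \<rho> * sin (\<theta> + \<theta>1)] =
          norm x * cos \<theta>1 * (N * \<rho> * cos (\<theta> + \<theta>1)) + norm x * sin \<theta>1 * (N * \<rho> * sin (\<theta> + \<theta>1))"
          by (subst \<theta>1) (simp add: inner_vec_def sum_2)
        also have "\<dots> = norm x * N * \<rho> * cos ((\<theta> + \<theta>1) - \<theta>1)"
          unfolding cos_diff[of "\<theta> + \<theta>1" \<theta>1] by (simp only: algebra_simps)
        finally show ?thesis by simp
      qed
      have dN: "\<delta> * (N * \<rho>) = 2 powi k * \<rho>" using \<delta> by (simp add: N)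
      have w: "N\<^sup>2 * \<rho> * (N * \<rho>) powr s = N powr (s + 2) * \<rho> powr (s + 1)"
        using N0 \<rho> by (simp add: powr_mult powr_add)
      have nN: "N * \<rho> / N = \<rho>" using N0 by simp
      have "N\<^sup>2 * \<rho> * (X * Y * (N * \<rho>) powr s) = (N powr (s + 2) * (\<rho> powr (s + 1) * Y)) * X" for X Y
        using arg_cong[OF w, of "\<lambda>z. z * (X * Y)"] by (simp only: mult_ac)
      then show ?thesis unfolding F_eq nr ip dN nN by (simp only: add.assoc)
    qed
    show "integral {0..2*pi} (\<lambda>\<theta>. N\<^sup>2 * \<rho> * F (vector [N * \<rho> * cos (\<theta> + \<theta>1), N * \<rho> * sin (\<theta> + \<theta>1)])) =
      N powr (s + 2) * (\<rho> powr (s + 1) * P \<rho> *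
      integral {0..2*pi} (\<lambda>\<theta>. cos (norm x * N * \<rho> * cos \<theta> + (t / \<delta> * g (2 powi k * \<rho>) + c))))"
      unfolding pt integral_mult_right by (simp only: mult.assoc)
  qed
  also have "\<dots> = N powr (s + 2) * radial_integral (\<lambda>\<rho>. \<rho> powr (s + 1) * P \<rho>) (\<lambda>\<rho>. t / \<delta> * g (2 powi k * \<rho>) + c) (norm x * N)"
    unfolding radial_integral_def integral_mult_right ..
  also have "\<dots> \<le> N powr (s + 2) * B" using B[of c] by (intro mult_left_mono) auto
  finally show ?thesis unfolding I_def .
qed

text \<open>The common ground of \<open>P\<close> and \<open>lp_Q \<phi> 0\<close>, so that one set
  of estimates serves both families of integrals. Cutoffs are evaluated at norms, hence the support
  condition on the half-line.\<close>

definition C2_annular :: "(real \<Rightarrow> real) \<Rightarrow> bool" where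
  "C2_annular P \<longleftrightarrow> (\<exists>P' P''. (\<forall>y. (P has_real_derivative P' y) (at y)) \<and>
     (\<forall>y. (P' has_real_derivative P'' y) (at y)) \<and> continuous_on UNIV P'' \<and>
     (\<forall>y\<ge>0. y \<notin> {1/2..2} \<longrightarrow> P y = 0))"

lemma C_k_on_has_derivative:
  assumes f: "C_k_on n f U" and U: "open U" "y \<in> U" and i: "i < n"
  shows "((deriv ^^ i) f has_real_derivative (deriv ^^ Suc i) f y) (at y)"
proof -
  have "(deriv ^^ i) f differentiable (at y within U)"
    using f i U(2) by (simp add: C_k_on_def differentiable_on_def)
  then have "(deriv ^^ i) f differentiable (at y)" using at_within_open[OF U(2,1)] by simp
  then show ?thesis by (simp add: DERIV_deriv_iff_real_differentiable)
qed

lemma supported_inD: "supported_in f S \<Longrightarrow> y \<notin> S \<Longrightarrow> f y = 0"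
  unfolding supported_in_def support_on_def using closure_subset[of "{x \<in> UNIV. f x \<noteq> 0}"] by blast

lemma annular_cutoff_C2_annular:
  assumes "annular_cutoff P"
  shows "C2_annular P"
proof -
  have C: "C_k_on 2 P UNIV" and S: "supported_in P ({-2..-1/2} \<union> {1/2..2})"
    using assms by (auto simp: annular_cutoff_def smooth_on_def)
  show ?thesis
    unfolding C2_annular_def
  proof (intro exI conjI allI impI)
    show "(P has_real_derivative deriv P y) (at y)" for y
      using C_k_on_has_derivative[OF C open_UNIV, of y 0] by simp
    show "(deriv P has_real_derivative (deriv ^^ 2) P y) (at y)" for y
      using C_k_on_has_derivative[OF C open_UNIV, of y 1] by (simp add: numeral_2_eq_2)
    show "continuous_on UNIV ((deriv ^^ 2) P)" using C by (simp add: C_k_on_def)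
    show "P y = 0" if "0 \<le> y" "y \<notin> {1/2..2}" for y
      using supported_inD[OF S, of y] that by auto
  qed
qed

text \<open>Below 1/2 the two copies of \<phi> cancel, since both equal 1 there; above 2 both
  vanish, since even y/2 exceeds 4/5.\<close>

lemma lp_Q_C2_annular:
  assumes "lp_generator \<phi>"
  shows "C2_annular (lp_Q \<phi> 0)"
proof -
  have C: "C_k_on 2 \<phi> UNIV" and S: "supported_in \<phi> {-4/5..4/5}" and one: "\<And>y. y \<in> {-3/5..3/5} \<Longrightarrow> \<phi> y = 1"
    using assms by (auto simp: lp_generator_def smooth_on_def)
  have Q: "lp_Q \<phi> 0 = (\<lambda>y. \<phi> (y / 2) - \<phi> y)" by (auto simp: lp_Q_def)
  have d1: "(\<phi> has_real_derivative deriv \<phi> y) (at y)" for y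
    using C_k_on_has_derivative[OF C open_UNIV, of y 0] by simp
  have d2: "(deriv \<phi> has_real_derivative (deriv ^^ 2) \<phi> y) (at y)" for y
    using C_k_on_has_derivative[OF C open_UNIV, of y 1] by (simp add: numeral_2_eq_2)
  have c2: "continuous_on UNIV ((deriv ^^ 2) \<phi>)" using C by (simp add: C_k_on_def)
  have h: "((\<lambda>y. y / 2) has_real_derivative 1/2) (at y)" for y :: real
    by (auto intro!: derivative_eq_intros)
  show ?thesis
    unfolding C2_annular_def Q
  proof (intro exI conjI allI impI)
    show "((\<lambda>y. \<phi> (y / 2) - \<phi> y) has_real_derivative deriv \<phi> (y / 2) * (1/2) - deriv \<phi> y) (at y)" for y
      by (intro DERIV_diff DERIV_chain2[OF d1 h] d1)
    show "((\<lambda>y. deriv \<phi> (y / 2) * (1/2) - deriv \<phi> y) has_real_derivative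
        (deriv ^^ 2) \<phi> (y / 2) * (1/2) * (1/2) - (deriv ^^ 2) \<phi> y) (at y)" for y
      by (intro DERIV_diff DERIV_cmult_right DERIV_chain2[OF d2 h] d2)
    show "continuous_on UNIV (\<lambda>y. (deriv ^^ 2) \<phi> (y / 2) * (1/2) * (1/2) - (deriv ^^ 2) \<phi> y)"
      by (intro continuous_intros continuous_on_compose2[OF c2]) auto
    show "\<phi> (y / 2) - \<phi> y = 0" if y: "0 \<le> y" "y \<notin> {1/2..2}" for y
    proof (cases "y < 1/2")
      case True
      then show ?thesis using one[of y] one[of "y / 2"] y by auto
    next
      case False
      then show ?thesis using supported_inD[OF S, of y] supported_inD[OF S, of "y / 2"] y by auto
    qed
  qed
qed

lemma C2_annular_continuous: "C2_annular P \<Longrightarrow> continuous_on UNIV P"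
  unfolding C2_annular_def by (blast intro: DERIV_isCont continuous_at_imp_continuous_on)

lemma C2_annular_support: "C2_annular P \<Longrightarrow> 0 \<le> y \<Longrightarrow> y \<notin> {1/2..2} \<Longrightarrow> P y = 0"
  unfolding C2_annular_def by blast

text \<open>The support condition is silent at the endpoints themselves, where continuity decides.
  The vanishing removes the boundary terms in \<open>nonstationary_twice\<close>.\<close>

lemma C2_annular_ends:
  assumes P: "C2_annular P"
  shows "P (1/2) = 0" "P 2 = 0"
proof -
  have cl: "closed {y. P y = 0}"
    by (intro closed_Collect_eq C2_annular_continuous[OF P] continuous_on_const)
  have "{0<..<1/2} \<subseteq> {y. P y = 0}" "{2<..} \<subseteq> {y. P y = 0}"
    using C2_annular_support[OF P] by auto
  then have "closure {0<..<1/2} \<subseteq> {y. P y = 0}" "closure {2<..} \<subseteq> {y. P y = 0}"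
    using cl by (meson closure_minimal)+
  then show "P (1/2) = 0" "P 2 = 0" by (simp_all add: subset_iff)
qed

lemma C2_annular_weight:
  fixes s :: real
  assumes P: "C2_annular P"
  defines "b \<equiv> \<lambda>\<rho>. \<rho> powr (s + 1) * P \<rho>"
  obtains b' b'' M where
    "\<And>x. x \<in> {1/2..2} \<Longrightarrow> (b has_real_derivative b' x) (at x within {1/2..2})"
    "\<And>x. x \<in> {1/2..2} \<Longrightarrow> (b' has_real_derivative b'' x) (at x within {1/2..2})"
    "\<And>x. x \<in> {1/2..2} \<Longrightarrow> \<bar>b x\<bar> \<le> M" "\<And>x. x \<in> {1/2..2} \<Longrightarrow> \<bar>b' x\<bar> \<le> M"
    "\<And>x. x \<in> {1/2..2} \<Longrightarrow> \<bar>b'' x\<bar> \<le> M"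
proof -
  obtain P' P'' where d1: "\<And>y. (P has_real_derivative P' y) (at y)"
    and d2: "\<And>y. (P' has_real_derivative P'' y) (at y)" and c2: "continuous_on UNIV P''"
    using P unfolding C2_annular_def by blast
  define b' where "b' \<rho> = (s + 1) * \<rho> powr s * P \<rho> + \<rho> powr (s + 1) * P' \<rho>" for \<rho>
  define b'' where "b'' \<rho> = (s + 1) * (s * \<rho> powr (s - 1)) * P \<rho> + 2 * ((s + 1) * \<rho> powr s * P' \<rho>)
      + \<rho> powr (s + 1) * P'' \<rho>" for \<rho>
  have pw: "((\<lambda>\<rho>. \<rho> powr c) has_real_derivative c * x powr (c - 1)) (at x within {1/2..2})" if "x \<in> {1/2..2}" for x c :: real
    using that by (intro has_field_derivative_at_within[OF has_real_derivative_powr]) auto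
  have pw1: "((\<lambda>\<rho>. \<rho> powr (s + 1)) has_real_derivative (s + 1) * x powr s) (at x within {1/2..2})" if "x \<in> {1/2..2}" for x :: real
    using pw[OF that, of "s + 1"] by simp
  have D1: "(b has_real_derivative b' x) (at x within {1/2..2})" if x: "x \<in> {1/2..2}" for x
    unfolding b_def b'_def
    by (rule derivative_eq_intros pw1[OF x] has_field_derivative_at_within[OF d1] refl)+ simp
  have D2: "(b' has_real_derivative b'' x) (at x within {1/2..2})" if x: "x \<in> {1/2..2}" for x
    unfolding b''_def b'_def[abs_def]
    by (rule derivative_eq_intros pw1[OF x] pw[OF x] has_field_derivative_at_within[OF d1]
          has_field_derivative_at_within[OF d2] refl)+ (simp add: algebra_simps)
  have cP: "continuous_on {1/2..2} P" "continuous_on {1/2..2} P'"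
    by (rule DERIV_continuous_on, rule has_field_derivative_at_within, rule d1 d2)+
  have c: "continuous_on {1/2..2} b" "continuous_on {1/2..2} b'" "continuous_on {1/2..2} b''"
    using DERIV_continuous_on[OF D1] DERIV_continuous_on[OF D2]
    unfolding b''_def[abs_def]
    by (auto intro!: continuous_intros cP continuous_on_subset[OF c2])
  have bdd: "\<exists>M. \<forall>x\<in>{1/2..2}. \<bar>f x\<bar> \<le> M" if "continuous_on {1/2..2} f" for f :: "real \<Rightarrow> real"
    using compact_imp_bounded[OF compact_continuous_image[OF that compact_Icc]]
    unfolding bounded_iff by auto
  obtain M0 M1 M2 where "\<forall>x\<in>{1/2..2}. \<bar>b x\<bar> \<le> M0" "\<forall>x\<in>{1/2..2}. \<bar>b' x\<bar> \<le> M1" "\<forall>x\<in>{1/2..2}. \<bar>b'' x\<bar> \<le> M2"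
    using bdd[OF c(1)] bdd[OF c(2)] bdd[OF c(3)] by blast
  then show ?thesis
    by (intro that[of b' b'' "max M0 (max M1 M2)"] D1 D2) (auto simp: le_max_iff_disj)
qed

section \<open>Size of the rescaled phase and its derivatives\<close>

lemma powr_dyadic_bounds:
  assumes \<rho>: "\<rho> \<in> {1/2..2::real}" and c: "\<bar>c\<bar> \<le> \<gamma>"
  shows "2 powr - \<gamma> \<le> \<rho> powr c" "\<rho> powr c \<le> 2 powr \<gamma>"
proof -
  have "\<bar>log 2 \<rho>\<bar> \<le> 1"
  proof -
    have "log 2 \<rho> \<le> log 2 2" using \<rho> by (subst log_le_cancel_iff) auto
    moreover have "log 2 (1/2) \<le> log 2 \<rho>" using \<rho> by (subst log_le_cancel_iff) auto
    moreover have "log 2 (1/2 :: real) = -1" by (simp add: log_divide)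
    ultimately show ?thesis by simp
  qed
  then have "\<bar>c * log 2 \<rho>\<bar> \<le> \<gamma> * 1" unfolding abs_mult using c by (intro mult_mono) auto
  moreover have "\<rho> powr c = 2 powr (c * log 2 \<rho>)"
  proof -
    have "\<rho> powr c = (2 powr log 2 \<rho>) powr c" using \<rho> by simp
    then show ?thesis by (simp only: powr_powr mult.commute)
  qed
  ultimately show "2 powr - \<gamma> \<le> \<rho> powr c" "\<rho> powr c \<le> 2 powr \<gamma>" by auto
qed

lemma dyadic_indices_mem:
  assumes "k \<in> dyadic_indices J" "\<rho> \<in> {1/2..2::real}"
  shows "2 powi k * \<rho> \<in> J"
proof -
  have "2 powi (k - 1) = (2 powi k :: real) * (1/2)" "2 powi (k + 1) = (2 powi k :: real) * 2"
    by (simp_all add: power_int_diff power_int_add field_simps)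
  moreover have "2 powi k * (1/2) \<le> 2 powi k * \<rho>" "2 powi k * \<rho> \<le> 2 powi k * 2"
    using assms(2) by (intro mult_left_mono; simp)+
  ultimately have "2 powi k * \<rho> \<in> {2 powi (k - 1)..2 powi (k + 1)}" by (simp only: atLeastAtMost_iff)
  then show ?thesis using assms(1) unfolding dyadic_indices_def by blast
qed

lemma has_derivative_dilation:
  assumes "\<And>y. y > 0 \<Longrightarrow> (f has_real_derivative f' y) (at y)" "a * \<rho> > 0"
  shows "((\<lambda>\<rho>. c * f (a * \<rho>) + d) has_real_derivative c * a * f' (a * \<rho>)) (at \<rho> within S)"
proof -
  have "((\<lambda>\<rho>. f (a * \<rho>)) has_real_derivative f' (a * \<rho>) * a) (at \<rho> within S)"
    by (rule DERIV_chain2[where g = "\<lambda>\<rho>. a * \<rho>", OF assms(1)[OF assms(2)]])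
      (auto intro!: derivative_eq_intros)
  then show ?thesis by (auto intro!: derivative_eq_intros)
qed

text \<open>\<open>osc_size \<alpha> t \<delta> k\<close> is the size of the rescaled phase \<open>(t / \<delta>) g(2\<^sup>k \<rho>)\<close> on \<open>1/2 \<le> \<rho> \<le> 2\<close>.\<close>

definition osc_size :: "real \<Rightarrow> real \<Rightarrow> real \<Rightarrow> int \<Rightarrow> real" where
  "osc_size \<alpha> t \<delta> k = \<bar>t\<bar> / \<delta> * 2 powr ((\<alpha> + 2) * real_of_int k)"

text \<open>The n-th derivative of g(2^k \<rho>) carries 2^(k n), while the assumed size
  y^(\<alpha>+2-n) of the n-th derivative of g carries 2^(k (\<alpha>+2-n)). The product does not
  depend on n, so one number \<open>osc_size\<close> measures all three derivatives.\<close>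

lemma powr_scale_identity:
  assumes \<rho>: "\<rho> > 0" and \<delta>: "\<delta> > 0"
  shows "\<bar>t\<bar> / \<delta> * (2 powi k) ^ n * (2 powi k * \<rho>) powr (\<alpha> + 2 - real n) = osc_size \<alpha> t \<delta> k * \<rho> powr (\<alpha> + 2 - real n)"
proof -
  have "(2 powi k) ^ n * (2 powi k :: real) powr (\<alpha> + 2 - real n) = 2 powr ((\<alpha> + 2) * real_of_int k)"
    by (simp add: powr_real_of_int'[symmetric] powr_powr powr_realpow[symmetric] powr_add[symmetric] algebra_simps)
  then show ?thesis using \<rho> by (simp add: osc_size_def powr_mult)
qed

lemma phase_bounds:
  fixes f :: "real \<Rightarrow> real"
  assumes \<rho>: "\<rho> \<in> {1/2..2}" and \<delta>: "\<delta> > 0" and n: "1 \<le> n" "n \<le> 3"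
  shows "lam * (2 powi k * \<rho>) powr (\<alpha> + 2 - real n) \<le> \<bar>f (2 powi k * \<rho>)\<bar> \<Longrightarrow> lam > 0 \<Longrightarrow>
      lam * 2 powr - (\<bar>\<alpha>\<bar> + 1) * osc_size \<alpha> t \<delta> k \<le> \<bar>t / \<delta> * (2 powi k) ^ n * f (2 powi k * \<rho>)\<bar>"
    and "\<bar>f (2 powi k * \<rho>)\<bar> \<le> Lam * (2 powi k * \<rho>) powr (\<alpha> + 2 - real n) \<Longrightarrow> Lam > 0 \<Longrightarrow>
      \<bar>t / \<delta> * (2 powi k) ^ n * f (2 powi k * \<rho>)\<bar> \<le> Lam * 2 powr (\<bar>\<alpha>\<bar> + 1) * osc_size \<alpha> t \<delta> k"
proof -
  let ?e = "\<alpha> + 2 - real n" and ?y = "2 powi k * \<rho>" and ?q = "\<bar>t\<bar> / \<delta> * (2 powi k) ^ n"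
  have q: "0 \<le> ?q" using \<delta> by simp
  have T: "0 \<le> osc_size \<alpha> t \<delta> k" using \<delta> by (simp add: osc_size_def)
  \<comment> \<open>For n = 1, 2, 3 the exponent is \<alpha> + 1, \<alpha>, \<alpha> - 1; so powers
    of \<rho> in {1/2..2} vary within the factors 2^(\<plusminus>(|\<alpha>|+1)).\<close>
  have e: "\<bar>?e\<bar> \<le> \<bar>\<alpha>\<bar> + 1" using n by (simp add: abs_le_iff) linarith
  have ab: "\<bar>t / \<delta> * (2 powi k) ^ n * f ?y\<bar> = ?q * \<bar>f ?y\<bar>" using \<delta> by (simp add: abs_mult)
  have id: "?q * (c * ?y powr ?e) = c * \<rho> powr ?e * osc_size \<alpha> t \<delta> k" for c
    using powr_scale_identity[of \<rho> \<delta> t k n \<alpha>] \<rho> \<delta> by (simp add: mult_ac)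
  {
    assume h: "lam * ?y powr ?e \<le> \<bar>f ?y\<bar>" "lam > 0"
    have "lam * 2 powr - (\<bar>\<alpha>\<bar> + 1) * osc_size \<alpha> t \<delta> k \<le> lam * \<rho> powr ?e * osc_size \<alpha> t \<delta> k"
      using powr_dyadic_bounds(1)[OF \<rho> e] h(2) T by (intro mult_right_mono mult_left_mono) auto
    also have "\<dots> \<le> ?q * \<bar>f ?y\<bar>" unfolding id[symmetric] by (rule mult_left_mono[OF h(1) q])
    finally show "lam * 2 powr - (\<bar>\<alpha>\<bar> + 1) * osc_size \<alpha> t \<delta> k \<le> \<bar>t / \<delta> * (2 powi k) ^ n * f ?y\<bar>" unfolding ab .
  }
  {
    assume h: "\<bar>f ?y\<bar> \<le> Lam * ?y powr ?e" "Lam > 0"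
    have "?q * \<bar>f ?y\<bar> \<le> Lam * \<rho> powr ?e * osc_size \<alpha> t \<delta> k" unfolding id[symmetric] by (rule mult_left_mono[OF h(1) q])
    also have "\<dots> \<le> Lam * 2 powr (\<bar>\<alpha>\<bar> + 1) * osc_size \<alpha> t \<delta> k"
      using powr_dyadic_bounds(2)[OF \<rho> e] h(2) T by (intro mult_right_mono mult_left_mono) auto
    finally show "\<bar>t / \<delta> * (2 powi k) ^ n * f ?y\<bar> \<le> Lam * 2 powr (\<bar>\<alpha>\<bar> + 1) * osc_size \<alpha> t \<delta> k" unfolding ab .
  }
qed

section \<open>Bounds for a single dyadic piece\<close>

lemma I_dyadic_bound_C2:
  assumes P: "C2_annular P" and lam: "lam > 0"
    and g: "C_k_on 2 g {0<..}"
    and g1: "\<forall>y\<in>J. lam * y powr (\<alpha> + 1) \<le> \<bar>deriv g y\<bar>"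
    and g2: "\<forall>y\<in>J. lam * y powr \<alpha> \<le> \<bar>(deriv ^^ 2) g y\<bar>"
  obtains C where "C > 0"
    "\<And>t \<delta> x k. t \<noteq> 0 \<Longrightarrow> \<delta> > 0 \<Longrightarrow> k \<in> dyadic_indices J \<Longrightarrow>
      cmod (I_dyadic g P s t \<delta> x k) \<le> C * (2 powi k / \<delta>) powr (s + 2) * min 1 (1 / osc_size \<alpha> t \<delta> k)"
proof -
  obtain b' b'' M where b: "\<And>x. x \<in> {1/2..2} \<Longrightarrow> ((\<lambda>\<rho>. \<rho> powr (s + 1) * P \<rho>) has_real_derivative b' x) (at x within {1/2..2})"
    and M: "\<And>x. x \<in> {1/2..2} \<Longrightarrow> \<bar>x powr (s + 1) * P x\<bar> \<le> M" "\<And>x. x \<in> {1/2..2} \<Longrightarrow> \<bar>b' x\<bar> \<le> M"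
    by (rule C2_annular_weight[OF P, of s]) (rule that)
  obtain C where C: "C > 0" and bound: "\<And>r \<mu> \<Phi> \<Phi>' \<Phi>''. r \<ge> 0 \<Longrightarrow> \<mu> > 0 \<Longrightarrow>
      (\<And>x. x \<in> {1/2..2} \<Longrightarrow> (\<Phi> has_real_derivative \<Phi>' x) (at x within {1/2..2})) \<Longrightarrow>
      (\<And>x. x \<in> {1/2..2} \<Longrightarrow> (\<Phi>' has_real_derivative \<Phi>'' x) (at x within {1/2..2})) \<Longrightarrow>
      continuous_on {1/2..2} \<Phi>'' \<Longrightarrow>
      (\<And>x. x \<in> {1/2..2} \<Longrightarrow> \<mu> \<le> \<bar>\<Phi>' x\<bar>) \<Longrightarrow> (\<And>x. x \<in> {1/2..2} \<Longrightarrow> \<mu> \<le> \<bar>\<Phi>'' x\<bar>) \<Longrightarrow>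
      \<bar>radial_integral (\<lambda>\<rho>. \<rho> powr (s + 1) * P \<rho>) \<Phi> r\<bar> \<le> C * min 1 (1 / \<mu>)"
    using radial_integral_bound_C2[OF b M] by blast
  \<comment> \<open>Capping \<open>m\<close> at 1 allows it to be pulled out of the minimum: min 1
    (1 / (m T)) <= min 1 (1 / T) / m.\<close>
  define m where "m = min 1 (lam * 2 powr - (\<bar>\<alpha>\<bar> + 1))"
  have m: "0 < m" "m \<le> 1" "m \<le> lam * 2 powr - (\<bar>\<alpha>\<bar> + 1)" using lam by (auto simp: m_def)
  have dg: "(g has_real_derivative deriv g y) (at y)" "(deriv g has_real_derivative (deriv ^^ 2) g y) (at y)" if "y > 0" for y
    using C_k_on_has_derivative[OF g open_greaterThan, of y 0] C_k_on_has_derivative[OF g open_greaterThan, of y 1] that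
    by (simp_all add: numeral_2_eq_2)
  have cg: "continuous_on {0<..} g"
    by (rule DERIV_continuous_on[OF has_field_derivative_at_within[OF dg(1)]]) simp
  have cg2: "continuous_on {0<..} ((deriv ^^ 2) g)" using g by (simp add: C_k_on_def)
  show ?thesis
  proof (rule that[of "C / m"])
    show "C / m > 0" using C m by simp
    fix t \<delta> :: real and x :: "real^2" and k
    assume t: "t \<noteq> 0" and \<delta>: "\<delta> > 0" and k: "k \<in> dyadic_indices J"
    define a where "a = (2 powi k :: real)"
    define T where "T = osc_size \<alpha> t \<delta> k"
    have a: "a > 0" by (simp add: a_def)
    have T: "T > 0" using t \<delta> by (simp add: T_def osc_size_def)
    have pos: "a * \<rho> > 0" if "\<rho> \<in> {1/2..2}" for \<rho> using that a by simp
    have mem: "a * \<rho> \<in> J" if "\<rho> \<in> {1/2..2}" for \<rho> using dyadic_indices_mem[OF k that] by (simp add: a_def)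
    have lo: "m * T \<le> lam * 2 powr - (\<bar>\<alpha>\<bar> + 1) * T" using m T by (intro mult_right_mono) auto
    have "\<bar>radial_integral (\<lambda>\<rho>. \<rho> powr (s + 1) * P \<rho>) (\<lambda>\<rho>. t / \<delta> * g (a * \<rho>) + c) (norm x * (a / \<delta>))\<bar> \<le> C * min 1 (1 / (m * T))" for c
    proof (rule bound)
      fix \<rho> :: real assume \<rho>: "\<rho> \<in> {1/2..2}"
      show "((\<lambda>\<rho>. t / \<delta> * g (a * \<rho>) + c) has_real_derivative t / \<delta> * a * deriv g (a * \<rho>)) (at \<rho> within {1/2..2})"
        by (rule has_derivative_dilation[OF dg(1) pos[OF \<rho>]])
      show "((\<lambda>\<rho>. t / \<delta> * a * deriv g (a * \<rho>)) has_real_derivative t / \<delta> * a * a * (deriv ^^ 2) g (a * \<rho>)) (at \<rho> within {1/2..2})"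
        using has_derivative_dilation[OF dg(2) pos[OF \<rho>], of "t / \<delta> * a" 0] by simp
      show "m * T \<le> \<bar>t / \<delta> * a * deriv g (a * \<rho>)\<bar>"
        using phase_bounds(1)[OF \<rho> \<delta>, of 1 lam k \<alpha> "deriv g" t] g1 mem[OF \<rho>] lam lo
        by (simp add: a_def T_def add.commute)
      show "m * T \<le> \<bar>t / \<delta> * a * a * (deriv ^^ 2) g (a * \<rho>)\<bar>"
        using phase_bounds(1)[OF \<rho> \<delta>, of 2 lam k \<alpha> "(deriv ^^ 2) g" t] g2 mem[OF \<rho>] lam lo
        by (simp add: a_def T_def power2_eq_square mult.assoc)
    next
      show "continuous_on {1/2..2} (\<lambda>\<rho>. t / \<delta> * a * a * (deriv ^^ 2) g (a * \<rho>))"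
        by (intro continuous_intros continuous_on_compose2[OF cg2]) (use pos in auto)
    qed (use m T a \<delta> in auto)
    then have "cmod (I_dyadic g P s t \<delta> x k) \<le> (a / \<delta>) powr (s + 2) * (C * min 1 (1 / (m * T)))"
      unfolding a_def
      by (intro cmod_I_dyadic_le C2_annular_continuous[OF P] C2_annular_support[OF P] cg \<delta> refl) auto
    also have "\<dots> \<le> (a / \<delta>) powr (s + 2) * (C * (min 1 (1 / T) / m))"
    proof (intro mult_left_mono)
      show "min 1 (1 / (m * T)) \<le> min 1 (1 / T) / m"
      proof (cases "1 \<le> 1 / T")
        case True
        have "1 \<le> 1 / m" using m by simp
        then show ?thesis using True by (simp add: min_def)
      next
        case False
        then show ?thesis by (simp add: min_def mult.commute)
      qed
    qed (use C in auto)
    finally show "cmod (I_dyadic g P s t \<delta> x k) \<le> C / m * (2 powi k / \<delta>) powr (s + 2) * min 1 (1 / osc_size \<alpha> t \<delta> k)"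
      by (simp add: a_def T_def mult_ac)
  qed
qed

lemma I_dyadic_bound_C3:
  assumes P: "C2_annular P" and lam: "lam > 0" and Lam: "Lam > 0"
    and g: "C_k_on 3 g {0<..}"
    and g1: "\<forall>y\<in>J. lam * y powr (\<alpha> + 1) \<le> \<bar>deriv g y\<bar>" "\<forall>y\<in>J. \<bar>deriv g y\<bar> \<le> Lam * y powr (\<alpha> + 1)"
    and g2: "\<forall>y\<in>J. lam * y powr \<alpha> \<le> \<bar>(deriv ^^ 2) g y\<bar>" "\<forall>y\<in>J. \<bar>(deriv ^^ 2) g y\<bar> \<le> Lam * y powr \<alpha>"
    and g3: "\<forall>y\<in>J. \<bar>(deriv ^^ 3) g y\<bar> \<le> Lam * y powr (\<alpha> - 1)"
  obtains C \<kappa> where "C > 0" "\<kappa> > 0"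
    "\<And>t \<delta> x k. t \<noteq> 0 \<Longrightarrow> \<delta> > 0 \<Longrightarrow> k \<in> dyadic_indices J \<Longrightarrow> osc_size \<alpha> t \<delta> k \<ge> 1 \<Longrightarrow>
      norm x * (2 powi k / \<delta>) \<le> \<kappa> * osc_size \<alpha> t \<delta> k \<or> osc_size \<alpha> t \<delta> k \<le> \<kappa> * (norm x * (2 powi k / \<delta>)) \<Longrightarrow>
      cmod (I_dyadic g P s t \<delta> x k) \<le>
        C * (2 powi k / \<delta>) powr (s + 2) / (osc_size \<alpha> t \<delta> k * sqrt (osc_size \<alpha> t \<delta> k))"
proof -
  obtain b' b'' M where b: "\<And>x. x \<in> {1/2..2} \<Longrightarrow> ((\<lambda>\<rho>. \<rho> powr (s + 1) * P \<rho>) has_real_derivative b' x) (at x within {1/2..2})"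
    and b': "\<And>x. x \<in> {1/2..2} \<Longrightarrow> (b' has_real_derivative b'' x) (at x within {1/2..2})"
    and M: "\<And>x. x \<in> {1/2..2} \<Longrightarrow> \<bar>x powr (s + 1) * P x\<bar> \<le> M" "\<And>x. x \<in> {1/2..2} \<Longrightarrow> \<bar>b' x\<bar> \<le> M"
      "\<And>x. x \<in> {1/2..2} \<Longrightarrow> \<bar>b'' x\<bar> \<le> M"
    by (rule C2_annular_weight[OF P, of s]) (rule that)
  define m where "m = lam * 2 powr - (\<bar>\<alpha>\<bar> + 1)"
  define L where "L = Lam * 2 powr (\<bar>\<alpha>\<bar> + 1)"
  have m: "m > 0" and L: "L > 0" using lam Lam by (auto simp: m_def L_def)
  have ends: "(1/2) powr (s + 1) * P (1/2) = 0" "2 powr (s + 1) * P 2 = 0" using C2_annular_ends[OF P] by auto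
  obtain C \<kappa> where C: "C > 0" "0 < \<kappa>" and bound:
    "\<And>r T \<Phi> \<Phi>' \<Phi>'' \<Phi>'''. r \<ge> 0 \<Longrightarrow> T \<ge> 1 \<Longrightarrow> r \<le> \<kappa> * T \<or> T \<le> \<kappa> * r \<Longrightarrow>
      (\<And>x. x \<in> {1/2..2} \<Longrightarrow> (\<Phi> has_real_derivative \<Phi>' x) (at x within {1/2..2})) \<Longrightarrow>
      (\<And>x. x \<in> {1/2..2} \<Longrightarrow> (\<Phi>' has_real_derivative \<Phi>'' x) (at x within {1/2..2})) \<Longrightarrow>
      (\<And>x. x \<in> {1/2..2} \<Longrightarrow> (\<Phi>'' has_real_derivative \<Phi>''' x) (at x within {1/2..2})) \<Longrightarrow>
      (\<And>x. x \<in> {1/2..2} \<Longrightarrow> m * T \<le> \<bar>\<Phi>' x\<bar> \<and> \<bar>\<Phi>' x\<bar> \<le> L * T) \<Longrightarrow> 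
      (\<And>x. x \<in> {1/2..2} \<Longrightarrow> m * T \<le> \<bar>\<Phi>'' x\<bar> \<and> \<bar>\<Phi>'' x\<bar> \<le> L * T) \<Longrightarrow> 
      (\<And>x. x \<in> {1/2..2} \<Longrightarrow> \<bar>\<Phi>''' x\<bar> \<le> L * T) \<Longrightarrow> 
      \<bar>radial_integral (\<lambda>\<rho>. \<rho> powr (s + 1) * P \<rho>) \<Phi> r\<bar> \<le> C / (T * sqrt T)"
    using radial_integral_bound_C3[OF b b' M ends m L] by blast
  have dg: "(g has_real_derivative deriv g y) (at y)" "(deriv g has_real_derivative (deriv ^^ 2) g y) (at y)"
    "((deriv ^^ 2) g has_real_derivative (deriv ^^ 3) g y) (at y)" if "y > 0" for y
    using C_k_on_has_derivative[OF g open_greaterThan, of y 0] C_k_on_has_derivative[OF g open_greaterThan, of y 1]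
      C_k_on_has_derivative[OF g open_greaterThan, of y 2] that
    by (simp_all add: numeral_2_eq_2 numeral_3_eq_3)
  have cg: "continuous_on {0<..} g"
    by (rule DERIV_continuous_on[OF has_field_derivative_at_within[OF dg(1)]]) simp
  show ?thesis
  proof (rule that[OF C])
    fix t \<delta> :: real and x :: "real^2" and k
    assume t: "t \<noteq> 0" and \<delta>: "\<delta> > 0" and k: "k \<in> dyadic_indices J" and T1: "osc_size \<alpha> t \<delta> k \<ge> 1"
      and r: "norm x * (2 powi k / \<delta>) \<le> \<kappa> * osc_size \<alpha> t \<delta> k \<or> osc_size \<alpha> t \<delta> k \<le> \<kappa> * (norm x * (2 powi k / \<delta>))"
    define a where "a = (2 powi k :: real)"
    define T where "T = osc_size \<alpha> t \<delta> k"
    have a: "a > 0" by (simp add: a_def)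
    have T: "T \<ge> 1" using T1 by (simp add: T_def)
    have pos: "a * \<rho> > 0" if "\<rho> \<in> {1/2..2}" for \<rho> using that a by simp
    have mem: "a * \<rho> \<in> J" if "\<rho> \<in> {1/2..2}" for \<rho> using dyadic_indices_mem[OF k that] by (simp add: a_def)
    have "\<bar>radial_integral (\<lambda>\<rho>. \<rho> powr (s + 1) * P \<rho>) (\<lambda>\<rho>. t / \<delta> * g (a * \<rho>) + c) (norm x * (a / \<delta>))\<bar> \<le> C / (T * sqrt T)" for c
    proof (rule bound)
      fix \<rho> :: real assume \<rho>: "\<rho> \<in> {1/2..2}"
      show "((\<lambda>\<rho>. t / \<delta> * g (a * \<rho>) + c) has_real_derivative t / \<delta> * a * deriv g (a * \<rho>)) (at \<rho> within {1/2..2})"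
        by (rule has_derivative_dilation[OF dg(1) pos[OF \<rho>]])
      show "((\<lambda>\<rho>. t / \<delta> * a * deriv g (a * \<rho>)) has_real_derivative t / \<delta> * a * a * (deriv ^^ 2) g (a * \<rho>)) (at \<rho> within {1/2..2})"
        using has_derivative_dilation[OF dg(2) pos[OF \<rho>], of "t / \<delta> * a" 0] by simp
      show "((\<lambda>\<rho>. t / \<delta> * a * a * (deriv ^^ 2) g (a * \<rho>)) has_real_derivative t / \<delta> * a * a * a * (deriv ^^ 3) g (a * \<rho>)) (at \<rho> within {1/2..2})"
        using has_derivative_dilation[OF dg(3) pos[OF \<rho>], of "t / \<delta> * a * a" 0] by simp
      show "m * T \<le> \<bar>t / \<delta> * a * deriv g (a * \<rho>)\<bar> \<and> \<bar>t / \<delta> * a * deriv g (a * \<rho>)\<bar> \<le> L * T"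
        using phase_bounds(1)[OF \<rho> \<delta>, of 1 lam k \<alpha> "deriv g" t] phase_bounds(2)[OF \<rho> \<delta>, of 1 "deriv g" k Lam \<alpha> t]
          g1 mem[OF \<rho>] lam Lam
        by (simp add: a_def T_def m_def L_def add.commute)
      show "m * T \<le> \<bar>t / \<delta> * a * a * (deriv ^^ 2) g (a * \<rho>)\<bar> \<and> \<bar>t / \<delta> * a * a * (deriv ^^ 2) g (a * \<rho>)\<bar> \<le> L * T"
        using phase_bounds(1)[OF \<rho> \<delta>, of 2 lam k \<alpha> "(deriv ^^ 2) g" t] phase_bounds(2)[OF \<rho> \<delta>, of 2 "(deriv ^^ 2) g" k Lam \<alpha> t]
          g2 mem[OF \<rho>] lam Lam
        by (simp add: a_def T_def m_def L_def power2_eq_square mult.assoc)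
      show "\<bar>t / \<delta> * a * a * a * (deriv ^^ 3) g (a * \<rho>)\<bar> \<le> L * T"
        using phase_bounds(2)[OF \<rho> \<delta>, of 3 "(deriv ^^ 3) g" k Lam \<alpha> t]
          g3 mem[OF \<rho>] lam Lam
        by (simp add: a_def T_def m_def L_def power3_eq_cube mult.assoc)
    qed (use T r a \<delta> in \<open>auto simp: a_def T_def\<close>)
    then have "cmod (I_dyadic g P s t \<delta> x k) \<le> (a / \<delta>) powr (s + 2) * (C / (T * sqrt T))"
      unfolding a_def
      by (intro cmod_I_dyadic_le C2_annular_continuous[OF P] C2_annular_support[OF P] cg \<delta> refl) auto
    then show "cmod (I_dyadic g P s t \<delta> x k) \<le>
        C * (2 powi k / \<delta>) powr (s + 2) / (osc_size \<alpha> t \<delta> k * sqrt (osc_size \<alpha> t \<delta> k))"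
      by (simp add: a_def T_def mult_ac)
  qed
qed

section \<open>Littlewood-Paley sums\<close>

lemma lp_Q_scale: "lp_Q \<phi> k y = lp_Q \<phi> 0 (y / 2 powi k)"
  unfolding lp_Q_def by (simp add: power_int_diff power_int_minus field_simps)

lemma osc_integral_lp_Q: "osc_integral g (lp_Q \<phi> k) s t \<delta> x = I_dyadic g (lp_Q \<phi> 0) s t \<delta> x k"
  unfolding I_dyadic_def by (subst lp_Q_scale[abs_def]) (rule refl)

lemma lp_Q_nonneg:
  assumes "lp_generator \<phi>" "0 \<le> y"
  shows "0 \<le> lp_Q \<phi> k y"
proof -
  have "antimono_on {0..} \<phi>" using assms by (simp add: lp_generator_def)
  moreover have "2 powi (- k - 1) * y \<le> 2 powi (- k) * y"
    using assms(2) by (intro mult_right_mono power_int_increasing) auto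
  moreover have "0 \<le> 2 powi (- k - 1) * y" using assms(2) by simp
  ultimately show ?thesis
    unfolding lp_Q_def using monotone_onD[of "{0..}" "(\<le>)" "(\<ge>)" \<phi>] by simp
qed

lemma lp_Q_finite_support:
  assumes \<phi>: "lp_generator \<phi>" and y: "0 \<le> y"
  shows "finite {k. lp_Q \<phi> k y \<noteq> 0}"
proof (cases "y = 0")
  case True
  then show ?thesis by (simp add: lp_Q_def)
next
  case False
  then have y0: "y > 0" using y by simp
  have "{k. lp_Q \<phi> k y \<noteq> 0} \<subseteq> {\<lfloor>log 2 y\<rfloor> - 1..\<lceil>log 2 y\<rceil> + 1}"
  proof
    fix k assume "k \<in> {k. lp_Q \<phi> k y \<noteq> 0}"
    then have "y / 2 powi k \<in> {1/2..2}"
      using C2_annular_support[OF lp_Q_C2_annular[OF \<phi>], of "y / 2 powi k"] y lp_Q_scale[of \<phi> k y] by auto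
    then have b: "2 powi k / 2 \<le> y" "y \<le> 2 * 2 powi k" by (auto simp: field_simps)
    have e: "2 powi k = 2 powr real_of_int k" by (simp add: powr_real_of_int')
    have "2 powr (k - 1) \<le> y" using b(1) by (simp add: e powr_diff)
    then have "k - 1 \<le> log 2 y" using y0 by (simp add: le_log_iff)
    moreover have "y \<le> 2 powr (k + 1)" using b(2) by (simp add: e powr_add)
    then have "log 2 y \<le> k + 1" using y0 by (simp add: log_le_iff)
    ultimately show "k \<in> {\<lfloor>log 2 y\<rfloor> - 1..\<lceil>log 2 y\<rceil> + 1}" by simp linarith
  qed
  then show ?thesis by (rule finite_subset) simp
qed

text \<open>Bounded finite sums of moduli make the series over k absolutely convergent, so the
  prescription always makes sense and the series obeys the bound. If the full integrand is
  integrable, \<open>lp_integral\<close> is the Lebesgue integral instead, and it must be compared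
  with the series: the partial sums converge pointwise and, as the Q_k are nonnegative on the
  half-line, are dominated by the full integrand.\<close>

lemma lp_integral_bound:
  assumes \<phi>: "lp_generator \<phi>" and g: "continuous_on {0<..} g" and \<delta>: "0 < \<delta>"
    and B: "\<And>F. finite F \<Longrightarrow> F \<subseteq> dyadic_indices J \<Longrightarrow> (\<Sum>k\<in>F. cmod (I_dyadic g (lp_Q \<phi> 0) s t \<delta> x k)) \<le> B"
  shows "lp_integral_converges g \<phi> J s t \<delta> x" "cmod (lp_integral g \<phi> J s t \<delta> x) \<le> B"
proof -
  let ?D = "dyadic_indices J"
  let ?I = "\<lambda>k. osc_integral g (lp_Q \<phi> k) s t \<delta> x"
  have B': "(\<Sum>k\<in>F. cmod (?I k)) \<le> B" if "finite F" "F \<subseteq> ?D" for F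
    using B[OF that] by (simp add: osc_integral_lp_Q)
  have abs: "(\<lambda>k. cmod (?I k)) summable_on ?D"
    by (rule nonneg_bdd_above_summable_on) (auto intro!: bdd_aboveI2[where M = B] B')
  then show "lp_integral_converges g \<phi> J s t \<delta> x"
    unfolding lp_integral_converges_def by (blast intro: abs_summable_summable)
  have sumB: "cmod (\<Sum>\<^sub>\<infinity>k\<in>?D. ?I k) \<le> B"
  proof -
    have "cmod (\<Sum>\<^sub>\<infinity>k\<in>?D. ?I k) \<le> (\<Sum>\<^sub>\<infinity>k\<in>?D. cmod (?I k))" by (rule norm_infsum_bound[OF abs])
    also have "\<dots> \<le> B" by (rule infsum_le_finite_sums[OF abs B'])
    finally show ?thesis .
  qed
  show "cmod (lp_integral g \<phi> J s t \<delta> x) \<le> B"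
  proof (cases "integrable lborel (osc_integrand g (lp_sum \<phi> J) s t \<delta> x)")
    case False
    then show ?thesis using sumB by (simp add: lp_integral_def)
  next
    case True
    let ?f = "osc_integrand g (lp_sum \<phi> J) s t \<delta> x"
    \<comment> \<open>A finite exhaustion of the index set. At each point only finitely many Q_k are
      nonzero, so the partial sums \<open>S n y\<close> are eventually constant in
      \<open>n\<close>.\<close>
    define K where "K n = ?D \<inter> {- int n..int n}" for n
    have K: "finite (K n)" "K n \<subseteq> ?D" for n by (auto simp: K_def)
    define S where "S n y = (\<Sum>k\<in>K n. lp_Q \<phi> k y)" for n y
    define f where "f n = osc_integrand g (S n) s t \<delta> x" for n
    have f_sum: "f n \<xi> = (\<Sum>k\<in>K n. osc_integrand g (lp_Q \<phi> k) s t \<delta> x \<xi>)" for n \<xi>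
      unfolding f_def osc_integrand_def S_def by (simp add: sum_distrib_left sum_distrib_right)
    have Qint: "integrable lborel (osc_integrand g (lp_Q \<phi> k) s t \<delta> x)" for k
      using osc_integrand_annulus(3)[OF C2_annular_continuous[OF lp_Q_C2_annular[OF \<phi>]]
        C2_annular_support[OF lp_Q_C2_annular[OF \<phi>]] g \<delta> refl, of k s t x]
      by (subst lp_Q_scale[abs_def])
    have fint: "integrable lborel (f n)" for n
      using Qint unfolding f_sum[abs_def] by (intro Bochner_Integration.integrable_sum)
    have lim: "(\<lambda>n. S n y) \<longlonglongrightarrow> lp_sum \<phi> J y" and le: "S n y \<le> lp_sum \<phi> J y" and nn: "0 \<le> S n y"
      if y: "0 \<le> y" for y n
    proof -
      define A where "A = {k \<in> ?D. lp_Q \<phi> k y \<noteq> 0}"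
      have A: "finite A" using lp_Q_finite_support[OF \<phi> y] by (rule rev_finite_subset) (auto simp: A_def)
      have "lp_sum \<phi> J y = (\<Sum>\<^sub>\<infinity>k\<in>A. lp_Q \<phi> k y)"
        unfolding lp_sum_def by (rule infsum_cong_neutral) (auto simp: A_def)
      then have sA: "lp_sum \<phi> J y = (\<Sum>k\<in>A. lp_Q \<phi> k y)" using A by simp
      have SA: "S n y = (\<Sum>k\<in>A \<inter> K n. lp_Q \<phi> k y)" for n
        unfolding S_def by (rule sum.mono_neutral_right) (use K in \<open>auto simp: A_def\<close>)
      show "S n y \<le> lp_sum \<phi> J y"
        unfolding sA SA by (rule sum_mono2[OF A]) (auto intro: lp_Q_nonneg[OF \<phi> y])
      show "0 \<le> S n y" unfolding S_def by (intro sum_nonneg lp_Q_nonneg[OF \<phi> y])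
      obtain m where m: "A \<subseteq> {- int m..int m}"
      proof -
        have "\<bar>k\<bar> \<le> Max (abs ` A)" if "k \<in> A" for k using A that by simp
        then show ?thesis by (intro that[of "nat (Max (abs ` A))"] subsetI) fastforce
      qed
      have "S n y = lp_sum \<phi> J y" if "n \<ge> m" for n
      proof -
        have "A \<inter> K n = A" using m that by (auto simp: K_def A_def)
        then show ?thesis by (simp add: SA sA)
      qed
      then show "(\<lambda>n. S n y) \<longlonglongrightarrow> lp_sum \<phi> J y"
        by (intro tendsto_eventually) (auto simp: eventually_sequentially)
    qed
    have "(\<lambda>n. LINT \<xi>|lborel. f n \<xi>) \<longlonglongrightarrow> (LINT \<xi>|lborel. ?f \<xi>)"
    proof (rule integral_dominated_convergence)
      show "?f \<in> borel_measurable lborel" using True by (rule borel_measurable_integrable)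
      show "f n \<in> borel_measurable lborel" for n using fint by (rule borel_measurable_integrable)
      show "integrable lborel (\<lambda>\<xi>. cmod (?f \<xi>))" using True by (rule integrable_norm)
      show "AE \<xi> in lborel. (\<lambda>n. f n \<xi>) \<longlonglongrightarrow> ?f \<xi>"
        unfolding f_def osc_integrand_def using \<delta> by (intro AE_I2 tendsto_intros lim) auto
      show "AE \<xi> in lborel. cmod (f n \<xi>) \<le> cmod (?f \<xi>)" for n
      proof (rule AE_I2)
        fix \<xi> :: "real^2"
        have "0 \<le> \<delta> * norm \<xi>" using \<delta> by simp
        from le[OF this, of n] nn[OF this, of n] show "cmod (f n \<xi>) \<le> cmod (?f \<xi>)"
          unfolding f_def osc_integrand_def norm_mult by (intro mult_right_mono mult_left_mono) auto
      qed
    qed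
    moreover have "cmod (LINT \<xi>|lborel. f n \<xi>) \<le> B" for n
    proof -
      have "(LINT \<xi>|lborel. f n \<xi>) = (\<Sum>k\<in>K n. ?I k)"
        unfolding f_sum osc_integral_def using Qint by (intro Bochner_Integration.integral_sum)
      then show ?thesis using norm_sum[of ?I "K n"] B'[OF K] by (simp add: order_trans)
    qed
    ultimately have "cmod (LINT \<xi>|lborel. ?f \<xi>) \<le> B"
      by (intro Lim_norm_ubound[of sequentially "\<lambda>n. LINT \<xi>|lborel. f n \<xi>"]) auto
    then show ?thesis using True by (simp add: lp_integral_def osc_integral_def)
  qed
qed

section \<open>Summation over the dyadic scales\<close>

lemma sum_geometric_int_bounded:
  fixes q :: real
  assumes q: "0 < q" "q < 1"
  obtains C where "C > 0" "\<And>F :: int set. finite F \<Longrightarrow> (\<Sum>k\<in>F. q ^ nat \<bar>k\<bar>) \<le> C"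
proof (rule that[of "2 / (1 - q)"])
  show "2 / (1 - q) > 0" using q by simp
  fix F :: "int set" assume F: "finite F"
  have geo: "(\<Sum>n\<in>A. q ^ n) \<le> 1 / (1 - q)" if "finite A" for A :: "nat set"
    using sum_le_suminf[OF summable_geometric, of q A] that q suminf_geometric[of q] by simp
  have inj: "inj_on nat (F \<inter> {0..})" "inj_on (\<lambda>k. nat (- k)) (F \<inter> {..<0})"
    by (auto simp: inj_on_def)
  have "(\<Sum>k\<in>F. q ^ nat \<bar>k\<bar>) = (\<Sum>k\<in>F \<inter> {0..}. q ^ nat \<bar>k\<bar>) + (\<Sum>k\<in>F \<inter> {..<0}. q ^ nat \<bar>k\<bar>)"
    using F by (subst sum.union_disjoint[symmetric]) (auto intro!: sum.cong)
  also have "(\<Sum>k\<in>F \<inter> {0..}. q ^ nat \<bar>k\<bar>) = (\<Sum>n\<in>nat ` (F \<inter> {0..}). q ^ n)"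
    using inj(1) by (subst sum.reindex) auto
  also have "(\<Sum>k\<in>F \<inter> {..<0}. q ^ nat \<bar>k\<bar>) = (\<Sum>n\<in>(\<lambda>k. nat (- k)) ` (F \<inter> {..<0}). q ^ n)"
    using inj(2) by (subst sum.reindex) auto
  finally show "(\<Sum>k\<in>F. q ^ nat \<bar>k\<bar>) \<le> 2 / (1 - q)"
    using geo[of "nat ` (F \<inter> {0..})"] geo[of "(\<lambda>k. nat (- k)) ` (F \<inter> {..<0})"] F by simp
qed

text \<open>For y > 0 and \<tau> > 0 this is exp (- \<tau> |log y|), a bump at y = 1 with power
  decay on both sides.\<close>

definition peak :: "real \<Rightarrow> real \<Rightarrow> real" where
  "peak \<tau> y = min (y powr \<tau>) (y powr - \<tau>)"

lemma peak_nonneg: "0 \<le> peak \<tau> y" by (simp add: peak_def)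

text \<open>With T = 2^(p u) the terms are 2^(-a |k + u|), where a = \<tau> |p|. Rounding u down to
  an integer costs at most a factor 2^a and leaves a translate of a two-sided geometric series,
  whose sum is independent of T. The same argument covers both signs of p.\<close>

lemma sum_peak_bounded:
  fixes \<tau> p :: real
  assumes \<tau>: "\<tau> > 0" and p: "p \<noteq> 0"
  obtains C where "C > 0" "\<And>F T. finite F \<Longrightarrow> 0 \<le> T \<Longrightarrow> (\<Sum>k\<in>F. peak \<tau> (T * 2 powr (p * real_of_int k))) \<le> C"
proof -
  define a where "a = \<tau> * \<bar>p\<bar>"
  define q where "q = 2 powr - a"
  have a: "a > 0" using \<tau> p by (simp add: a_def)
  have q: "0 < q" "q < 1" using a by (auto simp: q_def powr_less_one)
  obtain C where C: "C > 0" "\<And>F :: int set. finite F \<Longrightarrow> (\<Sum>k\<in>F. q ^ nat \<bar>k\<bar>) \<le> C"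
    using sum_geometric_int_bounded[OF q] by blast
  show ?thesis
  proof (rule that[of "2 powr a * C"])
    show "2 powr a * C > 0" using C by simp
    fix F :: "int set" and T :: real assume F: "finite F" and T0: "0 \<le> T"
    show "(\<Sum>k\<in>F. peak \<tau> (T * 2 powr (p * real_of_int k))) \<le> 2 powr a * C"
    \<comment> \<open>T = 0 arises for x = 0 in the critical sum. All terms are then 0, since 0
      raised by \<open>powr\<close> is 0.\<close>
    proof (cases "T = 0")
      case True
      then show ?thesis using C by (simp add: peak_def)
    next
      case False
      then have T: "T > 0" using T0 by simp
      define u where "u = log 2 T / p"
      define n where "n = \<lfloor>u\<rfloor>"
      have Tu: "T * 2 powr (p * real_of_int k) = 2 powr (p * (u + k))" for k :: int
        using T p by (simp add: u_def distrib_left powr_add)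
      have term_le: "peak \<tau> (T * 2 powr (p * real_of_int k)) \<le> 2 powr a * q ^ nat \<bar>k + n\<bar>" for k :: int
      proof -
        have "peak \<tau> (T * 2 powr (p * real_of_int k)) = min (2 powr (\<tau> * p * (u + k))) (2 powr (- (\<tau> * p * (u + k))))"
          unfolding Tu peak_def by (simp add: powr_powr mult_ac)
        also have "\<dots> \<le> 2 powr (- \<bar>\<tau> * p * (u + k)\<bar>)"
          by (simp add: abs_if min_le_iff_disj)
        also have "\<dots> = 2 powr (- (a * \<bar>u + k\<bar>))"
          using \<tau> by (simp add: a_def abs_mult)
        also have "\<dots> \<le> 2 powr (- (a * (\<bar>real_of_int (k + n)\<bar> - 1)))"
        proof -
          have "\<bar>real_of_int (k + n)\<bar> - 1 \<le> \<bar>u + k\<bar>" unfolding n_def by linarith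
          then show ?thesis using a by (intro powr_mono) auto
        qed
        also have "\<dots> = 2 powr a * (2 powr - a) powr \<bar>real_of_int (k + n)\<bar>"
          by (simp add: powr_powr powr_add[symmetric] algebra_simps)
        also have "(2 powr - a) powr \<bar>real_of_int (k + n)\<bar> = q ^ nat \<bar>k + n\<bar>"
          using q by (simp add: q_def[symmetric] powr_realpow[symmetric])
        finally show ?thesis .
      qed
      have "(\<Sum>k\<in>F. peak \<tau> (T * 2 powr (p * real_of_int k))) \<le> (\<Sum>k\<in>F. 2 powr a * q ^ nat \<bar>k + n\<bar>)"
        by (intro sum_mono term_le)
      also have "\<dots> = 2 powr a * (\<Sum>k\<in>(\<lambda>k. k + n) ` F. q ^ nat \<bar>k\<bar>)"
        by (subst sum.reindex) (auto simp: inj_on_def sum_distrib_left)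
      also have "\<dots> \<le> 2 powr a * C"
        using C(2)[of "(\<lambda>k. k + n) ` F"] F by (intro mult_left_mono) auto
      finally show ?thesis .
    qed
  qed
qed

text \<open>The value of (2^k / \<delta>)^(s+2) at the real k for which \<open>osc_size\<close>
  equals 1, that is, where the dyadic bounds peak.\<close>

definition decay_rate :: "real \<Rightarrow> real \<Rightarrow> real \<Rightarrow> real \<Rightarrow> real" where
  "decay_rate \<alpha> s t \<delta> = \<delta> powr (- ((\<alpha> + 1) * (s + 2) / (2 + \<alpha>))) / \<bar>t\<bar> powr ((s + 2) / (2 + \<alpha>))"

text \<open>Eliminating k between 2^k / \<delta> and \<open>osc_size\<close> separates the
  dependence on t and \<delta> from that on the scale; \<alpha> + 2 must be nonzero for
  \<open>osc_size\<close> to determine the scale.\<close>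

lemma decay_rate_osc_size:
  assumes \<alpha>: "\<alpha> \<noteq> -2" and t: "t \<noteq> 0" and \<delta>: "\<delta> > 0"
  shows "(2 powi k / \<delta>) powr (s + 2) = decay_rate \<alpha> s t \<delta> * osc_size \<alpha> t \<delta> k powr ((s + 2) / (2 + \<alpha>))"
proof -
  define \<sigma> where "\<sigma> = (s + 2) / (2 + \<alpha>)"
  have s: "s + 2 = (\<alpha> + 2) * \<sigma>" and s': "(\<alpha> + 1) * (s + 2) / (2 + \<alpha>) = (\<alpha> + 1) * \<sigma>"
  proof -
    have "\<alpha> + 2 \<noteq> 0" using \<alpha> by linarith
    then show "s + 2 = (\<alpha> + 2) * \<sigma>" by (simp add: \<sigma>_def add.commute[of 2 \<alpha>])
  qed (simp add: \<sigma>_def)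
  have "osc_size \<alpha> t \<delta> k powr \<sigma> = \<bar>t\<bar> powr \<sigma> / \<delta> powr \<sigma> * 2 powr ((\<alpha> + 2) * k * \<sigma>)"
    using \<delta> by (simp add: osc_size_def powr_mult powr_divide powr_powr)
  moreover have "(2 powi k / \<delta>) powr ((\<alpha> + 2) * \<sigma>) = 2 powr ((\<alpha> + 2) * k * \<sigma>) / \<delta> powr ((\<alpha> + 2) * \<sigma>)"
    using \<delta> by (simp add: powr_divide powr_real_of_int'[symmetric] powr_powr mult_ac)
  moreover have "\<delta> powr ((\<alpha> + 2) * \<sigma>) = \<delta> powr ((\<alpha> + 1) * \<sigma>) * \<delta> powr \<sigma>"
    using \<delta> by (simp add: powr_add[symmetric] algebra_simps)
  moreover have "\<bar>t\<bar> powr \<sigma> \<noteq> 0" using t by simp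
  ultimately show ?thesis
    unfolding decay_rate_def s' unfolding \<sigma>_def[symmetric] unfolding s using \<delta>
    by (simp add: powr_minus_divide)
qed

lemma decay_rate_nonneg: "0 \<le> decay_rate \<alpha> s t \<delta>"
  by (simp add: decay_rate_def)

text \<open>The left side grows like T^\<sigma> up to T = 1 and decays like T^(\<sigma>-1) beyond.
  The smaller of the two rates serves on both sides, and it is positive exactly for 0 < \<sigma> <
  1.\<close>

lemma min_powr_le_peak:
  assumes T: "T > 0" and \<sigma>: "0 < \<sigma>" "\<sigma> < 1"
  shows "T powr \<sigma> * min 1 (1 / T) \<le> peak (min \<sigma> (1 - \<sigma>)) T"
proof (cases "T \<le> 1")
  case True
  have p: "T powr a \<le> T powr b" if "b \<le> a" for a b using powr_mono'[OF that] True T by simp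
  have "T powr \<sigma> * min 1 (1 / T) = T powr \<sigma>" using True T by (simp add: min_def)
  moreover have "T powr \<sigma> \<le> T powr min \<sigma> (1 - \<sigma>)" "T powr \<sigma> \<le> T powr - min \<sigma> (1 - \<sigma>)"
    by (rule p; use \<sigma> in simp)+
  ultimately show ?thesis by (simp only: peak_def min.bounded_iff)
next
  case False
  have p: "T powr a \<le> T powr b" if "a \<le> b" for a b using powr_mono[OF that, of T] False by simp
  have "T powr \<sigma> * min 1 (1 / T) = T powr (\<sigma> - 1)" using False T by (simp add: min_def powr_diff)
  moreover have "T powr (\<sigma> - 1) \<le> T powr min \<sigma> (1 - \<sigma>)" "T powr (\<sigma> - 1) \<le> T powr - min \<sigma> (1 - \<sigma>)"
    by (rule p; use \<sigma> in \<open>simp add: min_def\<close>)+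
  ultimately show ?thesis by (simp only: peak_def min.bounded_iff)
qed

text \<open>The majorants \<open>M k\<close> are exhibited, and not only a bound for the sum,
  because they are uniform in x: this permits the supremum inside the sum.\<close>

lemma dyadic_sum_sup_bound:
  assumes P: "C2_annular P" and lam: "lam > 0" and \<alpha>: "\<alpha> \<noteq> -2"
    and g: "C_k_on 2 g {0<..}"
    and g1: "\<forall>y\<in>J. lam * y powr (\<alpha> + 1) \<le> \<bar>deriv g y\<bar>"
    and g2: "\<forall>y\<in>J. lam * y powr \<alpha> \<le> \<bar>(deriv ^^ 2) g y\<bar>"
    and s: "(\<alpha> > s \<and> s > -2) \<or> (\<alpha> < s \<and> s < -2)"
  obtains C where "C > 0"
    "\<And>t \<delta>. t \<noteq> 0 \<Longrightarrow> \<delta> > 0 \<Longrightarrow> \<exists>M. (\<forall>k\<in>dyadic_indices J. \<forall>x. cmod (I_dyadic g P s t \<delta> x k) \<le> M k) \<and>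
      (\<forall>F. finite F \<longrightarrow> F \<subseteq> dyadic_indices J \<longrightarrow> (\<Sum>k\<in>F. M k) \<le> C * decay_rate \<alpha> s t \<delta>)"
proof -
  obtain C0 where C0: "C0 > 0" and bd: "\<And>t \<delta> x k. t \<noteq> 0 \<Longrightarrow> \<delta> > 0 \<Longrightarrow> k \<in> dyadic_indices J \<Longrightarrow>
      cmod (I_dyadic g P s t \<delta> x k) \<le> C0 * (2 powi k / \<delta>) powr (s + 2) * min 1 (1 / osc_size \<alpha> t \<delta> k)"
    using I_dyadic_bound_C2[OF P lam g g1 g2] by blast
  define \<sigma> where "\<sigma> = (s + 2) / (2 + \<alpha>)"
  \<comment> \<open>The two alternatives for s say that s + 2 and \<alpha> + 2 have the same sign
    and that |s + 2| < |\<alpha> + 2|.\<close>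
  have \<sigma>: "0 < \<sigma>" "\<sigma> < 1" using s by (auto simp: \<sigma>_def zero_less_divide_iff divide_less_eq)
  define \<tau> where "\<tau> = min \<sigma> (1 - \<sigma>)"
  have \<tau>: "\<tau> > 0" using \<sigma> by (simp add: \<tau>_def)
  obtain C1 where C1: "C1 > 0" and geo: "\<And>F T. finite F \<Longrightarrow> 0 \<le> T \<Longrightarrow> (\<Sum>k\<in>F. peak \<tau> (T * 2 powr ((\<alpha> + 2) * real_of_int k))) \<le> C1"
    using sum_peak_bounded[OF \<tau>, of "\<alpha> + 2"] \<alpha> by auto
  show ?thesis
  proof (rule that[of "C0 * C1"])
    show "C0 * C1 > 0" using C0 C1 by simp
    fix t \<delta> :: real assume t: "t \<noteq> 0" and \<delta>: "\<delta> > 0"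
    let ?E = "decay_rate \<alpha> s t \<delta>"
    define M where "M k = C0 * ?E * peak \<tau> (osc_size \<alpha> t \<delta> k)" for k
    have "cmod (I_dyadic g P s t \<delta> x k) \<le> M k" if k: "k \<in> dyadic_indices J" for x k
    proof -
      have T: "osc_size \<alpha> t \<delta> k > 0" using t \<delta> by (simp add: osc_size_def)
      have "cmod (I_dyadic g P s t \<delta> x k) \<le>
          C0 * (?E * osc_size \<alpha> t \<delta> k powr \<sigma>) * min 1 (1 / osc_size \<alpha> t \<delta> k)"
        using bd[OF t \<delta> k, of x] unfolding decay_rate_osc_size[OF \<alpha> t \<delta>] \<sigma>_def .
      also have "\<dots> = C0 * ?E * (osc_size \<alpha> t \<delta> k powr \<sigma> * min 1 (1 / osc_size \<alpha> t \<delta> k))"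
        by (simp only: mult_ac)
      also have "\<dots> \<le> M k"
        unfolding M_def \<tau>_def using C0 decay_rate_nonneg by (intro mult_left_mono min_powr_le_peak T \<sigma>) auto
      finally show ?thesis .
    qed
    moreover have "(\<Sum>k\<in>F. M k) \<le> C0 * C1 * ?E" if "finite F" for F
    proof -
      have "(\<Sum>k\<in>F. M k) = C0 * ?E * (\<Sum>k\<in>F. peak \<tau> (osc_size \<alpha> t \<delta> k))"
        by (simp add: M_def sum_distrib_left)
      also have "\<dots> \<le> C0 * ?E * C1"
        using geo[OF that, of "\<bar>t\<bar> / \<delta>"] \<delta> C0 decay_rate_nonneg
        by (intro mult_left_mono) (auto simp: osc_size_def)
      finally show ?thesis by (simp add: mult_ac)
    qed
    ultimately show "\<exists>M. (\<forall>k\<in>dyadic_indices J. \<forall>x. cmod (I_dyadic g P s t \<delta> x k) \<le> M k) \<and>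
      (\<forall>F. finite F \<longrightarrow> F \<subseteq> dyadic_indices J \<longrightarrow> (\<Sum>k\<in>F. M k) \<le> C0 * C1 * ?E)" by blast
  qed
qed

text \<open>For \<open>s = \<alpha>\<close> every dyadic piece with \<open>osc_size \<ge> 1\<close> is of the critical size. Only those whose spatial
  frequency \<open>|x| 2\<^sup>k / \<delta>\<close> is comparable to \<open>osc_size\<close> fail to improve on it, and since \<open>\<alpha> \<noteq> -1\<close> the
  quotient of the two is again geometric in \<open>k\<close>.\<close>

lemma dyadic_sum_bound_critical:
  assumes P: "C2_annular P" and lam: "lam > 0" and Lam: "Lam > 0" and \<alpha>: "\<alpha> \<noteq> -2" "\<alpha> \<noteq> -1"
    and g: "C_k_on 2 g {0<..}" "C_k_on 3 g {0<..}"
    and g1: "\<forall>y\<in>J. lam * y powr (\<alpha> + 1) \<le> \<bar>deriv g y\<bar>" "\<forall>y\<in>J. \<bar>deriv g y\<bar> \<le> Lam * y powr (\<alpha> + 1)"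
    and g2: "\<forall>y\<in>J. lam * y powr \<alpha> \<le> \<bar>(deriv ^^ 2) g y\<bar>" "\<forall>y\<in>J. \<bar>(deriv ^^ 2) g y\<bar> \<le> Lam * y powr \<alpha>"
    and g3: "\<forall>y\<in>J. \<bar>(deriv ^^ 3) g y\<bar> \<le> Lam * y powr (\<alpha> - 1)"
  obtains C where "C > 0"
    "\<And>t \<delta> x F. t \<noteq> 0 \<Longrightarrow> \<delta> > 0 \<Longrightarrow> finite F \<Longrightarrow> F \<subseteq> dyadic_indices J \<Longrightarrow>
      (\<Sum>k\<in>F. cmod (I_dyadic g P \<alpha> t \<delta> x k)) \<le> C * decay_rate \<alpha> \<alpha> t \<delta>"
proof -
  obtain C1 where C1: "C1 > 0" and bd1: "\<And>t \<delta> x k. t \<noteq> 0 \<Longrightarrow> \<delta> > 0 \<Longrightarrow> k \<in> dyadic_indices J \<Longrightarrow>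
      cmod (I_dyadic g P \<alpha> t \<delta> x k) \<le> C1 * (2 powi k / \<delta>) powr (\<alpha> + 2) * min 1 (1 / osc_size \<alpha> t \<delta> k)"
    using I_dyadic_bound_C2[OF P lam g(1) g1(1) g2(1)] by blast
  obtain C2 \<kappa> where C2: "C2 > 0" and \<kappa>: "\<kappa> > 0" and bd2:
    "\<And>t \<delta> x k. t \<noteq> 0 \<Longrightarrow> \<delta> > 0 \<Longrightarrow> k \<in> dyadic_indices J \<Longrightarrow> osc_size \<alpha> t \<delta> k \<ge> 1 \<Longrightarrow>
      norm x * (2 powi k / \<delta>) \<le> \<kappa> * osc_size \<alpha> t \<delta> k \<or> osc_size \<alpha> t \<delta> k \<le> \<kappa> * (norm x * (2 powi k / \<delta>)) \<Longrightarrow>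
      cmod (I_dyadic g P \<alpha> t \<delta> x k) \<le>
        C2 * (2 powi k / \<delta>) powr (\<alpha> + 2) / (osc_size \<alpha> t \<delta> k * sqrt (osc_size \<alpha> t \<delta> k))"
    using I_dyadic_bound_C3[OF P lam Lam g(2) g1 g2 g3, of \<alpha>] by blast
  obtain G1 where G1: "G1 > 0" and geo1: "\<And>F T. finite F \<Longrightarrow> 0 \<le> T \<Longrightarrow> (\<Sum>k\<in>F. peak (1/2) (T * 2 powr ((\<alpha> + 2) * real_of_int k))) \<le> G1"
    using sum_peak_bounded[of "1/2" "\<alpha> + 2"] \<alpha> by auto
  obtain G2 where G2: "G2 > 0" and geo2: "\<And>F T. finite F \<Longrightarrow> 0 \<le> T \<Longrightarrow> (\<Sum>k\<in>F. peak (1/2) (T * 2 powr (- (\<alpha> + 1) * real_of_int k))) \<le> G2"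
    using sum_peak_bounded[of "1/2" "- (\<alpha> + 1)"] \<alpha> by auto
  \<comment> \<open>\<open>C1\<close> serves T <= 1 and \<open>C2\<close> the scales with r and T
    far apart. For comparable r and T the bound is only \<open>C1\<close> times the decay rate, and
    \<open>C1 / sqrt \<kappa>\<close> compensates for the peak at their quotient, which may be as
    small as sqrt \<kappa>.\<close>
  define C0 where "C0 = max (max C1 C2) (C1 / sqrt \<kappa>)"
  have C0: "C0 > 0" "C1 \<le> C0" "C2 \<le> C0" "C1 / sqrt \<kappa> \<le> C0" using C1 by (auto simp: C0_def)
  show ?thesis
  proof (rule that[of "C0 * (G1 + G2)"])
    show "C0 * (G1 + G2) > 0" using C0 G1 G2 by simp
    fix t \<delta> :: real and x :: "real^2" and F
    assume t: "t \<noteq> 0" and \<delta>: "\<delta> > 0" and F: "finite F" "F \<subseteq> dyadic_indices J"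
    let ?E = "decay_rate \<alpha> \<alpha> t \<delta>"
    \<comment> \<open>The quotient q of the spatial frequency |x| 2^k / \<delta> by
      \<open>osc_size\<close> is R 2^(-(\<alpha>+1) k): \<delta> cancels.\<close>
    define R where "R = norm x / \<bar>t\<bar>"
    have R0: "0 \<le> R" by (simp add: R_def)
    have E0: "0 \<le> ?E" by (rule decay_rate_nonneg)
    have term_le: "cmod (I_dyadic g P \<alpha> t \<delta> x k) \<le>
        C0 * ?E * (peak (1/2) (osc_size \<alpha> t \<delta> k) + peak (1/2) (R * 2 powr (- (\<alpha> + 1) * real_of_int k)))"
      if k: "k \<in> F" for k
    proof -
      have kD: "k \<in> dyadic_indices J" using k F by blast
      define T where "T = osc_size \<alpha> t \<delta> k"
      define q where "q = R * 2 powr (- (\<alpha> + 1) * real_of_int k)"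
      have T: "T > 0" using t \<delta> by (simp add: T_def osc_size_def)
      \<comment> \<open>For s = \<alpha> the exponent \<sigma> is 1, so the scale factor is linear
        in T.\<close>
      have N: "(2 powi k / \<delta>) powr (\<alpha> + 2) = ?E * T"
        using decay_rate_osc_size[OF \<alpha>(1) t \<delta>, of k \<alpha>] \<alpha>(1) T by (simp add: T_def add.commute)
      have qT: "norm x * (2 powi k / \<delta>) = q * T"
      proof -
        have "2 powr (- (\<alpha> + 1) * real_of_int k) * 2 powr ((\<alpha> + 2) * real_of_int k) = (2 powi k :: real)"
          by (simp add: powr_add[symmetric] powr_real_of_int'[symmetric] algebra_simps)
        then have "q * T = R * (\<bar>t\<bar> / \<delta>) * 2 powi k"
          by (simp add: q_def T_def osc_size_def mult_ac)
        then show ?thesis using t by (simp add: R_def)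
      qed
      have q0: "0 \<le> q" using R0 by (simp add: q_def)
      have pk: "0 \<le> peak (1/2) T" "0 \<le> peak (1/2) q" by (rule peak_nonneg)+
      consider "T \<le> 1" | "T > 1" "q \<le> \<kappa> \<or> 1 \<le> \<kappa> * q" | "T > 1" "\<kappa> < q" "\<kappa> * q < 1" by linarith
      then have "cmod (I_dyadic g P \<alpha> t \<delta> x k) \<le> C0 * ?E * (peak (1/2) T + peak (1/2) q)"
      proof cases
        case 1
        have "T * 1 \<le> T powr (1/2)" using 1 T powr_mono'[of "1/2" 1 T] by simp
        moreover have "T * 1 \<le> T powr - (1/2)" using 1 T powr_mono'[of "-(1/2)" 1 T] by simp
        ultimately have "T * min 1 (1 / T) \<le> peak (1/2) T" using 1 T by (simp add: peak_def min_def)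
        then have "C1 * (?E * T) * min 1 (1 / T) \<le> C1 * ?E * peak (1/2) T"
          using C1 E0 mult_left_mono[of "T * min 1 (1 / T)" "peak (1/2) T" "C1 * ?E"] by (simp only: mult_ac) simp
        also have "\<dots> \<le> C0 * ?E * (peak (1/2) T + peak (1/2) q)"
          using C0 C1 E0 pk by (intro mult_mono) auto
        finally show ?thesis using bd1[OF t \<delta> kD, of x] unfolding N T_def[symmetric] by linarith
      next
        case 2
        have "peak (1/2) T = 1 / sqrt T"
        proof -
          have "T powr - (1/2) \<le> T powr (1/2)" using 2(1) by simp
          then have "peak (1/2) T = T powr - (1/2)" by (simp add: peak_def)
          then show ?thesis using T by (simp add: powr_minus_divide powr_half_sqrt)
        qed
        then have "C2 * (?E * T) / (T * sqrt T) = C2 * ?E * peak (1/2) T" using T by simp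
        also have "\<dots> \<le> C0 * ?E * (peak (1/2) T + peak (1/2) q)"
          using C0 C2 E0 pk by (intro mult_mono) auto
        finally have "C2 * (?E * T) / (T * sqrt T) \<le> C0 * ?E * (peak (1/2) T + peak (1/2) q)" .
        moreover have "q * T \<le> \<kappa> * T \<or> T \<le> \<kappa> * (q * T)"
          using 2(2)
        proof
          assume "q \<le> \<kappa>" then show ?thesis using T by simp
        next
          assume "1 \<le> \<kappa> * q"
          then have "1 * T \<le> \<kappa> * q * T" using T by (intro mult_right_mono) auto
          then show ?thesis by (simp add: mult_ac)
        qed
        ultimately show ?thesis
          using bd2[OF t \<delta> kD, of x] 2(1) unfolding N qT T_def[symmetric] by linarith
      next
        case 3
        have q1: "q > 0" using 3 \<kappa> by linarith
        \<comment> \<open>In the comparable range \<kappa> < q < 1/\<kappa>, both sqrt q and 1 /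
          sqrt q are at least sqrt \<kappa>. The sum of these peaks replaces a count of the
          exceptional scales.\<close>
        have "sqrt \<kappa> \<le> peak (1/2) q"
        proof -
          have "sqrt \<kappa> \<le> sqrt q" using 3 by simp
          moreover have "sqrt \<kappa> * sqrt q \<le> 1"
          proof -
            have "sqrt (\<kappa> * q) \<le> sqrt 1" using 3 by (intro real_sqrt_le_mono) simp
            then show ?thesis by (simp add: real_sqrt_mult)
          qed
          then have "sqrt \<kappa> \<le> 1 / sqrt q" using q1 by (simp add: field_simps)
          ultimately show ?thesis using q1 by (simp add: peak_def powr_minus_divide powr_half_sqrt)
        qed
        then have "C1 * ?E \<le> C1 / sqrt \<kappa> * ?E * peak (1/2) q"
          using C1 E0 \<kappa> mult_left_mono[of "sqrt \<kappa>" "peak (1/2) q" "C1 / sqrt \<kappa> * ?E"] by simp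
        also have "\<dots> \<le> C0 * ?E * (peak (1/2) T + peak (1/2) q)"
          using C0 C1 E0 pk \<kappa> by (intro mult_mono) auto
        finally have "C1 * (?E * T) * min 1 (1 / T) \<le> C0 * ?E * (peak (1/2) T + peak (1/2) q)"
          using 3(1) by (simp add: min_def)
        then show ?thesis using bd1[OF t \<delta> kD, of x] unfolding N T_def[symmetric] by linarith
      qed
      then show ?thesis by (simp add: T_def q_def)
    qed
    have "(\<Sum>k\<in>F. cmod (I_dyadic g P \<alpha> t \<delta> x k)) \<le>
        (\<Sum>k\<in>F. C0 * ?E * (peak (1/2) (osc_size \<alpha> t \<delta> k) + peak (1/2) (R * 2 powr (- (\<alpha> + 1) * real_of_int k))))"
      by (rule sum_mono) (rule term_le)
    also have "\<dots> = C0 * ?E * ((\<Sum>k\<in>F. peak (1/2) (osc_size \<alpha> t \<delta> k)) + (\<Sum>k\<in>F. peak (1/2) (R * 2 powr (- (\<alpha> + 1) * real_of_int k))))"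
      by (simp only: sum_distrib_left[symmetric] sum.distrib)
    also have "\<dots> \<le> C0 * ?E * (G1 + G2)"
      using geo1[OF F(1), of "\<bar>t\<bar> / \<delta>"] geo2[OF F(1) R0] \<delta> C0 E0
      unfolding osc_size_def by (intro mult_left_mono add_mono) auto
    finally show "(\<Sum>k\<in>F. cmod (I_dyadic g P \<alpha> t \<delta> x k)) \<le> C0 * (G1 + G2) * ?E"
      by (simp only: mult_ac)
  qed
qed

section \<open>From finite sums to the stated suprema and series\<close>

lemma infsum_ennreal_le:
  assumes "\<And>F. finite F \<Longrightarrow> F \<subseteq> A \<Longrightarrow> (\<Sum>k\<in>F. f k) \<le> B" "\<And>k. k \<in> A \<Longrightarrow> 0 \<le> f k"
  shows "(\<Sum>\<^sub>\<infinity>k\<in>A. ennreal (f k)) \<le> ennreal B"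
proof (rule infsum_le_finite_sums)
  show "(\<lambda>k. ennreal (f k)) summable_on A" by (rule nonneg_summable_on_complete) simp
  fix F assume F: "finite F" "F \<subseteq> A"
  then have "(\<Sum>k\<in>F. ennreal (f k)) = ennreal (\<Sum>k\<in>F. f k)" using assms(2) by (intro sum_ennreal) auto
  then show "(\<Sum>k\<in>F. ennreal (f k)) \<le> ennreal B" using assms(1)[OF F] by (simp add: ennreal_leI)
qed

theorem lemma2p15:
  fixes J :: "real set" and Lam lam \<alpha> s :: real and g P \<phi>\<^sub>0 :: "real \<Rightarrow> real"
  assumes P: "annular_cutoff P"
    and phi: "lp_generator \<phi>\<^sub>0"
    and J: "is_interval J" "J \<subseteq> {0<..}"
    and params: "Lam > 0" "lam > 0" "\<alpha> \<noteq> -2"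
    and g: "C_k_on 2 g {0<..}"
    and g1: "\<forall>y\<in>J. \<bar>deriv g y\<bar> \<ge> lam * y powr (\<alpha> + 1)"
    and g2: "\<forall>y\<in>J. \<bar>(deriv ^^ 2) g y\<bar> \<ge> lam * y powr \<alpha>"
  shows
    "((\<alpha> > s \<and> s > -2) \<or> (\<alpha> < s \<and> s < -2) \<longrightarrow>
       (\<exists>C>0. \<forall>t \<delta>. t \<noteq> 0 \<longrightarrow> \<delta> > 0 \<longrightarrow>
          (\<Sum>\<^sub>\<infinity>k\<in>dyadic_indices J. SUP x. ennreal (cmod (I_dyadic g P s t \<delta> x k)))
            \<le> ennreal (C * (\<delta> powr (- ((\<alpha> + 1) * (s + 2) / (2 + \<alpha>)))
                              / \<bar>t\<bar> powr ((s + 2) / (2 + \<alpha>)))) \<and>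
          (\<forall>x. lp_integral_converges g \<phi>\<^sub>0 J s t \<delta> x) \<and>
          (SUP x. ennreal (cmod (lp_integral g \<phi>\<^sub>0 J s t \<delta> x)))
            \<le> ennreal (C * (\<delta> powr (- ((\<alpha> + 1) * (s + 2) / (2 + \<alpha>)))
                              / \<bar>t\<bar> powr ((s + 2) / (2 + \<alpha>))))))
     \<and>
     (s = \<alpha> \<and> \<alpha> \<notin> {-2, -1} \<and> C_k_on 3 g {0<..} \<and>
      (\<forall>y\<in>J. \<bar>deriv g y\<bar> \<le> Lam * y powr (\<alpha> + 1)) \<and>
      (\<forall>y\<in>J. \<bar>(deriv ^^ 2) g y\<bar> \<le> Lam * y powr \<alpha>) \<and>
      (\<forall>y\<in>J. \<bar>(deriv ^^ 3) g y\<bar> \<le> Lam * y powr (\<alpha> - 1)) \<longrightarrow>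
       (\<exists>C>0. \<forall>t \<delta>. t \<noteq> 0 \<longrightarrow> \<delta> > 0 \<longrightarrow>
          (SUP x. \<Sum>\<^sub>\<infinity>k\<in>dyadic_indices J. ennreal (cmod (I_dyadic g P \<alpha> t \<delta> x k)))
            \<le> ennreal (C * (\<delta> powr (- (\<alpha> + 1)) / \<bar>t\<bar>)) \<and>
          (\<forall>x. lp_integral_converges g \<phi>\<^sub>0 J \<alpha> t \<delta> x) \<and>
          (SUP x. ennreal (cmod (lp_integral g \<phi>\<^sub>0 J \<alpha> t \<delta> x)))
            \<le> ennreal (C * (\<delta> powr (- (\<alpha> + 1)) / \<bar>t\<bar>))))"
proof (intro conjI impI)
  let ?D = "dyadic_indices J"
  have P': "C2_annular P" by (rule annular_cutoff_C2_annular[OF P])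
  have Q': "C2_annular (lp_Q \<phi>\<^sub>0 0)" by (rule lp_Q_C2_annular[OF phi])
  have cg: "continuous_on {0<..} g"
    by (rule DERIV_continuous_on[OF has_field_derivative_at_within])
      (use C_k_on_has_derivative[OF g open_greaterThan, of _ 0] in simp)
  {
    assume s: "(\<alpha> > s \<and> s > -2) \<or> (\<alpha> < s \<and> s < -2)"
    obtain CP where CP: "CP > 0" and bP: "\<And>t \<delta>. t \<noteq> 0 \<Longrightarrow> \<delta> > 0 \<Longrightarrow>
      \<exists>M. (\<forall>k\<in>?D. \<forall>x. cmod (I_dyadic g P s t \<delta> x k) \<le> M k) \<and>
      (\<forall>F. finite F \<longrightarrow> F \<subseteq> ?D \<longrightarrow> (\<Sum>k\<in>F. M k) \<le> CP * decay_rate \<alpha> s t \<delta>)"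
      using dyadic_sum_sup_bound[OF P' params(2,3) g g1 g2 s] by blast
    obtain CQ where CQ: "CQ > 0" and bQ: "\<And>t \<delta>. t \<noteq> 0 \<Longrightarrow> \<delta> > 0 \<Longrightarrow>
      \<exists>M. (\<forall>k\<in>?D. \<forall>x. cmod (I_dyadic g (lp_Q \<phi>\<^sub>0 0) s t \<delta> x k) \<le> M k) \<and>
      (\<forall>F. finite F \<longrightarrow> F \<subseteq> ?D \<longrightarrow> (\<Sum>k\<in>F. M k) \<le> CQ * decay_rate \<alpha> s t \<delta>)"
      using dyadic_sum_sup_bound[OF Q' params(2,3) g g1 g2 s] by blast
    let ?C = "max CP CQ"
    show "\<exists>C>0. \<forall>t \<delta>. t \<noteq> 0 \<longrightarrow> \<delta> > 0 \<longrightarrow>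
          (\<Sum>\<^sub>\<infinity>k\<in>?D. SUP x. ennreal (cmod (I_dyadic g P s t \<delta> x k)))
            \<le> ennreal (C * (\<delta> powr (- ((\<alpha> + 1) * (s + 2) / (2 + \<alpha>)))
                              / \<bar>t\<bar> powr ((s + 2) / (2 + \<alpha>)))) \<and>
          (\<forall>x. lp_integral_converges g \<phi>\<^sub>0 J s t \<delta> x) \<and>
          (SUP x. ennreal (cmod (lp_integral g \<phi>\<^sub>0 J s t \<delta> x)))
            \<le> ennreal (C * (\<delta> powr (- ((\<alpha> + 1) * (s + 2) / (2 + \<alpha>)))
                              / \<bar>t\<bar> powr ((s + 2) / (2 + \<alpha>))))"
      unfolding decay_rate_def[symmetric]
    proof (intro exI[of _ ?C] conjI allI impI)
      show "0 < ?C" using CP by simp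
      fix t \<delta> :: real assume t: "t \<noteq> 0" and \<delta>: "\<delta> > 0"
      let ?E = "decay_rate \<alpha> s t \<delta>"
      have le: "CP * ?E \<le> ?C * ?E" "CQ * ?E \<le> ?C * ?E"
        using decay_rate_nonneg by (intro mult_right_mono; simp)+
      obtain M where M: "\<And>k x. k \<in> ?D \<Longrightarrow> cmod (I_dyadic g P s t \<delta> x k) \<le> M k"
        "\<And>F. finite F \<Longrightarrow> F \<subseteq> ?D \<Longrightarrow> (\<Sum>k\<in>F. M k) \<le> CP * ?E"
        using bP[OF t \<delta>] by blast
      \<comment> \<open>Each supremum is bounded by the x-independent \<open>M k\<close> before
        summing. In \<open>ennreal\<close> summability is automatic.\<close>
      have "(\<Sum>\<^sub>\<infinity>k\<in>?D. SUP x. ennreal (cmod (I_dyadic g P s t \<delta> x k))) \<le> (\<Sum>\<^sub>\<infinity>k\<in>?D. ennreal (M k))"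
        by (intro infsum_mono nonneg_summable_on_complete SUP_least ennreal_leI M) auto
      also have "\<dots> \<le> ennreal (?C * ?E)"
      proof (rule infsum_ennreal_le)
        show "(\<Sum>k\<in>F. M k) \<le> ?C * ?E" if "finite F" "F \<subseteq> ?D" for F using M(2)[OF that] le by linarith
        show "0 \<le> M k" if "k \<in> ?D" for k using M(1)[OF that, of 0] norm_ge_zero order_trans by blast
      qed
      finally show "(\<Sum>\<^sub>\<infinity>k\<in>?D. SUP x. ennreal (cmod (I_dyadic g P s t \<delta> x k))) \<le> ennreal (?C * ?E)" .
      obtain M' where M': "\<And>k x. k \<in> ?D \<Longrightarrow> cmod (I_dyadic g (lp_Q \<phi>\<^sub>0 0) s t \<delta> x k) \<le> M' k"
        "\<And>F. finite F \<Longrightarrow> F \<subseteq> ?D \<Longrightarrow> (\<Sum>k\<in>F. M' k) \<le> CQ * ?E"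
        using bQ[OF t \<delta>] by blast
      have sumQ: "(\<Sum>k\<in>F. cmod (I_dyadic g (lp_Q \<phi>\<^sub>0 0) s t \<delta> x k)) \<le> ?C * ?E" if F: "finite F" "F \<subseteq> ?D" for F x
      proof -
        have "(\<Sum>k\<in>F. cmod (I_dyadic g (lp_Q \<phi>\<^sub>0 0) s t \<delta> x k)) \<le> (\<Sum>k\<in>F. M' k)"
          using F by (intro sum_mono M') auto
        then show ?thesis using M'(2)[OF F] le by linarith
      qed
      show "lp_integral_converges g \<phi>\<^sub>0 J s t \<delta> x" for x
        by (rule lp_integral_bound(1)[OF phi cg \<delta> sumQ])
      show "(SUP x. ennreal (cmod (lp_integral g \<phi>\<^sub>0 J s t \<delta> x))) \<le> ennreal (?C * ?E)"
        by (intro SUP_least ennreal_leI lp_integral_bound(2)[OF phi cg \<delta> sumQ])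
    qed
  }
  {
    assume h: "s = \<alpha> \<and> \<alpha> \<notin> {-2, -1} \<and> C_k_on 3 g {0<..} \<and>
      (\<forall>y\<in>J. \<bar>deriv g y\<bar> \<le> Lam * y powr (\<alpha> + 1)) \<and>
      (\<forall>y\<in>J. \<bar>(deriv ^^ 2) g y\<bar> \<le> Lam * y powr \<alpha>) \<and>
      (\<forall>y\<in>J. \<bar>(deriv ^^ 3) g y\<bar> \<le> Lam * y powr (\<alpha> - 1))"
    then have \<alpha>1: "\<alpha> \<noteq> -1" and g3: "C_k_on 3 g {0<..}"
      and u: "\<forall>y\<in>J. \<bar>deriv g y\<bar> \<le> Lam * y powr (\<alpha> + 1)" "\<forall>y\<in>J. \<bar>(deriv ^^ 2) g y\<bar> \<le> Lam * y powr \<alpha>"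
        "\<forall>y\<in>J. \<bar>(deriv ^^ 3) g y\<bar> \<le> Lam * y powr (\<alpha> - 1)"
      by auto
    obtain CP where CP: "CP > 0" and bP: "\<And>t \<delta> x F. t \<noteq> 0 \<Longrightarrow> \<delta> > 0 \<Longrightarrow> finite F \<Longrightarrow> F \<subseteq> ?D \<Longrightarrow>
      (\<Sum>k\<in>F. cmod (I_dyadic g P \<alpha> t \<delta> x k)) \<le> CP * decay_rate \<alpha> \<alpha> t \<delta>"
      using dyadic_sum_bound_critical[OF P' params(2,1,3) \<alpha>1 g g3 g1 u(1) g2 u(2,3)] by blast
    obtain CQ where CQ: "CQ > 0" and bQ: "\<And>t \<delta> x F. t \<noteq> 0 \<Longrightarrow> \<delta> > 0 \<Longrightarrow> finite F \<Longrightarrow> F \<subseteq> ?D \<Longrightarrow>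
      (\<Sum>k\<in>F. cmod (I_dyadic g (lp_Q \<phi>\<^sub>0 0) \<alpha> t \<delta> x k)) \<le> CQ * decay_rate \<alpha> \<alpha> t \<delta>"
      using dyadic_sum_bound_critical[OF Q' params(2,1,3) \<alpha>1 g g3 g1 u(1) g2 u(2,3)] by blast
    let ?C = "max CP CQ"
    show "\<exists>C>0. \<forall>t \<delta>. t \<noteq> 0 \<longrightarrow> \<delta> > 0 \<longrightarrow>
          (SUP x. \<Sum>\<^sub>\<infinity>k\<in>?D. ennreal (cmod (I_dyadic g P \<alpha> t \<delta> x k)))
            \<le> ennreal (C * (\<delta> powr (- (\<alpha> + 1)) / \<bar>t\<bar>)) \<and>
          (\<forall>x. lp_integral_converges g \<phi>\<^sub>0 J \<alpha> t \<delta> x) \<and>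
          (SUP x. ennreal (cmod (lp_integral g \<phi>\<^sub>0 J \<alpha> t \<delta> x)))
            \<le> ennreal (C * (\<delta> powr (- (\<alpha> + 1)) / \<bar>t\<bar>))"
    proof (intro exI[of _ ?C] allI impI conjI)
      show "0 < ?C" using CP by simp
      fix t \<delta> :: real assume t: "t \<noteq> 0" and \<delta>: "\<delta> > 0"
      let ?E = "decay_rate \<alpha> \<alpha> t \<delta>"
      \<comment> \<open>For s = \<alpha> the quotient (s + 2) / (2 + \<alpha>) is 1, so the general
        rate takes the form stated in (2).\<close>
      have E: "\<delta> powr (- (\<alpha> + 1)) / \<bar>t\<bar> = ?E"
      proof -
        have "\<alpha> + 2 \<noteq> 0" using params(3) by linarith
        then show ?thesis using t by (simp add: decay_rate_def add.commute[of 2 \<alpha>])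
      qed
      have le: "CP * ?E \<le> ?C * ?E" "CQ * ?E \<le> ?C * ?E"
        using decay_rate_nonneg by (intro mult_right_mono; simp)+
      have sumP: "(\<Sum>k\<in>F. cmod (I_dyadic g P \<alpha> t \<delta> x k)) \<le> ?C * ?E" if "finite F" "F \<subseteq> ?D" for F x
        using bP[OF t \<delta> that, of x] le by linarith
      have sumQ: "(\<Sum>k\<in>F. cmod (I_dyadic g (lp_Q \<phi>\<^sub>0 0) \<alpha> t \<delta> x k)) \<le> ?C * ?E" if "finite F" "F \<subseteq> ?D" for F x
        using bQ[OF t \<delta> that, of x] le by linarith
      show "(SUP x. \<Sum>\<^sub>\<infinity>k\<in>?D. ennreal (cmod (I_dyadic g P \<alpha> t \<delta> x k))) \<le> ennreal (?C * (\<delta> powr (- (\<alpha> + 1)) / \<bar>t\<bar>))"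
        unfolding E by (intro SUP_least infsum_ennreal_le sumP) auto
      show "lp_integral_converges g \<phi>\<^sub>0 J \<alpha> t \<delta> x" for x
        by (rule lp_integral_bound(1)[OF phi cg \<delta> sumQ])
      show "(SUP x. ennreal (cmod (lp_integral g \<phi>\<^sub>0 J \<alpha> t \<delta> x))) \<le> ennreal (?C * (\<delta> powr (- (\<alpha> + 1)) / \<bar>t\<bar>))"
        unfolding E by (intro SUP_least ennreal_leI lp_integral_bound(2)[OF phi cg \<delta> sumQ])
    qed
  }
qed

end
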